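(* Let $\mathcal H$ be a homogeneous foliation of degree $d\ge3$ on $\mathbb P^2_{\mathbb C}$, of type $\mathcal T_{\mathcal H}$. If $\deg\mathcal T_{\mathcal H}=2$, then the $d$-web $\mathrm{Leg}\,\mathcal H$ is flat if and only if $\mathcal H$ is linearly conjugate to one of the two foliations $\mathcal H_1^d$ and $\mathcal H_2^d$ described respectively by the $1$-forms 1. $\omega_1^d=y^d\mathrm dx-x^d\mathrm dy$; 2. $\omega_2^d=x^d\mathrm dx-y^d\mathrm dy$.
   Context: Foliations. A foliation of degree $d$ on $\mathbb P^2_{\mathbb C}$ is given in homogeneous coordinates $[x:y:z]$, up to a nonzero scalar, by a $1$-form $\alpha\,\mathrm dx+\beta\,\mathrm dy+\gamma\,\mathrm dz$ with homogeneous coefficients of degree $d+1$ without common factor satisfying $x\alpha+y\beta+z\gamma=0$; in the affine chart $z=1$ it is described by a polynomial $1$-form with coprime coefficients. It is homogeneous if in some affine chart $(x,y)$ it is invariant under all homotheties $(x,y)\mapsto\lambda(x,y)$; it is then described by $\omega=A\,\mathrm dx+B\,\mathrm dy$ with $A,B$ homogeneous of degree $d$ without common factor. Linearly conjugate means conjugate under $\mathrm{PGL}_3(\mathbb C)=\mathrm{Aut}(\mathbb P^2_{\mathbb C})$. Radial singularities. Let $s$ be a singular point of a foliation $\mathcal F$ defined near $s$ by a vector field $\mathrm X$ with isolated zeros. $\nu(\mathcal F,s)$ is the vanishing order of $\mathrm X$ at $s$. For a line $\ell=\{f=0\}$ through $s$ not $\mathcal F$-invariant, $\mathrm{Tang}(\mathcal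 F,\ell,s)=\dim_{\mathbb C}\mathcal O_s/\langle f,\mathrm X(f)\rangle$; $\tau(\mathcal F,s)$ is the minimum of these numbers over all such lines. The point $s$ is radial of order $\tau(\mathcal F,s)-1$ if $\nu(\mathcal F,s)=1$ and $\tau(\mathcal F,s)\ge2$. Type. For $\mathcal H$ a homogeneous foliation of degree $d$ described in an affine chart $(x,y)$ by $\omega=A\,\mathrm dx+B\,\mathrm dy$, with $A,B$ homogeneous polynomials of degree $d$ without common factor, put $\mathrm D_{\mathcal H}=A_xB_y-A_yB_x$. A transverse inflection line of order $m\geq 1$ is a line through the origin, not $\mathcal H$-invariant, dividing $\mathrm D_{\mathcal H}$ with multiplicity exactly $m$. If $r_k$ is the number of radial singularities of order $k$ of $\mathcal H$ and $t_k$ the number of its transverse inflection lines of order $k$, the type of $\mathcal H$ is the formal sum $\mathcal T_{\mathcal H}=\sum_{k=1}^{d-1}(r_k\cdot\mathrm R_k+t_k\cdot\mathrm T_k)$ in formal variables $\mathrm R_k,\mathrm T_k$, and $\deg\mathcal T_{\mathcal H}=\sum_{k=1}^{d-1}(r_k+t_k)$, which is the number of distinct lines composing the divisor $\mathrm D_{\mathcal H}=0$. Webs and Legendre transform. A $k$-web on a complex surface is given locally by a $k$-symmetric holomorphic $1$-form with isolated zeros (well defined up to units, compatible on overlaps) which at a generic point factors as a product of $k$ pairwise non-collinear linear forms. The set where this fails is the discriminant $\Delta(\mathcal W)$. The Legendre transform $\mathrm{Leg}\,\mathcal H$ is the $d$-web on the dual plane $\check{\mathbb P}^2_{\mathbb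 C}$ whose leaves are the families of tangent lines to the leaves of $\mathcal H$. In the affine chart $(p,q)$ of $\check{\mathbb P}^2_{\mathbb C}$ corresponding to the line $\{y=px-q\}$ it is given by $A(x,px-q)+pB(x,px-q)=0$ with $x=\frac{\mathrm dq}{\mathrm dp}$. Curvature. For a germ of web $\mathcal W=\mathcal F_1\boxtimes\cdots\boxtimes\mathcal F_k$ superposed from foliations defined by $1$-forms $\theta_i$ in coordinates $(u,v)$, write $\theta_i\wedge\theta_j=\delta_{ij}\,\mathrm du\wedge\mathrm dv$. For $r<s<t$ let $\eta_{rst}$ be the unique meromorphic $1$-form with $\mathrm d(\delta_{st}\theta_r)=\eta_{rst}\wedge\delta_{st}\theta_r$, $\mathrm d(\delta_{tr}\theta_s)=\eta_{rst}\wedge\delta_{tr}\theta_s$, $\mathrm d(\delta_{rs}\theta_t)=\eta_{rst}\wedge\delta_{rs}\theta_t$. The curvature $K(\mathcal W)=\mathrm d(\sum_{r<s<t}\eta_{rst})$ does not depend on choices. For a general web these local forms glue to a global meromorphic $2$-form with poles in $\Delta(\mathcal W)$. The web is flat if $K(\mathcal W)\equiv0$. *)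

theory Defs
  imports
    "HOL-Analysis.Analysis"
    "HOL-Computational_Algebra.Polynomial"
    "HOL-Library.Landau_Symbols"
    "HOL-Library.Multiset"
    "HOL-Library.Extended_Nat"
begin

section \<open>Polynomials in two and three variables\<close>

text \<open>
  A polynomial in \<open>x, y\<close> is an element of \<open>complex poly poly\<close> and a polynomial in \<open>x, y, z\<close> an
  element of \<open>complex poly poly poly\<close>. The innermost variable is \<open>x\<close>, the outermost one is \<open>y\<close>
  (resp. \<open>z\<close>).
\<close>

type_synonym poly2 = "complex poly poly"
type_synonym poly3 = "complex poly poly poly"

definition var_x :: poly2 where "var_x = [:[:0, 1:]:]"
definition var_y :: poly2 where "var_y = [:0, 1:]"

definition eval2 :: "poly2 \<Rightarrow> complex \<times> complex \<Rightarrow> complex" where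
  "eval2 P v = poly (poly P [:snd v:]) (fst v)"

definition eval3 :: "poly3 \<Rightarrow> complex ^ 3 \<Rightarrow> complex" where
  "eval3 P v = poly (poly (poly P [:[:v $ 3:]:]) [:v $ 2:]) (v $ 1)"

definition homogeneous2 :: "nat \<Rightarrow> poly2 \<Rightarrow> bool" where
  "homogeneous2 n P \<longleftrightarrow> (\<forall>i j. coeff (coeff P j) i \<noteq> 0 \<longrightarrow> i + j = n)"

definition homogeneous3 :: "nat \<Rightarrow> poly3 \<Rightarrow> bool" where
  "homogeneous3 n P \<longleftrightarrow> (\<forall>i j k. coeff (coeff (coeff P k) j) i \<noteq> 0 \<longrightarrow> i + j + k = n)"

definition deriv_x :: "poly2 \<Rightarrow> poly2" where "deriv_x P = map_poly pderiv P"
definition deriv_y :: "poly2 \<Rightarrow> poly2" where "deriv_y P = pderiv P"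


section \<open>Foliations on the projective plane\<close>

text \<open>
  The vector \<open>F\<close> stands for the homogeneous \<open>1\<close>-form \<open>F$1 dx + F$2 dy + F$3 dz\<close>.
\<close>

type_synonym form3 = "poly3 ^ 3"

definition eval_form :: "form3 \<Rightarrow> complex ^ 3 \<Rightarrow> complex ^ 3" where
  "eval_form F v = (\<chi> i. eval3 (F $ i) v)"

definition foliation :: "nat \<Rightarrow> form3 \<Rightarrow> bool" where
  "foliation d F \<longleftrightarrow>
     (\<forall>i. homogeneous3 (d + 1) (F $ i)) \<and>
     (\<forall>Q. (\<forall>i. Q dvd F $ i) \<longrightarrow> is_unit Q) \<and>
     [:var_x:] * F $ 1 + [:var_y:] * F $ 2 + [:0, 1:] * F $ 3 = 0"

text \<open>
  \<open>is_pullback g F G\<close>: the form \<open>G\<close> is, up to a nonzero scalar, the pullback of \<open>F\<close> under the linear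
  map \<open>g\<close>; polynomials over the complex numbers are determined by their values. For invertible
  \<open>g\<close>, \<open>G\<close> is thus the same foliation read in the homogeneous coordinates given by \<open>g\<close>, whose affine
  chart \<open>z = 1\<close> is \<open>(x, y) \<mapsto> [g (x, y, 1)]\<close>. All affine charts of the plane arise in this way.
\<close>

definition is_pullback :: "complex ^ 3 ^ 3 \<Rightarrow> form3 \<Rightarrow> form3 \<Rightarrow> bool" where
  "is_pullback g F G \<longleftrightarrow>
     (\<exists>c. c \<noteq> 0 \<and> (\<forall>v. eval_form G v = c *s (transpose g *v eval_form F (g *v v))))"

definition linearly_conjugate :: "form3 \<Rightarrow> form3 \<Rightarrow> bool" where
  "linearly_conjugate F G \<longleftrightarrow> (\<exists>g. invertible g \<and> is_pullback g F G)"

definition homothety :: "complex \<Rightarrow> complex ^ 3 ^ 3" where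
  "homothety c = vector [vector [c, 0, 0], vector [0, c, 0], vector [0, 0, 1]]"

definition homogeneous_foliation :: "nat \<Rightarrow> form3 \<Rightarrow> bool" where
  "homogeneous_foliation d F \<longleftrightarrow> foliation d F \<and>
     (\<exists>g G. invertible g \<and> is_pullback g F G \<and>
        (\<forall>c. c \<noteq> 0 \<longrightarrow> is_pullback (homothety c) G G))"

text \<open>
  The homogeneous form defining the foliation which is given by \<open>A dx + B dy\<close> in the chart \<open>z = 1\<close>,
  for \<open>A, B\<close> homogeneous of the same degree: \<open>z A dx + z B dy - (x A + y B) dz\<close>.
\<close>

definition projective_form :: "poly2 \<Rightarrow> poly2 \<Rightarrow> form3" where
  "projective_form A B = vector [[:0, A:], [:0, B:], [:- (var_x * A + var_y * B):]]"

text \<open>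
  \<open>F\<close> is described by \<open>A dx + B dy\<close> in the affine chart \<open>(x, y) \<mapsto> [g (x, y, 1)]\<close>, with \<open>A, B\<close>
  homogeneous of degree \<open>d\<close> without common factor.
\<close>

definition described_in_chart :: "nat \<Rightarrow> form3 \<Rightarrow> complex ^ 3 ^ 3 \<Rightarrow> poly2 \<Rightarrow> poly2 \<Rightarrow> bool" where
  "described_in_chart d F g A B \<longleftrightarrow> invertible g \<and>
     homogeneous2 d A \<and> homogeneous2 d B \<and> coprime A B \<and>
     is_pullback g F (projective_form A B)"

definition H1 :: "nat \<Rightarrow> form3" where
  "H1 d = projective_form (var_y ^ d) (- (var_x ^ d))"

definition H2 :: "nat \<Rightarrow> form3" where
  "H2 d = projective_form (var_x ^ d) (- (var_y ^ d))"


section \<open>Holomorphic functions of two variables and their germs at the origin\<close>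

definition holomorphic2_on :: "(complex \<times> complex \<Rightarrow> complex) \<Rightarrow> (complex \<times> complex) set \<Rightarrow> bool" where
  "holomorphic2_on f U \<longleftrightarrow>
     (\<forall>z\<in>U. \<exists>a b. (f has_derivative (\<lambda>h. a * fst h + b * snd h)) (at z))"

text \<open>
  Germs are represented by total functions; two functions define the same germ if they agree
  eventually in \<open>nhds 0\<close>.
\<close>

definition is_germ :: "(complex \<times> complex \<Rightarrow> complex) \<Rightarrow> bool" where
  "is_germ h \<longleftrightarrow> (\<exists>U. open U \<and> 0 \<in> U \<and> holomorphic2_on h U)"

definition in_germ_ideal ::
  "(complex \<times> complex \<Rightarrow> complex) \<Rightarrow> (complex \<times> complex \<Rightarrow> complex) \<Rightarrow>
   (complex \<times> complex \<Rightarrow> complex) \<Rightarrow> bool" where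
  "in_germ_ideal f g h \<longleftrightarrow>
     (\<exists>a b. is_germ a \<and> is_germ b \<and> (\<forall>\<^sub>F z in nhds 0. h z = a z * f z + b z * g z))"

text \<open>
  The complex dimension of the quotient of the local ring by the ideal generated by \<open>f\<close> and \<open>g\<close>, as
  the least cardinality of a spanning family.
\<close>

definition germ_codim ::
  "(complex \<times> complex \<Rightarrow> complex) \<Rightarrow> (complex \<times> complex \<Rightarrow> complex) \<Rightarrow> enat" where
  "germ_codim f g = Inf {enat n | n. \<exists>e :: nat \<Rightarrow> complex \<times> complex \<Rightarrow> complex.
     (\<forall>i<n. is_germ (e i)) \<and>
     (\<forall>h. is_germ h \<longrightarrow>
        (\<exists>c :: nat \<Rightarrow> complex. in_germ_ideal f g (\<lambda>z. h z - (\<Sum>i<n. c i * e i z))))}"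


section \<open>Radial singularities\<close>

text \<open>In this section \<open>X\<close> is a vector field near the origin, given by its two components.\<close>

definition vanishing_order :: "(complex \<times> complex \<Rightarrow> complex \<times> complex) \<Rightarrow> enat" where
  "vanishing_order X =
     Sup {enat n | n. (\<lambda>z. norm (X z)) \<in> bigo (at 0) (\<lambda>z. norm z ^ n)}"

definition line_eq :: "complex \<Rightarrow> complex \<Rightarrow> complex \<times> complex \<Rightarrow> complex" where
  "line_eq a b z = a * fst z + b * snd z"

text \<open>The derivative \<open>X(f)\<close> of \<open>f = line_eq a b\<close> along \<open>X\<close>.\<close>

definition lie_line ::
  "(complex \<times> complex \<Rightarrow> complex \<times> complex) \<Rightarrow> complex \<Rightarrow> complex \<Rightarrow> complex \<times> complex \<Rightarrow> complex" where
  "lie_line X a b z = a * fst (X z) + b * snd (X z)"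

definition germ_invariant_line ::
  "(complex \<times> complex \<Rightarrow> complex \<times> complex) \<Rightarrow> complex \<Rightarrow> complex \<Rightarrow> bool" where
  "germ_invariant_line X a b \<longleftrightarrow>
     (\<forall>\<^sub>F z in nhds 0. line_eq a b z = 0 \<longrightarrow> lie_line X a b z = 0)"

definition tang ::
  "(complex \<times> complex \<Rightarrow> complex \<times> complex) \<Rightarrow> complex \<Rightarrow> complex \<Rightarrow> enat" where
  "tang X a b = germ_codim (line_eq a b) (lie_line X a b)"

definition tangency_order :: "(complex \<times> complex \<Rightarrow> complex \<times> complex) \<Rightarrow> enat" where
  "tangency_order X =
     Inf {tang X a b | a b. (a, b) \<noteq> (0, 0) \<and> \<not> germ_invariant_line X a b}"

text \<open>
  The foliation \<open>F\<close> in the chart \<open>(x, y) \<mapsto> [g (x, y, 1)]\<close> is \<open>A dx + B dy = 0\<close>, with \<open>A, B\<close> the first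
  two components of the pullback; it is defined by the vector field \<open>B \<partial>/\<partial>x - A \<partial>/\<partial>y\<close>, which has
  isolated zeros since \<open>A\<close> and \<open>B\<close> are coprime.
\<close>

definition local_field :: "form3 \<Rightarrow> complex ^ 3 ^ 3 \<Rightarrow> complex \<times> complex \<Rightarrow> complex \<times> complex" where
  "local_field F g z =
     (let w = transpose g *v eval_form F (g *v vector [fst z, snd z, 1]) in (w $ 2, - (w $ 1)))"

text \<open>Points of the projective plane are the lines of the vector space \<open>complex ^ 3\<close>.\<close>

definition projective_plane :: "(complex ^ 3) set set" where
  "projective_plane = {vec.span {v} | v. v \<noteq> 0}"

definition singular_point :: "form3 \<Rightarrow> (complex ^ 3) set \<Rightarrow> bool" where
  "singular_point F s \<longleftrightarrow> s \<in> projective_plane \<and> (\<forall>v\<in>s. eval_form F v = 0)"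

text \<open>
  The orders are computed in an affine chart centred at \<open>s\<close>; they do not depend on the chart, and
  the projective lines through \<open>s\<close> are the lines through the origin of the chart.
\<close>

definition radial_singularity :: "form3 \<Rightarrow> nat \<Rightarrow> (complex ^ 3) set \<Rightarrow> bool" where
  "radial_singularity F k s \<longleftrightarrow> singular_point F s \<and>
     (\<exists>g. invertible g \<and> g *v vector [0, 0, 1] \<in> s \<and>
        vanishing_order (local_field F g) = 1 \<and>
        tangency_order (local_field F g) \<ge> 2 \<and>
        tangency_order (local_field F g) - 1 = enat k)"

definition radial_count :: "form3 \<Rightarrow> nat \<Rightarrow> nat" where
  "radial_count F k = card {s. radial_singularity F k s}"


section \<open>Transverse inflection lines and the type\<close>

definition inflection_poly :: "poly2 \<Rightarrow> poly2 \<Rightarrow> poly2" where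
  "inflection_poly A B = deriv_x A * deriv_y B - deriv_y A * deriv_x B"

definition invariant_line :: "poly2 \<Rightarrow> poly2 \<Rightarrow> (complex \<times> complex) set \<Rightarrow> bool" where
  "invariant_line A B l \<longleftrightarrow>
     (\<forall>v\<in>l. \<forall>w\<in>l. eval2 A v * fst w + eval2 B v * snd w = 0)"

definition transverse_inflection_line ::
  "poly2 \<Rightarrow> poly2 \<Rightarrow> nat \<Rightarrow> (complex \<times> complex) set \<Rightarrow> bool" where
  "transverse_inflection_line A B m l \<longleftrightarrow>
     (\<exists>a b. (a, b) \<noteq> (0, 0) \<and> l = {v. line_eq a b v = 0} \<and> \<not> invariant_line A B l \<and>
        ([:[:a:]:] * var_x + [:[:b:]:] * var_y) ^ m dvd inflection_poly A B \<and>
        \<not> ([:[:a:]:] * var_x + [:[:b:]:] * var_y) ^ Suc m dvd inflection_poly A B)"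

definition transverse_count :: "poly2 \<Rightarrow> poly2 \<Rightarrow> nat \<Rightarrow> nat" where
  "transverse_count A B k = card {l. transverse_inflection_line A B k l}"

text \<open>
  The type is a formal sum of the formal variables \<open>R k\<close> and \<open>T k\<close> with natural coefficients, i.e. a
  multiset; its degree, the sum of the coefficients, is the size of the multiset.
\<close>

datatype type_var = R nat | T nat

definition foliation_type :: "nat \<Rightarrow> form3 \<Rightarrow> poly2 \<Rightarrow> poly2 \<Rightarrow> type_var multiset" where
  "foliation_type d F A B =
     (\<Sum>k = 1..d - 1. replicate_mset (radial_count F k) (R k) +
                      replicate_mset (transverse_count A B k) (T k))"


section \<open>Webs and their curvature\<close>

text \<open>
  In coordinates \<open>(u, v)\<close>, a \<open>1\<close>-form \<open>P du + Q dv\<close> is represented by the function \<open>z \<mapsto> (P z, Q z)\<close>,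
  and a \<open>2\<close>-form by its coefficient with respect to \<open>du \<and> dv\<close>.
\<close>

type_synonym form1 = "complex \<times> complex \<Rightarrow> complex \<times> complex"

definition apply_form :: "complex \<times> complex \<Rightarrow> complex \<times> complex \<Rightarrow> complex" where
  "apply_form e w = fst e * fst w + snd e * snd w"

definition wedge :: "complex \<times> complex \<Rightarrow> complex \<times> complex \<Rightarrow> complex" where
  "wedge e f = fst e * snd f - snd e * fst f"

definition scale_form :: "(complex \<times> complex \<Rightarrow> complex) \<Rightarrow> form1 \<Rightarrow> form1" where
  "scale_form h e z = (h z * fst (e z), h z * snd (e z))"

definition ext_deriv :: "form1 \<Rightarrow> complex \<times> complex \<Rightarrow> complex" where
  "ext_deriv e z =
     deriv (\<lambda>u. snd (e (u, snd z))) (fst z) - deriv (\<lambda>v. fst (e (fst z, v))) (snd z)"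

definition delta :: "(nat \<Rightarrow> form1) \<Rightarrow> nat \<Rightarrow> nat \<Rightarrow> complex \<times> complex \<Rightarrow> complex" where
  "delta \<theta> i j z = wedge (\<theta> i z) (\<theta> j z)"

definition eta :: "(nat \<Rightarrow> form1) \<Rightarrow> nat \<Rightarrow> nat \<Rightarrow> nat \<Rightarrow> form1" where
  "eta \<theta> r s t z = (THE e.
     ext_deriv (scale_form (delta \<theta> s t) (\<theta> r)) z = wedge e (scale_form (delta \<theta> s t) (\<theta> r) z) \<and>
     ext_deriv (scale_form (delta \<theta> t r) (\<theta> s)) z = wedge e (scale_form (delta \<theta> t r) (\<theta> s) z) \<and>
     ext_deriv (scale_form (delta \<theta> r s) (\<theta> t)) z = wedge e (scale_form (delta \<theta> r s) (\<theta> t) z))"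

definition curvature :: "nat \<Rightarrow> (nat \<Rightarrow> form1) \<Rightarrow> complex \<times> complex \<Rightarrow> complex" where
  "curvature k \<theta> =
     ext_deriv (\<lambda>z. \<Sum>(r, s, t)\<in>{(r, s, t). r < s \<and> s < t \<and> t < k}. eta \<theta> r s t z)"

text \<open>
  A \<open>k\<close>-symmetric form on \<open>complex \<times> complex\<close> maps a point and a tangent vector to a complex number,
  being a homogeneous polynomial of degree \<open>k\<close> in the tangent vector.
\<close>

type_synonym symmetric_form = "complex \<times> complex \<Rightarrow> complex \<times> complex \<Rightarrow> complex"

definition decomposition ::
  "nat \<Rightarrow> symmetric_form \<Rightarrow> (complex \<times> complex) set \<Rightarrow> (nat \<Rightarrow> form1) \<Rightarrow> bool" where
  "decomposition k \<Omega> U \<theta> \<longleftrightarrow>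
     (\<forall>i<k. holomorphic2_on (\<lambda>z. fst (\<theta> i z)) U \<and> holomorphic2_on (\<lambda>z. snd (\<theta> i z)) U) \<and>
     (\<forall>i<k. \<forall>j<k. i \<noteq> j \<longrightarrow> (\<forall>z\<in>U. delta \<theta> i j z \<noteq> 0)) \<and>
     (\<forall>z\<in>U. \<forall>w. \<Omega> z w = (\<Prod>i<k. apply_form (\<theta> i z) w))"

text \<open>
  Every point outside the discriminant has a neighbourhood \<open>U\<close> admitting a decomposition, and the
  complement of the discriminant of a web is dense; so this says that the curvature, a meromorphic
  \<open>2\<close>-form with poles in the discriminant, vanishes identically on the domain of \<open>\<Omega>\<close>. Units need no
  separate treatment, as they can be absorbed into one of the factors without changing the curvature.
\<close>

definition flat_form :: "nat \<Rightarrow> symmetric_form \<Rightarrow> bool" where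
  "flat_form k \<Omega> \<longleftrightarrow>
     (\<forall>U \<theta>. open U \<longrightarrow> decomposition k \<Omega> U \<theta> \<longrightarrow> (\<forall>z\<in>U. curvature k \<theta> z = 0))"

text \<open>
  A global web on the dual plane is represented by the set of its defining symmetric forms in the
  various affine charts of the dual plane.
\<close>

definition flat_web :: "nat \<Rightarrow> symmetric_form set \<Rightarrow> bool" where
  "flat_web k W \<longleftrightarrow> (\<forall>\<Omega>\<in>W. flat_form k \<Omega>)"


section \<open>The Legendre transform\<close>

text \<open>
  Write \<open>A dx + B dy\<close> for the form \<open>G\<close> restricted to \<open>z = 1\<close>. In the affine chart \<open>(p, q)\<close> of the dual
  plane corresponding to the line \<open>y = p x - q\<close>, the Legendre transform is given by
  \<open>A(x, p x - q) + p B(x, p x - q) = 0\<close> with \<open>x = dq/dp\<close>: the roots \<open>x\<close> are the points of tangency of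
  the line with the foliation. By the Euler relation this polynomial in \<open>x\<close> has degree at most \<open>d\<close>;
  multiplying by \<open>dp ^ d\<close> gives the symmetric form below, where \<open>w = (dp, dq)\<close>.
\<close>

definition legendre_poly :: "form3 \<Rightarrow> complex \<times> complex \<Rightarrow> complex poly" where
  "legendre_poly G z = (let p = fst z; q = snd z in
     poly (poly (G $ 1) 1) [:- q, p:] + smult p (poly (poly (G $ 2) 1) [:- q, p:]))"

definition legendre_form :: "nat \<Rightarrow> form3 \<Rightarrow> symmetric_form" where
  "legendre_form d G z w = (\<Sum>j\<le>d. coeff (legendre_poly G z) j * snd w ^ j * fst w ^ (d - j))"

definition Leg :: "nat \<Rightarrow> form3 \<Rightarrow> symmetric_form set" where
  "Leg d F = {legendre_form d G | g G. invertible g \<and> is_pullback g F G}"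

end

theory Submission
  imports
    Defs
    "HOL-Computational_Algebra.Fundamental_Theorem_Algebra"
    "HOL-Complex_Analysis.Cauchy_Integral_Formula"
begin

text \<open>
  A homogeneous foliation \<open>A dx + B dy\<close> of degree \<open>d\<close> is governed by the rational map
  \<open>[A : B]\<close> of the projective line. Its ramification divisor is given by
  \<open>D = A_x B_y - A_y B_x\<close>, of degree \<open>2 d - 2\<close>. A line through the origin along which \<open>D\<close>
  vanishes to order \<open>j - 1\<close> carries a member of the pencil spanned by \<open>A\<close> and \<open>B\<close> that
  vanishes to order \<open>j \<le> d\<close> (\<open>pencil_member\<close>). Each such line contributes to the type: as a
  transverse inflection line if it is not invariant, and otherwise through the point where
  it meets the line at infinity, which is then a radial singularity (\<open>transverse_line\<close>,
  \<open>radial_point\<close>). So if the type has degree two, \<open>D\<close> vanishes on at most two lines, to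
  order at most \<open>d - 1\<close> on each; by degree, both orders are \<open>d - 1\<close>. In linear coordinates
  adapted to these two lines the pencil is spanned by \<open>x^d\<close> and \<open>y^d\<close>: the foliation is
  \<open>(a x^d + b y^d) dx + (c x^d + e y^d) dy\<close> with \<open>a e - b c \<noteq> 0\<close>
  (\<open>two_inflection_directions_normal_form\<close>, \<open>binomial_chart\<close>).

  The Legendre transform of such a binomial foliation is explicit in every affine chart of
  the dual plane. Let \<open>(l1, l2, l3)\<close> be the coordinates of the line, as affine functions of
  \<open>(p, q)\<close>, and let \<open>\<sigma>x, \<sigma>y\<close> be the \<open>1\<close>-forms giving the first two coordinates of its point
  of tangency. The web is \<open>f \<sigma>x^d + h \<sigma>y^d = 0\<close> with \<open>f = c l1 - a l2\<close> and
  \<open>h = e l1 - b l2\<close>, up to a constant factor (\<open>legendre_form_binomial\<close>). Its foliations are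
  locally \<open>\<sigma>x - c_i \<omega> \<sigma>y = 0\<close>, where \<open>\<omega>^d = - h / f\<close> and the \<open>c_i\<close> are the \<open>d\<close>-th roots of
  unity. They all belong to one pencil with constant coefficients, so every triple has the
  same \<open>\<eta>\<close> up to logarithmic differentials (\<open>eta_pencil\<close>), and the curvature of the web is
  \<open>d (d - 1) (d - 2) / 6\<close> times the exterior derivative of the form \<open>\<kappa>\<close> with \<open>\<kappa> \<and> \<sigma>x = d\<sigma>x\<close>
  and \<open>(\<kappa> - d\<omega> / \<omega>) \<and> \<sigma>y = d\<sigma>y\<close> (\<open>curvature_binomial_web\<close>).

  For the two foliations of the theorem \<open>\<omega>\<close> is a constant times \<open>(l1 / l2)^\<epsilon>\<close> with
  \<open>\<epsilon> = 1 / d\<close> or \<open>\<epsilon> = - 1 / d\<close>, and \<open>\<kappa> = - \<epsilon> dl2 / l2 + (2 + \<epsilon>) dl3 / l3\<close> is closed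
  (\<open>flat_monomial_pencil\<close>). Conversely, in the chart adapted to the binomial normal form,
  \<open>\<kappa> = (2 + p \<omega>' / \<omega>) dq / q\<close>, where \<open>\<omega>\<close> depends on \<open>p\<close> only, and \<open>d\<kappa> = 0\<close> says that
  \<open>p \<omega>' / \<omega>\<close> is constant. This amounts to \<open>a b = 0\<close> and \<open>e c = 0\<close> (\<open>flat_binomial_web\<close>),
  which leaves \<open>a = e = 0\<close> or \<open>b = c = 0\<close>, and rescaling \<open>x\<close> leads to the two foliations.
\<close>

section \<open>Binary forms restricted to lines\<close>

lemma eval2_simps [simp]:
  "eval2 0 v = 0" "eval2 1 v = 1"
  "eval2 (P + Q) v = eval2 P v + eval2 Q v"
  "eval2 (P - Q) v = eval2 P v - eval2 Q v"
  "eval2 (- P) v = - eval2 P v"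
  "eval2 (P * Q) v = eval2 P v * eval2 Q v"
  "eval2 (P ^ n) v = eval2 P v ^ n"
  "eval2 [:[:c:]:] v = c"
  "eval2 var_x v = fst v" "eval2 var_y v = snd v"
  by (simp_all add: eval2_def var_x_def var_y_def poly_power)

lemma eval2_pCons: "eval2 (pCons c P) v = poly c (fst v) + snd v * eval2 P v"
  by (simp add: eval2_def)

lemma eval2_expansion:
  "eval2 P v = (\<Sum>j\<le>degree P. \<Sum>i\<le>degree (coeff P j). coeff (coeff P j) i * fst v ^ i * snd v ^ j)"
proof -
  have "eval2 P v = (\<Sum>j\<le>degree P. poly (coeff P j) (fst v) * snd v ^ j)"
    by (simp add: eval2_def poly_altdef[of P] poly_sum poly_power)
  then show ?thesis
    by (simp add: poly_altdef[of _ "fst v"] sum_distrib_right)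
qed

lemma eval2_homogeneous:
  assumes "homogeneous2 n P"
  shows "eval2 P (c * x, c * y) = c ^ n * eval2 P (x, y)"
  unfolding eval2_expansion sum_distrib_left
proof (intro sum.cong refl)
  fix i j
  show "coeff (coeff P j) i * fst (c * x, c * y) ^ i * snd (c * x, c * y) ^ j =
         c ^ n * (coeff (coeff P j) i * fst (x, y) ^ i * snd (x, y) ^ j)"
  proof (cases "coeff (coeff P j) i = 0")
    case False
    then have "n = i + j" using assms by (auto simp: homogeneous2_def)
    then show ?thesis by (simp add: power_add power_mult_distrib)
  qed simp
qed

lemma eval2_has_derivative_along_line:
  "((\<lambda>t. eval2 P (v1 + t * u1, v2 + t * u2)) has_field_derivative
     u1 * eval2 (deriv_x P) (v1 + t * u1, v2 + t * u2) +
     u2 * eval2 (deriv_y P) (v1 + t * u1, v2 + t * u2)) (at t)"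
proof (induction P)
  case 0
  then show ?case by (simp add: deriv_x_def deriv_y_def)
next
  case (pCons c P)
  have dx: "deriv_x (pCons c P) = pCons (pderiv c) (deriv_x P)"
    using pCons(1) by (simp add: deriv_x_def map_poly_pCons)
  have dy: "deriv_y (pCons c P) = P + pCons 0 (deriv_y P)"
    by (simp add: deriv_y_def pderiv_pCons)
  show ?case
    unfolding dx dy eval2_pCons eval2_simps fst_conv snd_conv
    by (rule derivative_eq_intros pCons.IH poly_DERIV[THEN DERIV_chain2] refl | simp add: algebra_simps)+
qed

lemma euler_identity:
  assumes "homogeneous2 n P"
  shows "x * eval2 (deriv_x P) (x, y) + y * eval2 (deriv_y P) (x, y) = of_nat n * eval2 P (x, y)"
proof -
  have "((\<lambda>t. eval2 P (t * x, t * y)) has_field_derivative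
      x * eval2 (deriv_x P) (x, y) + y * eval2 (deriv_y P) (x, y)) (at 1)"
    using eval2_has_derivative_along_line[of P 0 x 0 y 1] by simp
  moreover have "((\<lambda>t. eval2 P (t * x, t * y)) has_field_derivative of_nat n * eval2 P (x, y)) (at 1)"
    unfolding eval2_homogeneous[OF assms] by (auto intro!: derivative_eq_intros)
  ultimately show ?thesis by (rule DERIV_unique)
qed

text \<open>
  The polynomial in \<open>t\<close> with values \<open>P (v + t u)\<close>. As a polynomial, not just a function, it
  has a degree and orders of vanishing.
\<close>

definition restrict_line :: "poly2 \<Rightarrow> complex \<times> complex \<Rightarrow> complex \<times> complex \<Rightarrow> complex poly" where
  "restrict_line P v u =
     (\<Sum>j\<le>degree P. pcompose (coeff P j) [:fst v, fst u:] * [:snd v, snd u:] ^ j)"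

lemma poly_restrict:
  "poly (restrict_line P v u) t = eval2 P (fst v + t * fst u, snd v + t * snd u)"
  by (simp add: restrict_line_def eval2_def poly_sum poly_altdef[of P] poly_power poly_pcompose)

lemma degree_restrict:
  assumes "homogeneous2 n P"
  shows "degree (restrict_line P v u) \<le> n"
  unfolding restrict_line_def
proof (rule degree_sum_le)
  fix j
  show "degree (pcompose (coeff P j) [:fst v, fst u:] * [:snd v, snd u:] ^ j) \<le> n"
  proof (cases "coeff P j = 0")
    case False
    then have "coeff (coeff P j) (degree (coeff P j)) \<noteq> 0" by simp
    then have n: "degree (coeff P j) + j = n" using assms by (auto simp: homogeneous2_def)
    have "degree (pcompose (coeff P j) [:fst v, fst u:]) \<le> degree (coeff P j) * 1"
      by (rule order_trans[OF degree_pcompose_le]) (simp add: degree_pCons_le)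
    moreover have "degree ([:snd v, snd u:] ^ j) \<le> 1 * j"
      by (rule order_trans[OF degree_power_le]) simp
    ultimately show ?thesis
      using n degree_mult_le[of "pcompose (coeff P j) [:fst v, fst u:]" "[:snd v, snd u:] ^ j"]
      by linarith
  qed simp
qed simp

lemma poly_eqI_nonzero:
  fixes p q :: "complex poly"
  assumes "\<And>s. s \<noteq> 0 \<Longrightarrow> poly p s = poly q s"
  shows "p = q"
proof -
  have "poly ([:0, 1:] * p) = poly ([:0, 1:] * q)"
    using assms by (auto simp: fun_eq_iff)
  then show ?thesis by (simp only: poly_eq_poly_eq_iff) simp
qed

text \<open>
  In the coordinates \<open>s, t\<close> of a basis \<open>v, u\<close> a binary form is the homogenization of its
  restriction to the affine line \<open>v + t u\<close>. For \<open>s \<noteq> 0\<close> this is homogeneity; as both sides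
  are polynomials in \<open>s\<close>, it remains true for \<open>s = 0\<close>.
\<close>

lemma eval2_in_basis:
  assumes "homogeneous2 n P"
  shows "eval2 P (s * v1 + t * u1, s * v2 + t * u2) =
    (\<Sum>i\<le>n. coeff (restrict_line P (v1, v2) (u1, u2)) i * s ^ (n - i) * t ^ i)"
proof -
  let ?p = "restrict_line P (v1, v2) (u1, u2)"
  let ?q = "\<Sum>i\<le>n. monom (coeff ?p i * t ^ i) (n - i)"
  let ?r = "restrict_line P (t * u1, t * u2) (v1, v2)"
  have "?r = ?q"
  proof (rule poly_eqI_nonzero)
    fix s :: complex assume s: "s \<noteq> 0"
    have "poly ?r s = eval2 P (s * (v1 + (t / s) * u1), s * (v2 + (t / s) * u2))"
      using s by (simp add: poly_restrict algebra_simps)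
    also have "\<dots> = s ^ n * poly ?p (t / s)"
      by (simp add: eval2_homogeneous[OF assms] poly_restrict)
    also have "poly ?p (t / s) = (\<Sum>i\<le>n. coeff ?p i * (t / s) ^ i)"
      using degree_restrict[OF assms] by (subst poly_altdef, intro sum.mono_neutral_left) (auto simp: coeff_eq_0)
    also have "s ^ n * \<dots> = (\<Sum>i\<le>n. coeff ?p i * t ^ i * s ^ (n - i))"
      unfolding sum_distrib_left
      by (rule sum.cong) (use s in \<open>auto simp: power_diff field_simps\<close>)
    also have "\<dots> = poly ?q s"
      by (simp add: poly_sum poly_monom)
    finally show "poly ?r s = poly ?q s" .
  qed
  then have "poly ?r s = poly ?q s" by simp
  then show ?thesis
    by (simp add: poly_restrict poly_sum poly_monom mult_ac add_ac)
qed

text \<open>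
  The affine line \<open>v + t u\<close> misses one direction, that of \<open>u\<close>; the coefficient of \<open>t^n\<close>
  makes up for it.
\<close>

lemma leading_coeff_restrict:
  assumes "homogeneous2 n P"
  shows "coeff (restrict_line P v u) n = eval2 P u"
proof -
  have "eval2 P u = (\<Sum>i\<le>n. coeff (restrict_line P v u) i * 0 ^ (n - i))"
    using eval2_in_basis[OF assms, of 0 "fst v" 1 "fst u" "snd v" "snd u"] by simp
  also have "\<dots> = (\<Sum>i\<le>n. if i = n then coeff (restrict_line P v u) i else 0)"
    by (rule sum.cong) auto
  finally show ?thesis by simp
qed

definition det2 :: "complex \<times> complex \<Rightarrow> complex \<times> complex \<Rightarrow> complex" where
  "det2 v u = fst v * snd u - snd v * fst u"

lemma basis_coordinates:
  assumes "det2 v u \<noteq> 0"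
  obtains s t where "w = (s * fst v + t * fst u, s * snd v + t * snd u)"
proof -
  have "det2 w u * fst v + det2 v w * fst u = det2 v u * fst w"
       "det2 w u * snd v + det2 v w * snd u = det2 v u * snd w"
    by (simp_all add: det2_def algebra_simps)
  then have "w = (det2 w u / det2 v u * fst v + det2 v w / det2 v u * fst u,
             det2 w u / det2 v u * snd v + det2 v w / det2 v u * snd u)"
    using assms by (cases w) (simp add: field_simps)
  then show thesis by (rule that)
qed

lemma restrict_nonzero:
  assumes "homogeneous2 n P" "det2 v u \<noteq> 0" "eval2 P w \<noteq> 0"
  shows "restrict_line P v u \<noteq> 0"
proof
  assume 0: "restrict_line P v u = 0"
  obtain s t where "w = (s * fst v + t * fst u, s * snd v + t * snd u)"
    by (rule basis_coordinates[OF assms(2)])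
  then show False
    using eval2_in_basis[OF assms(1), of s "fst v" t "fst u" "snd v" "snd u"] 0 assms(3) by simp
qed

lemma homogeneous2_mult:
  assumes "homogeneous2 m P" "homogeneous2 n Q"
  shows "homogeneous2 (m + n) (P * Q)"
  unfolding homogeneous2_def
proof (intro allI impI)
  fix i j assume "coeff (coeff (P * Q) j) i \<noteq> 0"
  then have "(\<Sum>k\<le>j. \<Sum>l\<le>i. coeff (coeff P k) l * coeff (coeff Q (j - k)) (i - l)) \<noteq> 0"
    by (simp add: coeff_mult coeff_sum)
  then obtain k where k: "k \<le> j" "(\<Sum>l\<le>i. coeff (coeff P k) l * coeff (coeff Q (j - k)) (i - l)) \<noteq> 0"
    by (meson atMost_iff sum.not_neutral_contains_not_neutral)
  then obtain l where l: "l \<le> i" "coeff (coeff P k) l * coeff (coeff Q (j - k)) (i - l) \<noteq> 0"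
    by (meson atMost_iff sum.not_neutral_contains_not_neutral)
  then have "l + k = m" "(i - l) + (j - k) = n"
    using assms unfolding homogeneous2_def by auto
  with k l show "i + j = m + n" by simp
qed

lemma homogeneous2_add:
  assumes "homogeneous2 n P" "homogeneous2 n Q"
  shows "homogeneous2 n (P + Q)"
  using assms unfolding homogeneous2_def by (metis add.right_neutral coeff_add add_cancel_right_left)

lemma homogeneous2_diff:
  assumes "homogeneous2 n P" "homogeneous2 n Q"
  shows "homogeneous2 n (P - Q)"
  using assms unfolding homogeneous2_def by (metis coeff_diff diff_0_right diff_zero cancel_comm_monoid_add_class.diff_cancel)

lemma homogeneous2_var: "homogeneous2 1 var_x" "homogeneous2 1 var_y"
  by (auto simp: homogeneous2_def var_x_def var_y_def coeff_pCons split: nat.splits if_splits)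

lemma homogeneous2_deriv:
  assumes "homogeneous2 (Suc n) P"
  shows "homogeneous2 n (deriv_x P)" "homogeneous2 n (deriv_y P)"
  using assms
  by (fastforce simp: homogeneous2_def deriv_x_def deriv_y_def coeff_map_poly coeff_pderiv
      of_nat_poly mult_eq_0_iff)+

definition line_poly :: "complex \<Rightarrow> complex \<Rightarrow> poly2" where
  "line_poly a b = [:[:a:]:] * var_x + [:[:b:]:] * var_y"

lemma eval2_line_poly [simp]: "eval2 (line_poly a b) v = a * fst v + b * snd v"
  unfolding line_poly_def eval2_simps ..

lemma const_poly2_dvd:
  assumes "c \<noteq> 0" shows "[:[:c:]:] * P dvd Q \<longleftrightarrow> P dvd (Q::poly2)"
proof -
  have "P = [:[:1/c:]:] * ([:[:c:]:] * P)"
    using assms by (simp flip: one_pCons)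
  then have "[:[:c:]:] * P dvd P" by (rule dvdI[OF trans[OF _ mult.commute]])
  then show ?thesis
    using dvd_trans dvd_mult_right by blast
qed

text \<open>
  The factor theorem. The line is written as \<open>y = - (a / b) x\<close> if \<open>b \<noteq> 0\<close>; otherwise it is
  \<open>x = 0\<close>, and the only coefficient of \<open>P\<close> that \<open>x\<close> might fail to divide is that of \<open>y^n\<close>.
\<close>

lemma line_dvd_if_vanishing:
  assumes "homogeneous2 n P" "(a, b) \<noteq> (0, 0)" "eval2 P (b, - a) = 0"
  shows "line_poly a b dvd P"
proof (cases "b = 0")
  case False
  have L: "line_poly a b = [:[:b:]:] * [:- [:0, - a / b:], 1:]"
    using False by (simp add: line_poly_def var_x_def var_y_def)
  have "poly P [:0, - a / b:] = 0"
  proof -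
    have "poly (poly P [:0, - a/b:]) x = 0" for x
    proof -
      have "poly (poly P [:0, - a/b:]) x = eval2 P (x, x * (- a / b))"
        unfolding eval2_def by (simp add: poly_altdef[of P] poly_sum poly_power)
      also have "\<dots> = eval2 P ((x / b) * b, (x / b) * - a)" using False by (simp add: field_simps)
      also have "\<dots> = 0" unfolding eval2_homogeneous[OF assms(1)] using assms(3) by simp
      finally show ?thesis .
    qed
    then show ?thesis using poly_all_0_iff_0 by blast
  qed
  then have "[:- [:0, - a / b:], 1:] dvd P" by (simp only: poly_eq_0_iff_dvd)
  then show ?thesis unfolding L by (rule const_poly2_dvd[OF False, THEN iffD2])
next
  case True
  then have a: "a \<noteq> 0" using assms(2) by simp
  have L: "line_poly a b = [:[:a:]:] * var_x" using True by (simp add: line_poly_def)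
  have 0: "coeff (coeff P n) 0 = 0"
  proof -
    have "eval2 P (0, 1) = (\<Sum>j\<le>degree P. coeff (coeff P j) 0)"
      unfolding eval2_def
      by (simp add: poly_altdef[of P] poly_0_coeff_0 coeff_sum flip: one_pCons)
    also have "\<dots> = (\<Sum>j\<le>degree P. if j = n then coeff (coeff P j) 0 else 0)"
      using assms(1)[unfolded homogeneous2_def, rule_format, of _ 0] by (intro sum.cong refl) auto
    also have "\<dots> = coeff (coeff P n) 0"
      by (auto simp: sum.delta coeff_eq_0)
    finally have *: "eval2 P (0, 1) = coeff (coeff P n) 0" .
    have "eval2 P (0, - a) = (- a) ^ n * eval2 P (0, 1)"
      using eval2_homogeneous[OF assms(1), of "- a" 0 1] by simp
    with assms(3) True a * show ?thesis by simp
  qed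
  have "[:0, 1:] dvd coeff P j" for j
  proof -
    have "coeff (coeff P j) 0 = 0"
      using 0 assms(1)[unfolded homogeneous2_def, rule_format, of j 0] by auto
    then show ?thesis using poly_eq_0_iff_dvd[of "coeff P j" 0] by (simp add: poly_0_coeff_0)
  qed
  then have "var_x dvd P" unfolding var_x_def const_poly_dvd_iff by blast
  then show ?thesis unfolding L by (rule const_poly2_dvd[OF a, THEN iffD2])
qed

lemma coprime_no_common_zero:
  assumes "homogeneous2 n A" "homogeneous2 n B" "coprime A B" "v \<noteq> (0, 0)"
  shows "eval2 A v \<noteq> 0 \<or> eval2 B v \<noteq> 0"
proof (rule ccontr)
  assume "\<not> ?thesis"
  then have 0: "eval2 A (fst v, - (- snd v)) = 0" "eval2 B (fst v, - (- snd v)) = 0" by simp_all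
  have v: "(- snd v, fst v) \<noteq> (0, 0)" using assms(4) by (cases v) auto
  have "line_poly (- snd v) (fst v) dvd A" "line_poly (- snd v) (fst v) dvd B"
    by (rule line_dvd_if_vanishing[OF assms(1) v 0(1)], rule line_dvd_if_vanishing[OF assms(2) v 0(2)])
  with assms(3) have "line_poly (- snd v) (fst v) dvd 1"
    using coprime_common_divisor by blast
  then obtain Q where "1 = line_poly (- snd v) (fst v) * Q" unfolding dvd_def by blast
  from arg_cong[OF this, of "\<lambda>P. eval2 P (0, 0)"] show False by simp
qed

section \<open>Ramification of the pencil spanned by two binary forms\<close>

text \<open>
  By Euler's identity the Jacobian determinant of two forms of degree \<open>d\<close> is the Wronskian
  of their restrictions to a line: the value of \<open>A\<close> at \<open>w\<close> is, up to the factor \<open>d\<close>, its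
  derivative at \<open>w\<close> in the direction \<open>w\<close>.
\<close>

lemma restrict_inflection_poly:
  assumes A: "homogeneous2 d A" and B: "homogeneous2 d B"
  shows "smult (det2 v u) (restrict_line (inflection_poly A B) v u) =
    smult (of_nat d) (restrict_line A v u * pderiv (restrict_line B v u) - pderiv (restrict_line A v u) * restrict_line B v u)"
proof -
  have deriv: "poly (pderiv (restrict_line P v u)) t =
      fst u * eval2 (deriv_x P) (fst v + t * fst u, snd v + t * snd u) +
      snd u * eval2 (deriv_y P) (fst v + t * fst u, snd v + t * snd u)" for P t
    by (rule DERIV_unique[OF poly_DERIV[of "restrict_line P v u" t, unfolded poly_restrict]])
       (rule eval2_has_derivative_along_line)
  have "poly (smult (det2 v u) (restrict_line (inflection_poly A B) v u)) t =
     poly (smult (of_nat d) (restrict_line A v u * pderiv (restrict_line B v u) - pderiv (restrict_line A v u) * restrict_line B v u)) t" for t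
  proof -
    define w where "w = (fst v + t * fst u, snd v + t * snd u)"
    have eA: "of_nat d * eval2 A w = fst w * eval2 (deriv_x A) w + snd w * eval2 (deriv_y A) w"
      using euler_identity[OF A, of "fst w" "snd w"] by simp
    have eB: "of_nat d * eval2 B w = fst w * eval2 (deriv_x B) w + snd w * eval2 (deriv_y B) w"
      using euler_identity[OF B, of "fst w" "snd w"] by simp
    have "det2 w u = det2 v u" by (simp add: det2_def w_def algebra_simps)
    moreover have "det2 w u * eval2 (inflection_poly A B) w =
       (of_nat d * eval2 A w) * (fst u * eval2 (deriv_x B) w + snd u * eval2 (deriv_y B) w) -
       (fst u * eval2 (deriv_x A) w + snd u * eval2 (deriv_y A) w) * (of_nat d * eval2 B w)"
      unfolding eA eB by (simp add: det2_def inflection_poly_def algebra_simps)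
    ultimately show ?thesis
      by (simp add: deriv poly_restrict w_def[symmetric] algebra_simps)
  qed
  then show ?thesis using poly_eq_poly_eq_iff by blast
qed
text \<open>
  A zero of order \<open>j\<close> of \<open>n\<close> is a zero of order \<open>j - 1\<close> of the Wronskian, as the term of
  lowest order comes from the derivative of \<open>t^j\<close> and has the coefficient \<open>- j n0(0) k(0)\<close>.
\<close>

lemma order_wronskian:
  fixes n k :: "complex poly"
  assumes "n \<noteq> 0" "poly n 0 = 0" "poly k 0 \<noteq> 0"
  obtains j w n0 where "1 \<le> j" "j \<le> degree n" "n * pderiv k - pderiv n * k = [:0, 1:] ^ (j - 1) * w" "poly w 0 \<noteq> 0"
     and "n = [:0, 1:] ^ j * n0" "poly n0 0 \<noteq> 0"
proof -
  obtain n0 where n0: "n = [:0, 1:] ^ order 0 n * n0" "poly n0 0 \<noteq> 0"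
    using order_decomp[OF assms(1), of 0] by (auto simp: dvd_iff_poly_eq_0)
  define j where "j = order 0 n"
  have j: "1 \<le> j" using assms(1,2) order_root[of n 0] by (simp add: j_def)
  have n: "n = [:0, 1:] ^ j * n0" using n0(1) by (simp add: j_def)
  define w where "w = [:0, 1:] * (n0 * pderiv k - pderiv n0 * k) - of_nat j * n0 * k"
  have "pderiv ([:0, 1:] ^ j) = of_nat j * ([:0, 1:] :: complex poly) ^ (j - 1)"
    using pderiv_power[of "[:0,1:]::complex poly" j] j
    by (simp add: pderiv_pCons of_nat_poly)
  moreover have "([:0, 1:] :: complex poly) ^ j = [:0, 1:] ^ (j - 1) * [:0, 1:]"
    by (rule power_minus_mult[symmetric]) (use j in simp)
  ultimately have "n * pderiv k - pderiv n * k = [:0, 1:] ^ (j - 1) * w"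
    unfolding n pderiv_mult w_def by (simp only:) (simp only: algebra_simps)
  moreover have "poly w 0 \<noteq> 0"
    using j n0(2) assms(3) by (simp add: w_def of_nat_poly)
  moreover have "j \<le> degree n" unfolding j_def by (rule order_degree[OF assms(1)])
  ultimately show thesis using j n n0(2) that by blast
qed

lemma poly_const_if_no_root:
  fixes p :: "complex poly"
  assumes "\<And>t. poly p t \<noteq> 0"
  obtains c where "p = [:c:]" "c \<noteq> 0"
proof -
  have "degree p = 0"
    using assms alg_closed_imp_poly_has_root[of p] by auto
  then obtain c where "p = [:c:]" by (rule degree_eq_zeroE)
  with assms that show thesis by auto
qed

text \<open>
  The local ramification formula: the member of the pencil of \<open>A\<close> and \<open>B\<close> that vanishes in
  the direction \<open>v\<close> vanishes there to one order more than \<open>D\<close>. Replacing \<open>A, B\<close> by this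
  member and another one, which cannot vanish at \<open>v\<close>, changes the Wronskian by a constant
  factor, and \<open>order_wronskian\<close> applies.
\<close>

lemma pencil_member:
  assumes hA: "homogeneous2 d A" and hB: "homogeneous2 d B" and d: "d \<ge> 1"
    and nz: "\<And>w. w \<noteq> (0, 0) \<Longrightarrow> eval2 A w \<noteq> 0 \<or> eval2 B w \<noteq> 0"
    and vu: "det2 v u \<noteq> 0"
    and lm: "(l, m) \<noteq> (0, 0)" "l * eval2 A v + m * eval2 B v = 0"
  obtains j w n0 where "1 \<le> j" "j \<le> d"
    "restrict_line (inflection_poly A B) v u = [:0, 1:] ^ (j - 1) * w" "poly w 0 \<noteq> 0"
    "smult l (restrict_line A v u) + smult m (restrict_line B v u) = [:0, 1:] ^ j * n0" "poly n0 0 \<noteq> 0"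
proof -
  define a where "a = restrict_line A v u"
  define b where "b = restrict_line B v u"
  have det: "cnj l * l + cnj m * m \<noteq> 0"
  proof -
    have "cnj l * l + cnj m * m = of_real ((cmod l)\<^sup>2 + (cmod m)\<^sup>2)"
      by (simp only: of_real_add complex_norm_square mult.commute)
    moreover have "(cmod l)\<^sup>2 + (cmod m)\<^sup>2 \<noteq> 0"
      using lm(1) by (auto simp: sum_power2_eq_zero_iff)
    ultimately show ?thesis by (metis of_real_eq_0_iff)
  qed
  define n where "n = smult l a + smult m b"
  \<comment> \<open>\<open>k\<close> comes from the vector orthogonal to \<open>(l, m)\<close>, so the change of basis has determinant \<open>|l|^2 + |m|^2\<close>\<close>
  define k where "k = smult (cnj l) b - smult (cnj m) a"
  have common: "False" if "w \<noteq> (0, 0)" "l * eval2 A w + m * eval2 B w = 0"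
      "cnj l * eval2 B w - cnj m * eval2 A w = 0" for w
  proof -
    have "(cnj l * l + cnj m * m) * eval2 A w =
       cnj l * (l * eval2 A w + m * eval2 B w) - m * (cnj l * eval2 B w - cnj m * eval2 A w)"
      "(cnj l * l + cnj m * m) * eval2 B w =
       cnj m * (l * eval2 A w + m * eval2 B w) + l * (cnj l * eval2 B w - cnj m * eval2 A w)"
      by (simp_all add: algebra_simps)
    then have "eval2 A w = 0" "eval2 B w = 0" using that det by auto
    with nz[OF that(1)] show False by simp
  qed
  have v0: "v \<noteq> (0, 0)" and u0: "u \<noteq> (0, 0)" using vu by (auto simp: det2_def)
  have n0: "poly n 0 = 0" using lm(2) by (simp add: n_def a_def b_def poly_restrict)
  have k0: "poly k 0 \<noteq> 0"
    using common[OF v0 lm(2)] by (auto simp: k_def a_def b_def poly_restrict)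
  have nn: "n \<noteq> 0"
  proof
    assume n: "n = 0"
    have "poly k t \<noteq> 0" for t
    proof
      assume "poly k t = 0"
      moreover have "poly n t = 0" using n by simp
      moreover have "(fst v + t * fst u, snd v + t * snd u) \<noteq> (0, 0)"
        using vu by (auto simp: det2_def add_eq_0_iff2)
      ultimately show False
        using common[of "(fst v + t * fst u, snd v + t * snd u)"]
        by (simp add: n_def k_def a_def b_def poly_restrict)
    qed
    then obtain c where "k = [:c:]" by (rule poly_const_if_no_root)
    then have "coeff k d = 0" "coeff n d = 0" using d n by (auto simp: coeff_pCons split: nat.splits)
    then show False
      using common[OF u0] leading_coeff_restrict[OF hA, of v u] leading_coeff_restrict[OF hB, of v u]
      by (simp add: n_def k_def a_def b_def)
  qed
  obtain j w n0 where jw: "1 \<le> j" "j \<le> degree n" "n * pderiv k - pderiv n * k = [:0, 1:] ^ (j - 1) * w"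
    "poly w 0 \<noteq> 0" "n = [:0, 1:] ^ j * n0" "poly n0 0 \<noteq> 0"
    by (rule order_wronskian[OF nn n0 k0])
  have degn: "degree n \<le> d" unfolding n_def a_def b_def
    by (intro degree_add_le order_trans[OF degree_smult_le] degree_restrict hA hB)
  have "n * pderiv k - pderiv n * k = smult (cnj l * l + cnj m * m) (a * pderiv b - pderiv a * b)"
    by (simp add: n_def k_def pderiv_add pderiv_diff pderiv_smult algebra_simps smult_add_right smult_diff_right smult_add_left)
  then have W: "smult (cnj l * l + cnj m * m) (a * pderiv b - pderiv a * b) = [:0, 1:] ^ (j - 1) * w"
    using jw(3) by simp
  have "smult (det2 v u * (cnj l * l + cnj m * m)) (restrict_line (inflection_poly A B) v u) =
     smult (cnj l * l + cnj m * m) (smult (det2 v u) (restrict_line (inflection_poly A B) v u))"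
    by (simp only: smult_smult mult.commute)
  also have "\<dots> = smult (of_nat d) (smult (cnj l * l + cnj m * m) (a * pderiv b - pderiv a * b))"
    unfolding restrict_inflection_poly[OF hA hB, of v u] a_def b_def
    by (simp only: smult_smult mult.commute)
  finally have "smult (det2 v u * (cnj l * l + cnj m * m)) (restrict_line (inflection_poly A B) v u) =
     smult (of_nat d) ([:0, 1:] ^ (j - 1) * w)"
    unfolding W .
  then have "restrict_line (inflection_poly A B) v u =
     [:0, 1:] ^ (j - 1) * smult (of_nat d / (det2 v u * (cnj l * l + cnj m * m))) w"
    using vu det
    by (smt (verit) divide_inverse left_inverse mult.commute mult_eq_0_iff mult_smult_right smult_1_left smult_smult)
  moreover have "poly (smult (of_nat d / (det2 v u * (cnj l * l + cnj m * m))) w) 0 \<noteq> 0"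
    using d vu det jw(4) by simp
  moreover have "j \<le> d" using jw(2) degn by simp
  ultimately show thesis
    using that[OF jw(1)] jw(5,6) unfolding n_def a_def b_def by blast
qed

lemma homogeneous2_inflection_poly:
  assumes "homogeneous2 d A" "homogeneous2 d B" "d \<ge> 1"
  shows "homogeneous2 (2 * d - 2) (inflection_poly A B)"
proof -
  obtain k where d: "d = Suc k" using assms(3) by (cases d) auto
  then have "homogeneous2 (k + k) (inflection_poly A B)"
    unfolding inflection_poly_def
    by (intro homogeneous2_diff homogeneous2_mult) (use assms d homogeneous2_deriv in blast)+
  moreover have "2 * d - 2 = k + k" using d by simp
  ultimately show ?thesis by simp
qed

lemma eval2_pencil_in_basis:
  assumes "homogeneous2 d A" "homogeneous2 d B"
    "smult l (restrict_line A v u) + smult m (restrict_line B v u) = smult c ([:0, 1:] ^ d)"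
    "w = (s * fst v + t * fst u, s * snd v + t * snd u)"
  shows "l * eval2 A w + m * eval2 B w = c * t ^ d"
proof -
  have c: "l * coeff (restrict_line A v u) i + m * coeff (restrict_line B v u) i = (if i = d then c else 0)" for i
  proof -
    have "l * coeff (restrict_line A v u) i + m * coeff (restrict_line B v u) i = coeff (smult c ([:0, 1:] ^ d)) i"
      by (simp flip: assms(3))
    also have "([:0, 1:] :: complex poly) ^ d = monom 1 d"
      by (simp add: monom_altdef)
    finally show ?thesis by simp
  qed
  have "l * eval2 A w + m * eval2 B w =
     (\<Sum>i\<le>d. (l * coeff (restrict_line A v u) i + m * coeff (restrict_line B v u) i) * (s ^ (d - i) * t ^ i))"
    unfolding assms(4)
    using eval2_in_basis[OF assms(1), of s "fst v" t "fst u" "snd v" "snd u"]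
          eval2_in_basis[OF assms(2), of s "fst v" t "fst u" "snd v" "snd u"]
    by (simp add: sum_distrib_left algebra_simps sum.distrib)
  also have "\<dots> = (\<Sum>i\<le>d. if i = d then c * t ^ i else 0)"
    unfolding c by (rule sum.cong) auto
  finally show ?thesis by simp
qed

lemma eq_monomial_if_dvd:
  fixes p :: "complex poly"
  assumes "[:0, 1:] ^ n dvd p" "degree p \<le> n" "p \<noteq> 0"
  obtains c where "c \<noteq> 0" "p = smult c ([:0, 1:] ^ n)"
proof -
  obtain q where q: "p = [:0, 1:] ^ n * q" using assms(1) by (elim dvdE)
  with assms(3) have "q \<noteq> 0" by auto
  then have "degree p = n + degree q"
    unfolding q by (subst degree_mult_eq) (auto simp: degree_power_eq)
  with assms(2) have "degree q = 0" by simp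
  then obtain c where "q = [:c:]" by (rule degree_eq_zeroE)
  with q \<open>q \<noteq> 0\<close> that[of c] show thesis by simp
qed

text \<open>
  In the coordinates \<open>s, t\<close> of the basis, \<open>D\<close> has no zeros off the two axes, so it is a
  monomial \<open>s^i t^j\<close> up to a constant, with \<open>i + j = 2 d - 2\<close>. By \<open>pencil_member\<close> both
  exponents are at most \<open>d - 1\<close>, hence equal to \<open>d - 1\<close>, and the pencil contains nonzero
  multiples of \<open>t^d\<close> and of \<open>s^d\<close>.
\<close>

lemma two_inflection_directions_normal_form:
  assumes hA: "homogeneous2 d A" and hB: "homogeneous2 d B" and d: "d \<ge> 1"
    and nz: "\<And>w. w \<noteq> (0, 0) \<Longrightarrow> eval2 A w \<noteq> 0 \<or> eval2 B w \<noteq> 0"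
    and vu: "det2 v1 v2 \<noteq> 0"
    and dir: "\<And>w. w \<noteq> (0, 0) \<Longrightarrow> eval2 (inflection_poly A B) w = 0 \<Longrightarrow> det2 w v1 = 0 \<or> det2 w v2 = 0"
  obtains a b c e where "a * e - b * c \<noteq> 0"
    "\<forall>s t. eval2 A (s * fst v1 + t * fst v2, s * snd v1 + t * snd v2) = a * s ^ d + b * t ^ d"
    "\<forall>s t. eval2 B (s * fst v1 + t * fst v2, s * snd v1 + t * snd v2) = c * s ^ d + e * t ^ d"
proof -
  have one: "\<exists>j c l m g. 1 \<le> j \<and> j \<le> d \<and> c \<noteq> 0 \<and> restrict_line (inflection_poly A B) v u = smult c ([:0, 1:] ^ (j - 1)) \<and>
      (l, m) \<noteq> (0, 0) \<and> (j = d \<longrightarrow> g \<noteq> 0 \<and> smult l (restrict_line A v u) + smult m (restrict_line B v u) = smult g ([:0, 1:] ^ d))"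
    if vu: "det2 v u \<noteq> 0" and dir: "\<And>w. w \<noteq> (0, 0) \<Longrightarrow> eval2 (inflection_poly A B) w = 0 \<Longrightarrow> det2 w v = 0 \<or> det2 w u = 0"
    for v u
  proof -
    have v0: "v \<noteq> (0, 0)" using vu by (auto simp: det2_def)
    have lm: "(eval2 B v, - eval2 A v) \<noteq> (0, 0)" using nz[OF v0] by auto
    have lm0: "eval2 B v * eval2 A v + - eval2 A v * eval2 B v = 0" by simp
    obtain j w n0 where jw: "1 \<le> j" "j \<le> d"
      "restrict_line (inflection_poly A B) v u = [:0, 1:] ^ (j - 1) * w" "poly w 0 \<noteq> 0"
      and n0: "smult (eval2 B v) (restrict_line A v u) + smult (- eval2 A v) (restrict_line B v u) = [:0, 1:] ^ j * n0"
        "poly n0 0 \<noteq> 0"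
      by (rule pencil_member[OF hA hB d nz vu lm lm0])
    have n0_dvd: "[:0, 1:] ^ j dvd smult (eval2 B v) (restrict_line A v u) + smult (- eval2 A v) (restrict_line B v u)"
      "smult (eval2 B v) (restrict_line A v u) + smult (- eval2 A v) (restrict_line B v u) \<noteq> 0"
      using n0 by auto
    have "poly w t \<noteq> 0" for t
    proof
      assume t: "poly w t = 0"
      then have "t \<noteq> 0" using jw(4) by auto
      have "poly (restrict_line (inflection_poly A B) v u) t = 0" using t jw(3) by simp
      then have "eval2 (inflection_poly A B) (fst v + t * fst u, snd v + t * snd u) = 0"
        by (simp add: poly_restrict)
      moreover have "(fst v + t * fst u, snd v + t * snd u) \<noteq> (0, 0)"
        using vu by (auto simp: det2_def add_eq_0_iff2)
      ultimately have "det2 (fst v + t * fst u, snd v + t * snd u) v = 0 \<or>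
          det2 (fst v + t * fst u, snd v + t * snd u) u = 0" using dir by blast
      moreover have "det2 (fst v + t * fst u, snd v + t * snd u) v = - t * det2 v u"
        "det2 (fst v + t * fst u, snd v + t * snd u) u = det2 v u"
        by (simp_all add: det2_def algebra_simps)
      ultimately show False using \<open>t \<noteq> 0\<close> vu by simp
    qed
    then obtain c where c: "w = [:c:]" "c \<noteq> 0" by (rule poly_const_if_no_root)
    have g: "\<exists>g. g \<noteq> 0 \<and> smult (eval2 B v) (restrict_line A v u) + smult (- eval2 A v) (restrict_line B v u) = smult g ([:0, 1:] ^ d)"
      if "j = d"
    proof -
      have "degree (smult (eval2 B v) (restrict_line A v u) + smult (- eval2 A v) (restrict_line B v u)) \<le> d"
        by (intro degree_add_le order_trans[OF degree_smult_le] degree_restrict hA hB)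
      then show ?thesis using eq_monomial_if_dvd n0_dvd that by metis
    qed
    have r: "restrict_line (inflection_poly A B) v u = smult c ([:0, 1:] ^ (j - 1))"
      using jw(3) c by simp
    show ?thesis
    proof (cases "j = d")
      case True
      with g obtain g' where "g' \<noteq> 0" "smult (eval2 B v) (restrict_line A v u) + smult (- eval2 A v) (restrict_line B v u) = smult g' ([:0, 1:] ^ d)"
        by blast
      with jw(1,2) c(2) r lm show ?thesis by blast
    next
      case False
      with jw(1,2) c(2) r lm show ?thesis by blast
    qed
  qed
  have vu': "det2 v2 v1 \<noteq> 0" using vu by (simp add: det2_def algebra_simps)
  obtain j1 c1 l1 m1 g1 where 1: "1 \<le> j1" "j1 \<le> d" "c1 \<noteq> 0"
    "restrict_line (inflection_poly A B) v1 v2 = smult c1 ([:0, 1:] ^ (j1 - 1))" "(l1, m1) \<noteq> (0, 0)"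
    "j1 = d \<Longrightarrow> g1 \<noteq> 0" "j1 = d \<Longrightarrow> smult l1 (restrict_line A v1 v2) + smult m1 (restrict_line B v1 v2) = smult g1 ([:0, 1:] ^ d)"
    using one[OF vu dir] by blast
  obtain j2 c2 l2 m2 g2 where 2: "1 \<le> j2" "j2 \<le> d" "c2 \<noteq> 0"
    "restrict_line (inflection_poly A B) v2 v1 = smult c2 ([:0, 1:] ^ (j2 - 1))" "(l2, m2) \<noteq> (0, 0)"
    "j2 = d \<Longrightarrow> g2 \<noteq> 0" "j2 = d \<Longrightarrow> smult l2 (restrict_line A v2 v1) + smult m2 (restrict_line B v2 v1) = smult g2 ([:0, 1:] ^ d)"
    using one[OF vu'] dir by blast
  let ?N = "2 * d - 2"
  have coef: "coeff (restrict_line (inflection_poly A B) v1 v2) i = (if i = j1 - 1 then c1 else 0)" for i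
    unfolding 1(4) by (simp flip: monom_altdef)
  have D: "eval2 (inflection_poly A B) (s * fst v1 + 1 * fst v2, s * snd v1 + 1 * snd v2) = c1 * s ^ (?N - (j1 - 1))" for s
  proof -
    have "eval2 (inflection_poly A B) (s * fst v1 + 1 * fst v2, s * snd v1 + 1 * snd v2) =
        (\<Sum>i\<le>?N. (if i = j1 - 1 then c1 else 0) * s ^ (?N - i) * 1 ^ i)"
      unfolding eval2_in_basis[OF homogeneous2_inflection_poly[OF hA hB d]] prod.collapse coef ..
    also have "\<dots> = (\<Sum>i\<le>?N. if i = j1 - 1 then c1 * s ^ (?N - i) else 0)"
      by (rule sum.cong) auto
    finally show ?thesis using 1(1,2) by simp
  qed
  have cc: "c2 * s ^ (j2 - 1) = c1 * s ^ (?N - (j1 - 1))" for s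
    using D[of s] arg_cong[OF 2(4), of "\<lambda>p. poly p s"]
    by (simp add: poly_restrict add_ac)
  \<comment> \<open>two monomials that agree at \<open>1\<close> and \<open>2\<close> have the same exponent\<close>
  from cc[of 1] have "c2 = c1" by simp
  with cc[of 2] 1(3) have "(2::complex) ^ (j2 - 1) = 2 ^ (?N - (j1 - 1))" by simp
  then have "cmod (2 ^ (j2 - 1)) = cmod (2 ^ (?N - (j1 - 1)))" by simp
  then have "j2 - 1 = ?N - (j1 - 1)" by (simp add: norm_power)
  then have j: "j1 = d" "j2 = d" using 1(1,2) 2(1,2) by auto
  have N1: "l1 * eval2 A (s * fst v1 + t * fst v2, s * snd v1 + t * snd v2) +
            m1 * eval2 B (s * fst v1 + t * fst v2, s * snd v1 + t * snd v2) = g1 * t ^ d" for s t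
    by (rule eval2_pencil_in_basis[OF hA hB 1(7)[OF j(1)], of _ s t]) simp
  have N2: "l2 * eval2 A (s * fst v1 + t * fst v2, s * snd v1 + t * snd v2) +
            m2 * eval2 B (s * fst v1 + t * fst v2, s * snd v1 + t * snd v2) = g2 * s ^ d" for s t
    by (rule eval2_pencil_in_basis[OF hA hB 2(7)[OF j(2)], of _ t s]) (simp add: add.commute)
  have g: "g1 \<noteq> 0" "g2 \<noteq> 0" using 1(6) 2(6) j by auto
  define \<Delta> where "\<Delta> = l1 * m2 - l2 * m1"
  have a: "\<Delta> * eval2 A (s * fst v1 + t * fst v2, s * snd v1 + t * snd v2) = m2 * g1 * t ^ d - m1 * g2 * s ^ d" for s t
  proof -
    let ?w = "(s * fst v1 + t * fst v2, s * snd v1 + t * snd v2)"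
    have "\<Delta> * eval2 A ?w = m2 * (l1 * eval2 A ?w + m1 * eval2 B ?w) - m1 * (l2 * eval2 A ?w + m2 * eval2 B ?w)"
      by (simp add: \<Delta>_def algebra_simps)
    then show ?thesis unfolding N1 N2 by simp
  qed
  have b: "\<Delta> * eval2 B (s * fst v1 + t * fst v2, s * snd v1 + t * snd v2) = l1 * g2 * s ^ d - l2 * g1 * t ^ d" for s t
  proof -
    let ?w = "(s * fst v1 + t * fst v2, s * snd v1 + t * snd v2)"
    have "\<Delta> * eval2 B ?w = l1 * (l2 * eval2 A ?w + m2 * eval2 B ?w) - l2 * (l1 * eval2 A ?w + m1 * eval2 B ?w)"
      by (simp add: \<Delta>_def algebra_simps)
    then show ?thesis unfolding N1 N2 by simp
  qed
  have \<Delta>: "\<Delta> \<noteq> 0"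
  proof
    assume "\<Delta> = 0"
    with a[of 1 0] b[of 1 0] d g have "m1 = 0" "l1 = 0" by (simp_all add: power_0_left)
    with 1(5) show False by simp
  qed
  show thesis
  proof (rule that)
    show "(- m1 * g2 / \<Delta>) * (- l2 * g1 / \<Delta>) - (m2 * g1 / \<Delta>) * (l1 * g2 / \<Delta>) \<noteq> 0"
    proof -
      have "(- m1 * g2) * (- l2 * g1) - (m2 * g1) * (l1 * g2) = - g1 * g2 * \<Delta>"
        by (simp add: \<Delta>_def algebra_simps)
      then have "(- m1 * g2 / \<Delta>) * (- l2 * g1 / \<Delta>) - (m2 * g1 / \<Delta>) * (l1 * g2 / \<Delta>) = - g1 * g2 * \<Delta> / (\<Delta> * \<Delta>)"
        by (simp only: times_divide_times_eq diff_divide_distrib[symmetric])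
      then show ?thesis using g \<Delta> by simp
    qed
    show "\<forall>s t. eval2 A (s * fst v1 + t * fst v2, s * snd v1 + t * snd v2) = (- m1 * g2 / \<Delta>) * s ^ d + (m2 * g1 / \<Delta>) * t ^ d"
    proof (intro allI)
      fix s t
      show "eval2 A (s * fst v1 + t * fst v2, s * snd v1 + t * snd v2) = (- m1 * g2 / \<Delta>) * s ^ d + (m2 * g1 / \<Delta>) * t ^ d"
        using a[of s t] \<Delta> by (simp add: field_simps)
    qed
    show "\<forall>s t. eval2 B (s * fst v1 + t * fst v2, s * snd v1 + t * snd v2) = (l1 * g2 / \<Delta>) * s ^ d + (- l2 * g1 / \<Delta>) * t ^ d"
    proof (intro allI)
      fix s t
      show "eval2 B (s * fst v1 + t * fst v2, s * snd v1 + t * snd v2) = (l1 * g2 / \<Delta>) * s ^ d + (- l2 * g1 / \<Delta>) * t ^ d"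
        using b[of s t] \<Delta> by (simp add: field_simps)
    qed
  qed
qed

lemma finitely_many_zero_directions:
  assumes "homogeneous2 n P" "eval2 P w \<noteq> 0"
  obtains V where "finite V" "\<And>v. v \<noteq> (0, 0) \<Longrightarrow> eval2 P v = 0 \<Longrightarrow> \<exists>v'\<in>V. \<exists>c. c \<noteq> 0 \<and> v = (c * fst v', c * snd v')"
proof -
  define p where "p = restrict_line P (1, 0) (0, 1)"
  have p: "p \<noteq> 0" unfolding p_def
    by (rule restrict_nonzero[OF assms(1) _ assms(2)]) (simp add: det2_def)
  define V :: "(complex \<times> complex) set" where "V = insert (0, 1) ((\<lambda>t. (1, t)) ` {t. poly p t = 0})"
  show thesis
  proof (rule that)
    show "finite V" using poly_roots_finite[OF p] by (simp add: V_def)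
    fix v assume v: "v \<noteq> (0, 0)" "eval2 P v = 0"
    show "\<exists>v'\<in>V. \<exists>c. c \<noteq> 0 \<and> v = (c * fst v', c * snd v')"
    proof (cases "fst v = 0")
      case True
      then show ?thesis using v(1) by (auto simp: V_def prod_eq_iff)
    next
      case False
      have "eval2 P v = fst v ^ n * poly p (snd v / fst v)"
        using eval2_homogeneous[OF assms(1), of "fst v" 1 "snd v / fst v"] False
        by (simp add: p_def poly_restrict)
      with v False have "poly p (snd v / fst v) = 0" by simp
      with False show ?thesis
        by (intro bexI[of _ "(1, snd v / fst v)"] exI[of _ "fst v"]) (auto simp: V_def prod_eq_iff)
    qed
  qed
qed

section \<open>Division of germs\<close>

definition circ :: "real \<Rightarrow> real \<Rightarrow> complex" where
  "circ r x = of_real r * exp (2 * of_real pi * \<i> * of_real x)"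

lemma norm_circ: "r > 0 \<Longrightarrow> norm (circ r x) = r"
  by (simp add: circ_def norm_mult)

lemma continuous_on_circ [continuous_intros]:
  "continuous_on S g \<Longrightarrow> continuous_on S (\<lambda>x. circ r (g x))"
  unfolding circ_def by (intro continuous_intros)

lemma cauchy_integral_circ:
  assumes "continuous_on (cball 0 r) f" "f holomorphic_on ball 0 r" "norm s < r"
  shows "integral {0..1} (\<lambda>x. f (circ r x) * (circ r x / (circ r x - s))) = f s"
proof -
  have "contour_integral (circlepath 0 r) (\<lambda>u. f u / (u - s)) = 2 * of_real pi * \<i> * f s"
    by (rule contour_integral_unique[OF Cauchy_integral_circlepath]) (use assms in auto)
  moreover have "contour_integral (circlepath 0 r) (\<lambda>u. f u / (u - s)) =
      integral {0..1} (\<lambda>x. 2 * of_real pi * \<i> * (f (circ r x) * (circ r x / (circ r x - s))))"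
    unfolding contour_integral_integral
    by (rule integral_cong) (simp only: vector_derivative_circlepath, simp add: circlepath circ_def mult_ac)
  moreover have "\<dots> = 2 * of_real pi * \<i> * integral {0..1} (\<lambda>x. f (circ r x) * (circ r x / (circ r x - s)))"
    by (rule integral_mult_right)
  ultimately show ?thesis by simp
qed

lemma has_derivative_bicauchy_kernel:
  fixes k \<eta> \<zeta> :: complex
  assumes "\<eta> - fst w \<noteq> 0" "\<zeta> - snd w \<noteq> 0"
  shows "((\<lambda>z. k / ((\<eta> - fst z) * (\<zeta> - snd z))) has_derivative
     (\<lambda>h. k / ((\<eta> - fst w) * (\<zeta> - snd w)) / (\<eta> - fst w) * fst h +
          k / ((\<eta> - fst w) * (\<zeta> - snd w)) / (\<zeta> - snd w) * snd h)) (at w within S)"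
proof -
  have "((\<lambda>z. k / (fst z * snd z)) has_derivative
     (\<lambda>h. - (k / (p * q) / p * fst h) - k / (p * q) / q * snd h)) (at (p, q))" if "p \<noteq> 0" "q \<noteq> 0" for p q
    by (rule derivative_eq_intros refl | use that in force)+
       (use that in \<open>auto simp: fun_eq_iff field_simps\<close>)
  note D = this[OF assms]
  have "((\<lambda>z. (\<eta> - fst z, \<zeta> - snd z)) has_derivative (\<lambda>h. (- fst h, - snd h))) (at w within S)"
    by (auto intro!: derivative_eq_intros)
  from has_derivative_compose[where f = "\<lambda>z. (\<eta> - fst z, \<zeta> - snd z)" and g = "\<lambda>z. k / (fst z * snd z)", OF this D]
  show ?thesis by simp
qed

text \<open>
  The derivative of the integrand with respect to \<open>z\<close> is continuous in \<open>z\<close> and in the point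
  of the torus, so that one may differentiate under the integral sign.
\<close>

lemma torus_integral_holomorphic2:
  assumes r: "r > 0" and K: "continuous_on (sphere 0 r \<times> sphere 0 r) K"
  shows "holomorphic2_on (\<lambda>z. integral (cbox (0, 0) (1, 1))
           (\<lambda>x. K (circ r (fst x), circ r (snd x)) /
                ((circ r (fst x) - fst z) * (circ r (snd x) - snd z)))) (ball 0 r \<times> ball 0 r)"
  unfolding holomorphic2_on_def
proof
  let ?U = "ball 0 r \<times> ball 0 r :: (complex \<times> complex) set"
  let ?T = "cbox (0, 0) (1, 1) :: (real \<times> real) set"
  define k where "k x = K (circ r (fst x), circ r (snd x))" for x
  let ?f = "\<lambda>z x. k x / ((circ r (fst x) - fst z) * (circ r (snd x) - snd z))"
  define c1 where "c1 z x = ?f z x / (circ r (fst x) - fst z)" for z x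
  define c2 where "c2 z x = ?f z x / (circ r (snd x) - snd z)" for z x
  define F where "F z x = (blinfun_mult_right (c1 z x) o\<^sub>L fst_blinfun) + (blinfun_mult_right (c2 z x) o\<^sub>L snd_blinfun)"
    for z x
  have nz: "circ r x - w \<noteq> 0" if "w \<in> ball 0 r" for x w
    using that norm_circ[OF r, of x] by auto
  have kc: "continuous_on S (\<lambda>z. k (g z))" if "continuous_on S g" for S and g :: "'z::topological_space \<Rightarrow> real \<times> real"
    unfolding k_def
    by (rule continuous_on_compose2[OF K]) (use that norm_circ[OF r] in \<open>auto intro!: continuous_intros\<close>)
  have fc: "continuous_on (?U \<times> ?T) (\<lambda>y. ?f (fst y) (snd y))"
    by (intro continuous_intros kc) (use nz in auto)
  have c1c: "continuous_on (?U \<times> ?T) (\<lambda>y. c1 (fst y) (snd y))"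
    unfolding c1_def by (intro continuous_intros kc) (use nz in auto)
  have c2c: "continuous_on (?U \<times> ?T) (\<lambda>y. c2 (fst y) (snd y))"
    unfolding c2_def by (intro continuous_intros kc) (use nz in auto)
  have int: "h w integrable_on ?T" if "w \<in> ?U" "continuous_on (?U \<times> ?T) (\<lambda>y. h (fst y) (snd y))"
    for w and h :: "complex \<times> complex \<Rightarrow> real \<times> real \<Rightarrow> 'b::banach"
  proof (rule integrable_continuous)
    have "continuous_on ?T (\<lambda>x. h (fst (w, x)) (snd (w, x)))"
      by (rule continuous_on_compose2[OF that(2)]) (use that(1) in \<open>auto intro!: continuous_intros\<close>)
    then show "continuous_on ?T (h w)" by simp
  qed
  have Fc: "continuous_on (?U \<times> ?T) (\<lambda>y. F (fst y) (snd y))"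
    unfolding F_def
    by (intro continuous_intros bounded_linear.continuous_on[OF bounded_linear_blinfun_mult_right] c1c c2c)
  fix z assume z: "z \<in> ?U"
  have "((\<lambda>z. integral ?T (?f z)) has_derivative integral ?T (F z)) (at z within ?U)"
  proof (rule leibniz_rule[where U = ?U])
    fix w x assume w: "w \<in> ?U"
    have "((\<lambda>z. ?f z x) has_derivative (\<lambda>h. c1 w x * fst h + c2 w x * snd h)) (at w within ?U)"
      unfolding c1_def c2_def
      by (rule has_derivative_bicauchy_kernel) (use w nz in auto)
    also have "(\<lambda>h. c1 w x * fst h + c2 w x * snd h) = blinfun_apply (F w x)"
      by (simp add: F_def fun_eq_iff plus_blinfun.rep_eq)
    finally show "((\<lambda>z. ?f z x) has_derivative blinfun_apply (F w x)) (at w within ?U)" .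
  next
    fix w assume "w \<in> ?U"
    then show "?f w integrable_on ?T" by (rule int[of w ?f]) (rule fc)
  next
    show "continuous_on (?U \<times> ?T) (\<lambda>(x, t). F x t)" using Fc by (simp add: case_prod_unfold)
    show "convex ?U" by (intro convex_Times convex_ball)
  qed (rule z)
  then have "((\<lambda>z. integral ?T (?f z)) has_derivative integral ?T (F z)) (at z)"
    by (simp only: at_within_open[OF z open_Times[OF open_ball open_ball]])
  moreover have "blinfun_apply (integral ?T (F z)) = (\<lambda>h. integral ?T (c1 z) * fst h + integral ?T (c2 z) * snd h)"
  proof
    fix h
    have "blinfun_apply (integral ?T (F z)) h = integral ?T (\<lambda>x. blinfun_apply (F z x) h)"
      by (rule blinfun_apply_integral[OF int[of z F, OF z Fc]])
    also have "\<dots> = integral ?T (\<lambda>x. c1 z x * fst h + c2 z x * snd h)"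
      by (simp add: F_def plus_blinfun.rep_eq)
    also have "\<dots> = integral ?T (\<lambda>x. c1 z x * fst h) + integral ?T (\<lambda>x. c2 z x * snd h)"
      by (rule integral_add[OF integrable_on_mult_left[OF int[of z c1, OF z c1c]] integrable_on_mult_left[OF int[of z c2, OF z c2c]]])
    finally show "blinfun_apply (integral ?T (F z)) h = integral ?T (c1 z) * fst h + integral ?T (c2 z) * snd h"
      by (simp only: integral_mult_left)
  qed
  ultimately have "((\<lambda>z. integral ?T (?f z)) has_derivative
      (\<lambda>h. integral ?T (c1 z) * fst h + integral ?T (c2 z) * snd h)) (at z)" by (simp only:)
  then show "\<exists>a b. ((\<lambda>z. integral ?T (\<lambda>x. K (circ r (fst x), circ r (snd x)) /
                ((circ r (fst x) - fst z) * (circ r (snd x) - snd z)))) has_derivative (\<lambda>h. a * fst h + b * snd h)) (at z)"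
    unfolding k_def by (intro exI)
qed

lemma holomorphic2_on_slices:
  assumes "holomorphic2_on f U" "(x, y) \<in> U"
  shows "(\<lambda>s. f (s, y)) field_differentiable at x" "(\<lambda>t. f (x, t)) field_differentiable at y"
proof -
  obtain a b where D: "(f has_derivative (\<lambda>h. a * fst h + b * snd h)) (at (x, y))"
    using assms unfolding holomorphic2_on_def by blast
  have "((\<lambda>s. (s, y)) has_derivative (\<lambda>h. (h, 0))) (at x)" "((\<lambda>t. (x, t)) has_derivative (\<lambda>h. (0, h))) (at y)"
    by (auto intro!: derivative_eq_intros)
  from this[THEN has_derivative_compose, OF D]
  have "((\<lambda>s. f (s, y)) has_field_derivative a) (at x)" "((\<lambda>t. f (x, t)) has_field_derivative b) (at y)"
    by (simp_all add: has_field_derivative_def)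
  then show "(\<lambda>s. f (s, y)) field_differentiable at x" "(\<lambda>t. f (x, t)) field_differentiable at y"
    unfolding field_differentiable_def by blast+
qed

lemma holomorphic2_on_imp_continuous_on:
  "holomorphic2_on f U \<Longrightarrow> continuous_on U f"
  unfolding holomorphic2_on_def
  by (meson continuous_at_imp_continuous_on has_derivative_continuous)

text \<open>
  By Cauchy's formula in the second variable, the integral of \<open>k(s, \<zeta>) / (\<zeta> (\<zeta> - t))\<close> over a
  circle is, up to \<open>2 \<pi> i\<close>, the quotient of \<open>k (s, t) - k (s, 0)\<close> by \<open>t\<close>. Cauchy's formula
  in the first variable turns it into a torus integral, which is holomorphic in \<open>(s, t)\<close>
  also at \<open>t = 0\<close>.
\<close>

lemma division_by_coordinate:
  assumes k: "holomorphic2_on k (ball 0 \<rho> \<times> ball 0 \<rho>)" and r: "0 < r" "r < \<rho>"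
  obtains b where "holomorphic2_on b (ball 0 r \<times> ball 0 r)"
    "\<And>s t. s \<in> ball 0 r \<Longrightarrow> t \<in> ball 0 r \<Longrightarrow> k (s, t) - k (s, 0) = t * b (s, t)"
proof -
  have kc: "continuous_on (ball 0 \<rho> \<times> ball 0 \<rho>) k" by (rule holomorphic2_on_imp_continuous_on[OF k])
  have hol1: "(\<lambda>s. k (s, t)) holomorphic_on ball 0 \<rho>" if "t \<in> ball 0 \<rho>" for t
    unfolding holomorphic_on_def
    by (rule ballI, rule field_differentiable_at_within, rule holomorphic2_on_slices(1)[OF k]) (use that in simp)
  have hol2: "(\<lambda>t. k (s, t)) holomorphic_on ball 0 \<rho>" if "s \<in> ball 0 \<rho>" for s
    unfolding holomorphic_on_def
    by (rule ballI, rule field_differentiable_at_within, rule holomorphic2_on_slices(2)[OF k]) (use that in simp)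
  have sub: "cball 0 r \<subseteq> (ball 0 \<rho> :: complex set)" "ball 0 r \<subseteq> (ball 0 \<rho> :: complex set)" using r by auto
  have cauchy: "integral {0..1} (\<lambda>x. f (circ r x) * (circ r x / (circ r x - s))) = f s"
    if "f holomorphic_on ball 0 \<rho>" "s \<in> ball 0 r" for f s
  proof (rule cauchy_integral_circ)
    show "continuous_on (cball 0 r) f" "f holomorphic_on ball 0 r"
      using holomorphic_on_subset[OF that(1)] sub holomorphic_on_imp_continuous_on by blast+
  qed (use that(2) in simp)
  define K where "K z = k z * fst z" for z
  have Kc: "continuous_on (sphere 0 r \<times> sphere 0 r) K"
    unfolding K_def by (intro continuous_intros continuous_on_subset[OF kc]) (use r in auto)
  define b where "b z = integral (cbox (0, 0) (1, 1))
           (\<lambda>x. K (circ r (fst x), circ r (snd x)) /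
                ((circ r (fst x) - fst z) * (circ r (snd x) - snd z)))" for z
  show thesis
  proof (rule that)
    show "holomorphic2_on b (ball 0 r \<times> ball 0 r)"
      unfolding b_def by (rule torus_integral_holomorphic2[OF r(1) Kc])
    fix s t :: complex assume st: "s \<in> ball 0 r" "t \<in> ball 0 r"
    have nz: "circ r x - w \<noteq> 0" if "w \<in> ball 0 r" for x w
      using that norm_circ[OF r(1), of x] by auto
    have n0: "circ r x \<noteq> 0" for x using norm_circ[OF r(1), of x] r(1) by auto
    have circR: "circ r x \<in> ball 0 \<rho>" for x using norm_circ[OF r(1), of x] r by simp
    have "b (s, t) = integral (cbox 0 1) (\<lambda>x. integral (cbox 0 1) (\<lambda>y. K (circ r x, circ r y) /
                ((circ r x - s) * (circ r y - t))))"
      unfolding b_def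
    proof (subst integral_prod_continuous)
      show "continuous_on (cbox (0, 0) (1, 1)) (\<lambda>x. K (circ r (fst x), circ r (snd x)) /
          ((circ r (fst x) - fst (s, t)) * (circ r (snd x) - snd (s, t))))"
        by (intro continuous_intros continuous_on_compose2[OF Kc])
           (use st nz norm_circ[OF r(1)] in auto)
    qed simp
    also have "t * \<dots> = integral {0..1} (\<lambda>x. t * integral {0..1} (\<lambda>y. K (circ r x, circ r y) /
                ((circ r x - s) * (circ r y - t))))"
      by simp
    also have "\<dots> = integral {0..1} (\<lambda>x. (k (circ r x, t) - k (circ r x, 0)) * (circ r x / (circ r x - s)))"
    proof (rule integral_cong)
      fix x :: real
      let ?\<eta> = "circ r x"
      have "t * integral {0..1} (\<lambda>y. K (?\<eta>, circ r y) / ((?\<eta> - s) * (circ r y - t))) =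
        integral {0..1} (\<lambda>y. t * (K (?\<eta>, circ r y) / ((?\<eta> - s) * (circ r y - t))))"
        by (rule integral_mult_right[symmetric])
      also have "\<dots> = integral {0..1} (\<lambda>y. (?\<eta> / (?\<eta> - s)) *
           (k (?\<eta>, circ r y) * (circ r y / (circ r y - t)) - k (?\<eta>, circ r y) * (circ r y / (circ r y - 0))))"
      proof (rule integral_cong)
        fix y :: real
        have "t * (k * \<eta> / ((\<eta> - s) * (\<zeta> - t))) = \<eta> / (\<eta> - s) * (k * (\<zeta> / (\<zeta> - t)) - k * (\<zeta> / (\<zeta> - 0)))"
          if "\<zeta> - t \<noteq> 0" "\<zeta> \<noteq> 0" "\<eta> - s \<noteq> 0" for k \<eta> \<zeta> :: complex
        proof -
          have "\<zeta> / (\<zeta> - t) - 1 = t / (\<zeta> - t)" using that(1) by (simp add: field_simps)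
          moreover have "k * (\<zeta> / (\<zeta> - t)) - k * (\<zeta> / (\<zeta> - 0)) = k * (\<zeta> / (\<zeta> - t) - 1)"
            using that(2) by (simp add: right_diff_distrib)
          ultimately have "k * (\<zeta> / (\<zeta> - t)) - k * (\<zeta> / (\<zeta> - 0)) = k * (t / (\<zeta> - t))" by (simp only:)
          then show ?thesis by simp
        qed
        from this[OF nz[OF st(2)] n0 nz[OF st(1)]]
        show "t * (K (?\<eta>, circ r y) / ((?\<eta> - s) * (circ r y - t))) = (?\<eta> / (?\<eta> - s)) *
           (k (?\<eta>, circ r y) * (circ r y / (circ r y - t)) - k (?\<eta>, circ r y) * (circ r y / (circ r y - 0)))"
          unfolding K_def fst_conv .
      qed
      also have "\<dots> = (?\<eta> / (?\<eta> - s)) * (integral {0..1} (\<lambda>y. k (?\<eta>, circ r y) * (circ r y / (circ r y - t)))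
           - integral {0..1} (\<lambda>y. k (?\<eta>, circ r y) * (circ r y / (circ r y - 0))))"
      proof -
        have "(\<lambda>y. k (?\<eta>, circ r y) * (circ r y / (circ r y - w))) integrable_on {0..1}" if "w \<in> ball 0 r" for w
          by (intro integrable_continuous_real continuous_intros continuous_on_compose2[OF kc])
             (use circR nz[OF that] in auto)
        note I = this
        show ?thesis
          unfolding integral_mult_right
          by (subst integral_diff[OF I[OF st(2)] I[of 0]]) (use r(1) in simp_all)
      qed
      also have "integral {0..1} (\<lambda>y. k (?\<eta>, circ r y) * (circ r y / (circ r y - t))) = k (?\<eta>, t)"
        by (rule cauchy[OF hol2[OF circR] st(2)])
      also have "integral {0..1} (\<lambda>y. k (?\<eta>, circ r y) * (circ r y / (circ r y - 0))) = k (?\<eta>, 0)"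
        by (rule cauchy[OF hol2[OF circR]]) (use r in simp)
      finally show "t * integral {0..1} (\<lambda>y. K (?\<eta>, circ r y) / ((?\<eta> - s) * (circ r y - t))) =
        (k (circ r x, t) - k (circ r x, 0)) * (circ r x / (circ r x - s))" by (simp add: mult.commute)
    qed
    also have "\<dots> = k (s, t) - k (s, 0)"
    proof (rule cauchy)
      show "(\<lambda>s. k (s, t) - k (s, 0)) holomorphic_on ball 0 \<rho>"
        by (intro holomorphic_on_diff hol1) (use st r in auto)
    qed (rule st)
    finally show "k (s, t) - k (s, 0) = t * b (s, t)" by (rule sym)
  qed
qed

section \<open>Holomorphic functions of two variables\<close>

lemma holomorphic2_on_const [simp]: "holomorphic2_on (\<lambda>z. c) U"
  unfolding holomorphic2_on_def
proof
  fix z :: "complex \<times> complex" show "\<exists>a b. ((\<lambda>z. c) has_derivative (\<lambda>h. a * fst h + b * snd h)) (at z)"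
    by (rule exI[of _ 0], rule exI[of _ 0]) simp
qed

lemma holomorphic2_on_fst [simp]: "holomorphic2_on fst U"
  unfolding holomorphic2_on_def
proof
  fix z :: "complex \<times> complex" show "\<exists>a b. (fst has_derivative (\<lambda>h. a * fst h + b * snd h)) (at z)"
    by (rule exI[of _ 1], rule exI[of _ 0]) (auto intro!: derivative_eq_intros)
qed

lemma holomorphic2_on_snd [simp]: "holomorphic2_on snd U"
  unfolding holomorphic2_on_def
proof
  fix z :: "complex \<times> complex" show "\<exists>a b. (snd has_derivative (\<lambda>h. a * fst h + b * snd h)) (at z)"
    by (rule exI[of _ 0], rule exI[of _ 1]) (auto intro!: derivative_eq_intros)
qed

lemma holomorphic2_on_add:
  assumes "holomorphic2_on f U" "holomorphic2_on g U"
  shows "holomorphic2_on (\<lambda>z. f z + g z) U"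
  unfolding holomorphic2_on_def
proof
  fix z assume "z \<in> U"
  then obtain a b c d where "(f has_derivative (\<lambda>h. a * fst h + b * snd h)) (at z)"
    "(g has_derivative (\<lambda>h. c * fst h + d * snd h)) (at z)"
    using assms unfolding holomorphic2_on_def by blast
  from has_derivative_add[OF this]
  have "((\<lambda>z. f z + g z) has_derivative (\<lambda>h. (a + c) * fst h + (b + d) * snd h)) (at z)"
    by (simp add: algebra_simps)
  then show "\<exists>a b. ((\<lambda>z. f z + g z) has_derivative (\<lambda>h. a * fst h + b * snd h)) (at z)" by blast
qed

lemma holomorphic2_on_mult:
  assumes "holomorphic2_on f U" "holomorphic2_on g U"
  shows "holomorphic2_on (\<lambda>z. f z * g z) U"
  unfolding holomorphic2_on_def
proof
  fix z assume "z \<in> U"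
  then obtain a b c d where "(f has_derivative (\<lambda>h. a * fst h + b * snd h)) (at z)"
    "(g has_derivative (\<lambda>h. c * fst h + d * snd h)) (at z)"
    using assms unfolding holomorphic2_on_def by blast
  from has_derivative_mult[OF this]
  have "((\<lambda>z. f z * g z) has_derivative (\<lambda>h. (f z * c + a * g z) * fst h + (f z * d + b * g z) * snd h)) (at z)"
    by (simp add: algebra_simps)
  then show "\<exists>a b. ((\<lambda>z. f z * g z) has_derivative (\<lambda>h. a * fst h + b * snd h)) (at z)" by blast
qed

lemma holomorphic2_on_minus:
  assumes "holomorphic2_on f U" shows "holomorphic2_on (\<lambda>z. - f z) U"
  using holomorphic2_on_mult[OF holomorphic2_on_const[of "-1"] assms] by simp

lemma holomorphic2_on_diff:
  assumes "holomorphic2_on f U" "holomorphic2_on g U"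
  shows "holomorphic2_on (\<lambda>z. f z - g z) U"
  using holomorphic2_on_add[OF assms(1) holomorphic2_on_minus[OF assms(2)]] by simp

lemma holomorphic2_on_compose:
  assumes "holomorphic2_on f U" "\<And>z. z \<in> U \<Longrightarrow> g field_differentiable at (f z)"
  shows "holomorphic2_on (\<lambda>z. g (f z)) U"
  unfolding holomorphic2_on_def
proof
  fix z assume z: "z \<in> U"
  then obtain a b where 1: "(f has_derivative (\<lambda>h. a * fst h + b * snd h)) (at z)"
    using assms unfolding holomorphic2_on_def by blast
  obtain c where "(g has_derivative (\<lambda>h. c * h)) (at (f z))"
    using assms(2)[OF z] unfolding field_differentiable_def has_field_derivative_def by blast
  from has_derivative_compose[OF 1 this]
  have "((\<lambda>z. g (f z)) has_derivative (\<lambda>h. (c * a) * fst h + (c * b) * snd h)) (at z)"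
    by (simp add: algebra_simps)
  then show "\<exists>a b. ((\<lambda>z. g (f z)) has_derivative (\<lambda>h. a * fst h + b * snd h)) (at z)" by blast
qed

lemma holomorphic2_on_inverse:
  assumes "holomorphic2_on f U" "\<And>z. z \<in> U \<Longrightarrow> f z \<noteq> 0"
  shows "holomorphic2_on (\<lambda>z. inverse (f z)) U"
  by (rule holomorphic2_on_compose[OF assms(1)]) (use assms(2) in \<open>auto intro: field_differentiable_inverse\<close>)

lemma holomorphic2_on_shear:
  assumes "holomorphic2_on h U" "\<And>z. z \<in> V \<Longrightarrow> (fst z, snd z + c * fst z) \<in> U"
  shows "holomorphic2_on (\<lambda>z. h (fst z, snd z + c * fst z)) V"
  unfolding holomorphic2_on_def
proof
  fix z assume "z \<in> V"
  then obtain a b where 1: "(h has_derivative (\<lambda>h. a * fst h + b * snd h)) (at (fst z, snd z + c * fst z))"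
    using assms unfolding holomorphic2_on_def by blast
  have "((\<lambda>z. (fst z, snd z + c * fst z)) has_derivative (\<lambda>h. (fst h, snd h + c * fst h))) (at z)"
    by (auto intro!: derivative_eq_intros)
  from has_derivative_compose[OF this 1]
  have "((\<lambda>z. h (fst z, snd z + c * fst z)) has_derivative (\<lambda>h. (a + b * c) * fst h + b * snd h)) (at z)"
    by (simp add: algebra_simps)
  then show "\<exists>a b. ((\<lambda>z. h (fst z, snd z + c * fst z)) has_derivative (\<lambda>h. a * fst h + b * snd h)) (at z)" by blast
qed

lemma holomorphic2_on_poly: "holomorphic2_on f U \<Longrightarrow> holomorphic2_on (\<lambda>z. poly p (f z)) U"
  by (rule holomorphic2_on_compose)
     (auto simp: field_differentiable_def intro: poly_DERIV)

lemma holomorphic2_on_power: "holomorphic2_on f U \<Longrightarrow> holomorphic2_on (\<lambda>z. f z ^ n) U"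
  by (induction n) (auto intro: holomorphic2_on_mult)

section \<open>The local model of a radial singularity\<close>

lemma taylor_remainder:
  assumes "f holomorphic_on S" "open S"
  obtains c q where "q holomorphic_on S" "\<And>y. y \<in> S \<Longrightarrow> f y = (\<Sum>i<n. c i * y ^ i) + y ^ n * q y"
proof -
  have "\<exists>c q. q holomorphic_on S \<and> (\<forall>y\<in>S. f y = (\<Sum>i<n. c i * y ^ i) + y ^ n * q y)"
  proof (induction n)
    case 0
    show ?case using assms(1) by (intro exI[of _ "\<lambda>_. 0"] exI[of _ f]) simp
  next
    case (Suc n)
    then obtain c q where q: "q holomorphic_on S" "\<And>y. y \<in> S \<Longrightarrow> f y = (\<Sum>i<n. c i * y ^ i) + y ^ n * q y"
      by blast
    \<comment> \<open>the singularity of the difference quotient at \<open>0\<close> is removable\<close>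
    define q' where "q' y = (if y = 0 then deriv q 0 else (q y - q 0) / (y - 0))" for y
    have "q' holomorphic_on S" unfolding q'_def by (rule pole_lemma_open[OF q(1) assms(2)])
    moreover have "f y = (\<Sum>i<Suc n. (c(n := q 0)) i * y ^ i) + y ^ Suc n * q' y" if "y \<in> S" for y
    proof -
      have "q y = q 0 + y * q' y" by (simp add: q'_def)
      then show ?thesis using q(2)[OF that] by (simp add: algebra_simps)
    qed
    ultimately show ?case by blast
  qed
  then obtain c q where "q holomorphic_on S" "\<forall>y\<in>S. f y = (\<Sum>i<n. c i * y ^ i) + y ^ n * q y" by blast
  then show thesis by (intro that[of q c]) auto
qed

text \<open>
  The value at the origin and the derivative there in the direction \<open>w\<close> vanish on the ideal
  generated by \<open>f\<close> and \<open>g\<close>, because \<open>f\<close> vanishes on the line spanned by \<open>w\<close> and \<open>g\<close> vanishes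
  on it to order two. On affine functions these two functionals are independent.
\<close>

lemma germ_codim_ge_2:
  assumes g0: "f (0, 0) = 0" "g (0, 0) = 0"
    and w: "w \<noteq> (0, 0)"
    and f: "\<And>t. f (t * fst w, t * snd w) = 0"
    and g: "\<And>t. g (t * fst w, t * snd w) = t ^ 2 * G t" "G field_differentiable at 0"
  shows "germ_codim f g \<ge> 2"
proof -
  let ?l = "\<lambda>t. (t * fst w, t * snd w)"
  have D: "\<exists>D. ((\<lambda>t. h (?l t)) has_field_derivative D) (at 0)" if "is_germ h" for h
  proof -
    from that[unfolded is_germ_def] obtain U where U: "open U" "0 \<in> U" "holomorphic2_on h U"
      by (elim exE conjE)
    have l0: "?l 0 = 0" by (simp add: zero_prod_def)
    from bspec[OF U(3)[unfolded holomorphic2_on_def] U(2)]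
    obtain a b where ab: "(h has_derivative (\<lambda>x. a * fst x + b * snd x)) (at (?l 0))"
      unfolding l0 by (elim exE)
    have "(?l has_derivative ?l) (at 0)" by (auto intro!: derivative_eq_intros)
    from has_derivative_compose[OF this ab]
    have "((\<lambda>t. h (?l t)) has_field_derivative (a * fst w + b * snd w)) (at 0)"
      unfolding has_field_derivative_def fst_conv snd_conv
      by (rule has_derivative_eq_rhs) (simp add: fun_eq_iff algebra_simps)
    then show ?thesis by blast
  qed
  have ideal: "h (0, 0) = 0 \<and> ((\<lambda>t. h (?l t)) has_field_derivative 0) (at 0)" if hg: "in_germ_ideal f g h" for h
  proof -
    obtain a b where ab: "is_germ a" "is_germ b" "\<forall>\<^sub>F z in nhds 0. h z = a z * f z + b z * g z"
      using hg unfolding in_germ_ideal_def by blast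
    have lim: "filterlim ?l (nhds 0) (nhds 0)"
      by (rule tendsto_eq_intros filterlim_ident refl | simp add: zero_prod_def)+
    have ev: "\<forall>\<^sub>F t in nhds 0. h (?l t) = t * (t * (b (?l t) * G t))"
      using eventually_compose_filterlim[OF ab(3) lim]
      by eventually_elim (simp add: f g power2_eq_square)
    obtain D1 where D1: "((\<lambda>t. b (?l t)) has_field_derivative D1) (at 0)" using D[OF ab(2)] by blast
    obtain D2 where D2: "(G has_field_derivative D2) (at 0)" using g(2) unfolding field_differentiable_def by blast
    have "((\<lambda>t. t * (t * (b (?l t) * G t))) has_field_derivative 0) (at 0)"
      by (rule derivative_eq_intros D1 D2 refl | simp)+
    moreover have "h (0, 0) = 0" using eventually_nhds_x_imp_x[OF ev] by simp
    ultimately show ?thesis using DERIV_cong_ev[OF refl ev refl] by simp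
  qed
  have "enat 2 \<le> enat n" if e: "\<forall>i<n. is_germ (e i)"
    "\<forall>h. is_germ h \<longrightarrow> (\<exists>c. in_germ_ideal f g (\<lambda>z. h z - (\<Sum>i<n. c i * e i z)))" for n and e :: "nat \<Rightarrow> complex \<times> complex \<Rightarrow> complex"
  proof (rule ccontr)
    assume "\<not> enat 2 \<le> enat n"
    then have n: "n < 2" by simp
    have "\<forall>i\<in>{..<n}. \<exists>D. ((\<lambda>t. e i (?l t)) has_field_derivative D) (at 0)"
      by (intro ballI D) (use e(1) in simp)
    from bchoice[OF this]
    obtain D where De: "\<And>i. i < n \<Longrightarrow> ((\<lambda>t. e i (?l t)) has_field_derivative D i) (at 0)"
      by auto
    have key: "\<exists>c. h (0, 0) = (\<Sum>i<n. c i * e i (0, 0)) \<and> E = (\<Sum>i<n. c i * D i)"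
      if h: "is_germ h" "((\<lambda>t. h (?l t)) has_field_derivative E) (at 0)" for h E
    proof -
      obtain c where c: "in_germ_ideal f g (\<lambda>z. h z - (\<Sum>i<n. c i * e i z))" using e(2) h(1) by blast
      have "((\<lambda>t. h (?l t) - (\<Sum>i<n. c i * e i (?l t))) has_field_derivative E - (\<Sum>i<n. c i * D i)) (at 0)"
        by (intro DERIV_diff h(2) DERIV_sum DERIV_cmult De) simp
      from DERIV_unique[OF this conjunct2[OF ideal[OF c]]] have "E - (\<Sum>i<n. c i * D i) = 0" .
      moreover have "h (0, 0) = (\<Sum>i<n. c i * e i (0, 0))" using ideal[OF c] by simp
      ultimately show ?thesis by (intro exI[of _ c]) simp
    qed
    obtain a b where ab: "a * fst w + b * snd w = 1"
    proof (cases "fst w = 0")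
      case True
      then have "snd w \<noteq> 0" using w by (auto simp: prod_eq_iff)
      then have "0 * fst w + (1 / snd w) * snd w = 1" by simp
      then show ?thesis by (rule that)
    next
      case False
      then have "(1 / fst w) * fst w + 0 * snd w = 1" by simp
      then show ?thesis by (rule that)
    qed
    have germ: "is_germ (\<lambda>z. p + q * fst z + r * snd z)" for p q r
      unfolding is_germ_def
      by (intro exI[of _ UNIV] conjI open_UNIV UNIV_I holomorphic2_on_add holomorphic2_on_mult) auto
    have "((\<lambda>t. 1 + 0 * fst (?l t) + 0 * snd (?l t)) has_field_derivative 0) (at 0)"
      by (auto intro!: derivative_eq_intros)
    from key[OF germ this]
    obtain c where c: "1 = (\<Sum>i<n. c i * e i (0, 0))" "0 = (\<Sum>i<n. c i * D i)" by auto
    have "((\<lambda>t. 0 + a * fst (?l t) + b * snd (?l t)) has_field_derivative 1) (at 0)"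
      using ab by (auto intro!: derivative_eq_intros simp: mult.commute)
    from key[OF germ this]
    obtain c' where c': "0 = (\<Sum>i<n. c' i * e i (0, 0))" "1 = (\<Sum>i<n. c' i * D i)" by auto
    from n consider "n = 0" | "n = 1" by linarith
    then show False using c c' by cases auto
  qed
  then show ?thesis unfolding germ_codim_def
    by (intro Inf_greatest) (auto simp: numeral_eq_enat)
qed

text \<open>
  Near its intersection with an invariant line through the origin, the line at infinity is
  \<open>z = 0\<close> in suitable affine coordinates \<open>(y, z)\<close>, and a homogeneous foliation is defined by
  a vector field of this shape; \<open>\<alpha>\<close> and \<open>\<mu>\<close> are restrictions of members of the pencil of \<open>A\<close>
  and \<open>B\<close> (see \<open>radial_point\<close>).
\<close>

definition radial_model :: "complex \<Rightarrow> complex poly \<Rightarrow> complex poly \<Rightarrow> complex \<times> complex \<Rightarrow> complex \<times> complex" where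
  "radial_model \<kappa> \<alpha> \<mu> z =
     (\<kappa> * (poly \<alpha> (fst z) + fst z * poly \<mu> (fst z)), \<kappa> * (snd z * poly \<mu> (fst z)))"

text \<open>
  Written in this way, the derivative of a line is \<open>\<kappa> a \<alpha>(y)\<close> modulo the equation of the
  line: contact with a line is measured by the order of vanishing of \<open>\<alpha>\<close>.
\<close>

lemma lie_line_radial_model:
  "lie_line (radial_model \<kappa> \<alpha> \<mu>) a b z = \<kappa> * (a * poly \<alpha> (fst z) + line_eq a b z * poly \<mu> (fst z))"
  by (simp add: lie_line_def radial_model_def line_eq_def algebra_simps)

lemma poly_bounded_on_unit_disc:
  fixes p :: "complex poly"
  obtains M where "M > 0" "\<And>y. norm y \<le> 1 \<Longrightarrow> norm (poly p y) \<le> M"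
proof -
  have "compact (poly p ` cball 0 1)"
    by (intro compact_continuous_image continuous_intros compact_cball)
  then have "bounded (poly p ` cball 0 1)" by (rule compact_imp_bounded)
  then obtain M where "M > 0" "\<forall>x \<in> poly p ` cball 0 1. norm x \<le> M" by (auto simp: bounded_pos)
  then show thesis by (intro that[of M]) auto
qed

text \<open>
  On the line \<open>y = 0\<close> the field is \<open>(0, \<kappa> \<mu>(0) z)\<close>, so it does not vanish to order two.
\<close>

lemma vanishing_order_radial_model:
  assumes \<kappa>: "\<kappa> \<noteq> 0" and \<alpha>: "poly \<alpha> 0 = 0" and \<mu>: "poly \<mu> 0 \<noteq> 0"
  shows "vanishing_order (radial_model \<kappa> \<alpha> \<mu>) = 1"
proof -
  let ?X = "radial_model \<kappa> \<alpha> \<mu>"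
  have one: "(\<lambda>z. norm (?X z)) \<in> bigo (at 0) (\<lambda>z. norm z ^ 1)"
  proof -
    obtain \<beta> where \<beta>: "\<alpha> = [:0, 1:] * \<beta>"
      using \<alpha> poly_eq_0_iff_dvd[of \<alpha> 0] by (auto simp: dvd_def)
    obtain M1 where M1: "M1 > 0" "\<And>y. norm y \<le> 1 \<Longrightarrow> norm (poly (\<beta> + \<mu>) y) \<le> M1"
      using poly_bounded_on_unit_disc[of "\<beta> + \<mu>"] by blast
    obtain M2 where M2: "M2 > 0" "\<And>y. norm y \<le> 1 \<Longrightarrow> norm (poly \<mu> y) \<le> M2"
      using poly_bounded_on_unit_disc[of \<mu>] by blast
    have "norm (?X z) \<le> norm \<kappa> * (M1 + M2) * norm z" if z: "norm z \<le> 1" for z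
    proof -
      have f: "norm (fst z) \<le> 1" using z norm_fst_le[of "fst z" "snd z"] by simp
      have "norm (?X z) \<le> norm (fst (?X z)) + norm (snd (?X z))"
        using norm_Pair_le[of "fst (?X z)" "snd (?X z)"] by simp
      also have "fst (?X z) = \<kappa> * (poly (\<beta> + \<mu>) (fst z) * fst z)"
        by (simp add: radial_model_def \<beta> algebra_simps)
      also have "snd (?X z) = \<kappa> * (poly \<mu> (fst z) * snd z)"
        by (simp add: radial_model_def)
      also have "norm (\<kappa> * (poly (\<beta> + \<mu>) (fst z) * fst z)) + norm (\<kappa> * (poly \<mu> (fst z) * snd z)) \<le>
         norm \<kappa> * (M1 * norm z) + norm \<kappa> * (M2 * norm z)"
        unfolding norm_mult
        by (intro add_mono mult_left_mono mult_mono M1(2)[OF f] M2(2)[OF f] norm_ge_zero)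
           (use M1(1) M2(1) norm_fst_le[of "fst z" "snd z"] norm_snd_le[of "snd z" "fst z"] in auto)
      finally show ?thesis by (simp add: algebra_simps)
    qed
    moreover have "\<forall>\<^sub>F z in at (0 :: complex \<times> complex). norm z \<le> 1"
      unfolding eventually_at by (rule exI[of _ 1]) (auto simp: dist_norm)
    ultimately show ?thesis
      by (intro bigoI[of _ "norm \<kappa> * (M1 + M2)"]) (auto elim: eventually_mono)
  qed
  have other: "n \<le> 1" if n: "(\<lambda>z. norm (?X z)) \<in> bigo (at 0) (\<lambda>z. norm z ^ n)" for n
  proof (rule ccontr)
    assume "\<not> n \<le> 1"
    then obtain m where m: "n = Suc (Suc m)" by (cases n; cases "n - 1") auto
    obtain c where c: "c > 0" "\<forall>\<^sub>F z in at 0. norm (norm (?X z)) \<le> c * norm (norm z ^ n)"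
      using n by (elim landau_o.bigE)
    then obtain \<delta> where \<delta>: "\<delta> > 0" "\<And>z. z \<noteq> 0 \<Longrightarrow> norm z < \<delta> \<Longrightarrow> norm (?X z) \<le> c * norm z ^ n"
      by (auto simp: eventually_at dist_norm)
    define K where "K = norm (\<kappa> * poly \<mu> 0)"
    have K: "K > 0" using \<kappa> \<mu> by (simp add: K_def)
    \<comment> \<open>\<open>t\<close> is so small that \<open>c t \<le> K / 2\<close>, against \<open>K \<le> c t\<close>\<close>
    define t where "t = min (\<delta> / 2) (min 1 (K / (2 * c)))"
    have t: "t > 0" "t < \<delta>" "t \<le> 1" "t \<le> K / (2 * c)" using \<delta>(1) K c(1) by (auto simp: t_def)
    have "norm (?X (0, of_real t)) \<le> c * norm (0 :: complex, of_real t :: complex) ^ n"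
      by (rule \<delta>(2)) (use t in \<open>auto simp: norm_Pair zero_prod_def\<close>)
    moreover have "norm (?X (0, of_real t)) = K * t"
      using t(1) by (simp add: radial_model_def \<alpha> norm_Pair K_def norm_mult mult_ac)
    moreover have "norm (0 :: complex, of_real t :: complex) = t" using t(1) by (simp add: norm_Pair)
    ultimately have "K * t \<le> c * (t * (t * t ^ m))" by (simp add: m)
    then have "K \<le> c * (t * t ^ m)" using t(1) by (simp add: mult.left_commute)
    also have "\<dots> \<le> c * (t * 1)"
      using c(1) t by (intro mult_left_mono power_le_one) auto
    also have "\<dots> \<le> c * (K / (2 * c))" using t(4) c(1) by (intro mult_left_mono) auto
    also have "\<dots> = K / 2" using c(1) by simp
    finally show False using K by simp
  qed
  show ?thesis unfolding vanishing_order_def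
  proof (rule antisym)
    show "Sup {enat n |n. (\<lambda>z. norm (?X z)) \<in> bigo (at 0) (\<lambda>z. norm z ^ n)} \<le> 1"
      by (rule Sup_least) (use other in \<open>auto simp: one_enat_def\<close>)
    show "1 \<le> Sup {enat n |n. (\<lambda>z. norm (?X z)) \<in> bigo (at 0) (\<lambda>z. norm z ^ n)}"
      by (rule Sup_upper) (use one in \<open>auto simp: one_enat_def intro!: exI[of _ 1]\<close>)
  qed
qed

lemma tang_radial_model_ge_2:
  assumes j: "j \<ge> 2" and \<alpha>: "\<alpha> = [:0, 1:] ^ j * \<alpha>0" and ab: "(a, b) \<noteq> (0, 0)"
  shows "tang (radial_model \<kappa> \<alpha> \<mu>) a b \<ge> 2"
  unfolding tang_def
proof (rule germ_codim_ge_2)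
  show "line_eq a b (0, 0) = 0" by (simp add: line_eq_def)
  show "lie_line (radial_model \<kappa> \<alpha> \<mu>) a b (0, 0) = 0"
    using j by (simp add: lie_line_radial_model line_eq_def \<alpha>)
  show "(b, - a) \<noteq> (0, 0)" using ab by auto
  show l: "line_eq a b (t * fst (b, - a), t * snd (b, - a)) = 0" for t by (simp add: line_eq_def)
  show "lie_line (radial_model \<kappa> \<alpha> \<mu>) a b (t * fst (b, - a), t * snd (b, - a)) =
     t ^ 2 * (\<kappa> * a * b ^ 2 * poly ([:0, 1:] ^ (j - 2) * \<alpha>0) (t * b))" for t
  proof -
    have "(t * b) ^ j = (t * b) ^ 2 * (t * b) ^ (j - 2)"
      using power_add[of "t * b" 2 "j - 2"] j by (simp only: le_add_diff_inverse)
    then show ?thesis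
      unfolding lie_line_radial_model l \<alpha> fst_conv poly_mult poly_power
      by (simp add: power2_eq_square line_eq_def)
  qed
  have D: "((\<lambda>t. \<kappa> * a * b ^ 2 * poly p (t * b)) has_field_derivative \<kappa> * a * b ^ 2 * (poly (pderiv p) (0 * b) * b)) (at 0)" for p
    by (rule derivative_eq_intros poly_DERIV[THEN DERIV_chain2] refl | simp)+
  show "(\<lambda>t. \<kappa> * a * b ^ 2 * poly ([:0, 1:] ^ (j - 2) * \<alpha>0) (t * b)) field_differentiable at 0"
    unfolding field_differentiable_def by (rule exI, rule D)
qed

text \<open>
  For the line \<open>y + z = 0\<close> the ideal is generated by \<open>y + z\<close> and \<open>y^j\<close>, so the powers of \<open>y\<close>
  below \<open>y^j\<close> span the quotient: a germ is first replaced by its restriction to the line,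
  dividing by \<open>y + z\<close>, and then by a Taylor polynomial of this restriction.
\<close>

lemma tang_radial_model_le:
  assumes \<kappa>: "\<kappa> \<noteq> 0" and \<alpha>: "\<alpha> = [:0, 1:] ^ j * \<alpha>0" and \<alpha>0: "poly \<alpha>0 0 \<noteq> 0"
  shows "tang (radial_model \<kappa> \<alpha> \<mu>) 1 1 \<le> enat j"
  unfolding tang_def germ_codim_def
proof (rule Inf_lower, rule CollectI, intro exI[of _ j] exI[of _ "\<lambda>i z. fst z ^ i"] conjI refl allI impI)
  fix i show "is_germ (\<lambda>z. fst z ^ i)"
    unfolding is_germ_def
    by (intro exI[of _ UNIV] conjI open_UNIV UNIV_I holomorphic2_on_power holomorphic2_on_fst)
next
  fix h assume "is_germ h"
  from this[unfolded is_germ_def] obtain U where U: "open U" "0 \<in> U" "holomorphic2_on h U"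
    by (elim exE conjE)
  obtain \<epsilon> where \<epsilon>: "\<epsilon> > 0" "ball 0 \<epsilon> \<subseteq> U" using U(1,2) by (meson open_contains_ball)
  define \<rho> where "\<rho> = \<epsilon> / 4"
  have \<rho>: "\<rho> > 0" using \<epsilon>(1) by (simp add: \<rho>_def)
  define k where "k z = h (fst z, snd z + (-1) * fst z)" for z
  have "holomorphic2_on k (ball 0 \<rho> \<times> ball 0 \<rho>)"
    unfolding k_def
  proof (rule holomorphic2_on_shear[OF U(3)])
    fix z :: "complex \<times> complex" assume z: "z \<in> ball 0 \<rho> \<times> ball 0 \<rho>"
    have "norm (fst z, snd z + (-1) * fst z) \<le> norm (fst z) + norm (snd z + (-1) * fst z)"
      by (rule norm_Pair_le)
    also have "norm (snd z + (-1) * fst z) \<le> norm (snd z) + norm (fst z)"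
      using norm_triangle_ineq4[of "snd z" "fst z"] by simp
    finally have "norm (fst z, snd z + (-1) * fst z) < \<epsilon>"
      using z \<epsilon>(1) by (auto simp: \<rho>_def mem_Times_iff)
    then show "(fst z, snd z + (-1) * fst z) \<in> U" using \<epsilon>(2) by (simp add: subset_iff)
  qed
  note k = this
  have r: "0 < \<rho> / 2" "\<rho> / 2 < \<rho>" using \<rho> by auto
  obtain b where b: "holomorphic2_on b (ball 0 (\<rho>/2) \<times> ball 0 (\<rho>/2))"
    "\<And>s t. s \<in> ball 0 (\<rho>/2) \<Longrightarrow> t \<in> ball 0 (\<rho>/2) \<Longrightarrow> k (s, t) - k (s, 0) = t * b (s, t)"
    using division_by_coordinate[OF k r] by blast
  have "(\<lambda>y. k (y, 0)) holomorphic_on ball 0 \<rho>"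
    unfolding holomorphic_on_def
    by (rule ballI, rule field_differentiable_at_within, rule holomorphic2_on_slices(1)[OF k]) (use \<rho> in simp)
  from taylor_remainder[OF this open_ball, of j]
  obtain c q where q: "q holomorphic_on ball 0 \<rho>"
    "\<And>y. y \<in> ball 0 \<rho> \<Longrightarrow> k (y, 0) = (\<Sum>i<j. c i * y ^ i) + y ^ j * q y"
    by blast
  obtain \<delta> where \<delta>: "\<delta> > 0" "\<And>y. dist 0 y < \<delta> \<Longrightarrow> poly \<alpha>0 y \<noteq> 0"
    using continuous_at_avoid[of 0 "poly \<alpha>0" 0] \<alpha>0 by (auto simp: poly_isCont)
  define r' where "r' = min (\<rho> / 4) \<delta>"
  have r': "r' > 0" using \<rho> \<delta>(1) by (simp add: r'_def)
  let ?V = "ball 0 r' \<times> ball 0 r' :: (complex \<times> complex) set"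
  have small: "fst z \<in> ball 0 (\<rho>/2)" "snd z + 1 * fst z \<in> ball 0 (\<rho>/2)" "fst z \<in> ball 0 \<rho>" "poly \<alpha>0 (fst z) \<noteq> 0"
    if z: "z \<in> ?V" for z
  proof -
    have "norm (fst z) < \<rho> / 4" "norm (snd z) < \<rho> / 4" "dist 0 (fst z) < \<delta>" using z by (auto simp: r'_def mem_Times_iff)
    moreover have "norm (snd z + 1 * fst z) \<le> norm (snd z) + norm (fst z)"
      using norm_triangle_ineq[of "snd z" "fst z"] by simp
    ultimately show "fst z \<in> ball 0 (\<rho>/2)" "snd z + 1 * fst z \<in> ball 0 (\<rho>/2)" "fst z \<in> ball 0 \<rho>" "poly \<alpha>0 (fst z) \<noteq> 0"
      using \<rho> \<delta>(2) by auto
  qed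
  define b1 where "b1 z = b (fst z, snd z + 1 * fst z)" for z
  define q1 where "q1 y = q y / poly \<alpha>0 y" for y
  have b1: "holomorphic2_on b1 ?V"
    unfolding b1_def by (rule holomorphic2_on_shear[OF b(1)]) (use small in simp)
  have q1: "holomorphic2_on (\<lambda>z. q1 (fst z)) ?V"
  proof (rule holomorphic2_on_compose[OF holomorphic2_on_fst])
    fix z assume z: "z \<in> ?V"
    have "q field_differentiable at (fst z)"
      using q(1) small(3)[OF z] by (simp add: holomorphic_on_open field_differentiable_def)
    moreover have "poly \<alpha>0 field_differentiable at (fst z)"
      unfolding field_differentiable_def by (rule exI, rule poly_DERIV)
    ultimately show "q1 field_differentiable at (fst z)"
      unfolding q1_def using small(4)[OF z] by (rule field_differentiable_divide)
  qed
  define a where "a z = b1 z - q1 (fst z) * poly \<mu> (fst z)" for z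
  define b' where "b' z = q1 (fst z) * (1 / \<kappa>)" for z :: "complex \<times> complex"
  have V: "open ?V" "0 \<in> ?V" using r' by (auto intro: open_Times simp: zero_prod_def)
  show "\<exists>c. in_germ_ideal (line_eq 1 1) (lie_line (radial_model \<kappa> \<alpha> \<mu>) 1 1) (\<lambda>z. h z - (\<Sum>i<j. c i * fst z ^ i))"
    unfolding in_germ_ideal_def
  proof (rule exI[of _ c], rule exI[of _ a], rule exI[of _ b'], intro conjI)
    show "is_germ a" unfolding is_germ_def a_def
      by (intro exI[of _ ?V] conjI V holomorphic2_on_diff b1 holomorphic2_on_mult q1 holomorphic2_on_poly holomorphic2_on_fst)
    show "is_germ b'" unfolding is_germ_def b'_def
      by (intro exI[of _ ?V] conjI V holomorphic2_on_mult q1 holomorphic2_on_const)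
    have "\<forall>\<^sub>F z in nhds 0. z \<in> ?V" using V by (rule eventually_nhds_in_open)
    then show "\<forall>\<^sub>F z in nhds 0. h z - (\<Sum>i<j. c i * fst z ^ i) =
       a z * line_eq 1 1 z + b' z * lie_line (radial_model \<kappa> \<alpha> \<mu>) 1 1 z"
    proof eventually_elim
      case (elim z)
      let ?l = "fst z + snd z"
      have "h z = k (fst z, snd z + 1 * fst z)" by (simp add: k_def)
      also have "\<dots> = k (fst z, 0) + (snd z + 1 * fst z) * b1 z"
        using b(2)[OF small(1,2)[OF elim]] by (simp add: b1_def algebra_simps)
      finally have "h z - (\<Sum>i<j. c i * fst z ^ i) = fst z ^ j * q (fst z) + ?l * b1 z"
        using q(2)[OF small(3)[OF elim]] by (simp add: add.commute)
      moreover have "fst z ^ j * q (fst z) = q1 (fst z) * poly \<alpha> (fst z)"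
        using small(4)[OF elim] by (simp add: q1_def \<alpha> poly_power)
      moreover have "a z * line_eq 1 1 z + b' z * lie_line (radial_model \<kappa> \<alpha> \<mu>) 1 1 z =
          a z * ?l + q1 (fst z) * (poly \<alpha> (fst z) + ?l * poly \<mu> (fst z))"
        using \<kappa> by (simp add: lie_line_radial_model line_eq_def b'_def)
      ultimately show ?case by (simp add: a_def algebra_simps)
    qed
  qed
qed

lemma radial_model_orders:
  assumes \<kappa>: "\<kappa> \<noteq> 0" and \<alpha>: "\<alpha> = [:0, 1:] ^ j * \<alpha>0" and \<alpha>0: "poly \<alpha>0 0 \<noteq> 0"
    and \<mu>: "poly \<mu> 0 \<noteq> 0" and j: "j \<ge> 2"
  obtains k where "1 \<le> k" "k \<le> j - 1" "vanishing_order (radial_model \<kappa> \<alpha> \<mu>) = 1"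
    "tangency_order (radial_model \<kappa> \<alpha> \<mu>) \<ge> 2" "tangency_order (radial_model \<kappa> \<alpha> \<mu>) - 1 = enat k"
proof -
  let ?X = "radial_model \<kappa> \<alpha> \<mu>"
  have v: "vanishing_order ?X = 1"
    by (rule vanishing_order_radial_model[OF \<kappa> _ \<mu>]) (use j \<alpha> in simp)
  have ge: "tangency_order ?X \<ge> 2"
    unfolding tangency_order_def
    by (rule Inf_greatest) (use tang_radial_model_ge_2[OF j \<alpha>] in blast)
  have "\<not> germ_invariant_line ?X 1 1"
  proof
    assume "germ_invariant_line ?X 1 1"
    then have ev: "\<forall>\<^sub>F z in nhds 0. line_eq 1 1 z = 0 \<longrightarrow> lie_line ?X 1 1 z = 0"
      unfolding germ_invariant_line_def .
    have lim: "filterlim (\<lambda>t. (t, - t)) (nhds 0) (nhds (0::complex))"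
      by (rule tendsto_eq_intros filterlim_ident refl | simp add: zero_prod_def)+
    have "\<forall>\<^sub>F t in nhds 0. t ^ j * poly \<alpha>0 t = 0"
      using eventually_compose_filterlim[OF ev lim]
      by eventually_elim (use \<kappa> in \<open>simp add: lie_line_radial_model line_eq_def \<alpha> poly_power\<close>)
    moreover have "\<forall>\<^sub>F t in nhds 0. poly \<alpha>0 t \<noteq> 0"
      by (rule tendsto_imp_eventually_ne[OF _ \<alpha>0]) (rule isCont_tendsto_compose[OF poly_isCont filterlim_ident])
    ultimately have "\<forall>\<^sub>F t in nhds (0::complex). t = 0"
      by eventually_elim simp
    then have "\<forall>\<^sub>F t in at (0::complex). t = 0" by (rule filter_leD[OF at_within_le_nhds])
    moreover have "\<forall>\<^sub>F t in at (0::complex). t \<noteq> 0" by (rule eventually_neq_at_within)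
    ultimately have "\<forall>\<^sub>F t in at (0::complex). False" by eventually_elim simp
    then show False by simp
  qed
  then have "tangency_order ?X \<le> tang ?X 1 1"
    unfolding tangency_order_def by (intro Inf_lower) (use one_neq_zero in blast)
  also have "\<dots> \<le> enat j" by (rule tang_radial_model_le[OF \<kappa> \<alpha> \<alpha>0])
  finally obtain n where n: "tangency_order ?X = enat n" "n \<le> j"
    using enat_ile by fastforce
  have "2 \<le> n" using ge unfolding n(1) by (simp add: numeral_eq_enat)
  then show thesis
    using n by (intro that[of "n - 1"] v ge) (auto simp: one_enat_def)
qed

section \<open>Homogeneous foliations and their singular points\<close>

lemma vector3_simps [simp]:
  "vector [a, b, c] $ (1::3) = (a :: complex)" "vector [a, b, c] $ (2::3) = b" "vector [a, b, c] $ (3::3) = c"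
  by (rule vector_3)+

lemma vec3_eq_iff: "v = (w :: complex ^ 3) \<longleftrightarrow> v $ 1 = w $ 1 \<and> v $ 2 = w $ 2 \<and> v $ 3 = w $ 3"
  by (auto simp: vec_eq_iff forall_3)

lemma eval_projective_form:
  "eval_form (projective_form A B) v = vector [v $ 3 * eval2 A (v $ 1, v $ 2), v $ 3 * eval2 B (v $ 1, v $ 2),
     - (v $ 1 * eval2 A (v $ 1, v $ 2) + v $ 2 * eval2 B (v $ 1, v $ 2))]"
proof -
  have "vector [a, b, c] $ (1::3) = (a :: poly3)" "vector [a, b, c] $ (2::3) = b" "vector [a, b, c] $ (3::3) = c" for a b c
    by (rule vector_3)+
  then show ?thesis
    by (simp add: vec3_eq_iff eval_form_def projective_form_def eval3_def eval2_def var_x_def var_y_def)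
qed

lemma matrix_vector_mult_3:
  fixes M :: "complex ^ 3 ^ 3"
  shows "(M *v v) $ i = M $ i $ 1 * v $ 1 + M $ i $ 2 * v $ 2 + M $ i $ 3 * v $ 3"
  by (simp add: matrix_vector_mult_def sum_3)

lemma invertible_matrix_vector_cancel:
  fixes g :: "complex ^ 3 ^ 3"
  assumes "invertible g"
  shows "g *v v = g *v w \<longleftrightarrow> v = w"
  using assms by (metis invertible_def matrix_vector_mul_assoc matrix_vector_mul_lid)

lemma span_scale:
  fixes v :: "complex ^ 3" assumes "k \<noteq> 0" shows "vec.span {k *s v} = vec.span {v}"
  unfolding vec.span_singleton
proof (intro equalityI subsetI)
  fix x assume "x \<in> range (\<lambda>c. c *s (k *s v))"
  then obtain c where "x = c *s (k *s v)" by auto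
  then have "x = (c * k) *s v" by (simp add: vector_smult_assoc)
  then show "x \<in> range (\<lambda>c. c *s v)" by blast
next
  fix x assume "x \<in> range (\<lambda>c. c *s v)"
  then obtain c where "x = c *s v" by auto
  then have "x = (c / k) *s (k *s v)" using assms by (simp add: vector_smult_assoc)
  then show "x \<in> range (\<lambda>c. c *s (k *s v))" by blast
qed

lemma pullback_zero_iff:
  assumes "invertible g" "is_pullback g F G"
  shows "eval_form F (g *v v) = 0 \<longleftrightarrow> eval_form G v = 0"
proof -
  obtain c where c: "c \<noteq> 0" "\<And>v. eval_form G v = c *s (transpose g *v eval_form F (g *v v))"
    using assms(2) unfolding is_pullback_def by blast
  obtain g' where "g ** g' = mat 1" "g' ** g = mat 1" using assms(1) unfolding invertible_def by blast
  then have "transpose g' ** transpose g = mat 1" "transpose g ** transpose g' = mat 1"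
    by (simp_all flip: matrix_transpose_mul)
  then have t: "invertible (transpose g)" unfolding invertible_def by blast
  show ?thesis
    using invertible_matrix_vector_cancel[OF t, of _ 0] c by (simp add: vector_mul_eq_0)
qed

text \<open>
  If \<open>x A + y B\<close> were zero, \<open>A\<close> and \<open>B\<close> would be \<open>- y Q\<close> and \<open>x Q\<close> for a form \<open>Q\<close> of degree
  \<open>d - 1\<close>, and would vanish together at the zeros of \<open>Q\<close>. The proof argues with the
  restrictions to \<open>x = 1\<close>, where \<open>Q\<close> is the restriction of \<open>B\<close>.
\<close>

lemma tangent_cone_nonzero:
  assumes hA: "homogeneous2 d A" and hB: "homogeneous2 d B" and d: "d \<ge> 2"
    and nz: "\<And>w. w \<noteq> (0, 0) \<Longrightarrow> eval2 A w \<noteq> 0 \<or> eval2 B w \<noteq> 0"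
  obtains w where "fst w * eval2 A w + snd w * eval2 B w \<noteq> 0"
proof (rule ccontr)
  assume "\<not> thesis"
  then have 0: "fst w * eval2 A w + snd w * eval2 B w = 0" for w using that by blast
  let ?a = "restrict_line A (1, 0) (0, 1)" and ?b = "restrict_line B (1, 0) (0, 1)"
  have ab: "?a = - ([:0, 1:] * ?b)"
  proof -
    have "poly ?a t = poly (- ([:0, 1:] * ?b)) t" for t
      using 0[of "(1, t)"] by (simp add: poly_restrict eq_neg_iff_add_eq_0)
    then show ?thesis using poly_eq_poly_eq_iff by blast
  qed
  have "poly ?b t \<noteq> 0" for t
  proof
    assume t: "poly ?b t = 0"
    have "poly ?a t = 0" unfolding ab using t by simp
    with t nz[of "(1, t)"] show False by (simp add: poly_restrict)
  qed
  then obtain c where c: "?b = [:c:]" by (rule poly_const_if_no_root)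
  then have "coeff ?a d = 0" "coeff ?b d = 0"
    using d unfolding ab c by (auto simp: coeff_pCons split: nat.splits)
  then show False
    using nz[of "(0, 1)"] leading_coeff_restrict[OF hA, of "(1,0)" "(0,1)"] leading_coeff_restrict[OF hB, of "(1,0)" "(0,1)"] by simp
qed

locale homogeneous_chart =
  fixes d :: nat and F :: form3 and g :: "complex ^ 3 ^ 3" and A B :: poly2
  assumes d_ge_2: "d \<ge> 2" and chart: "described_in_chart d F g A B"
begin

lemma homogeneous_A: "homogeneous2 d A" and homogeneous_B: "homogeneous2 d B" and g: "invertible g"
  and coprime_AB: "coprime A B" and pullback: "is_pullback g F (projective_form A B)"
  using chart by (auto simp: described_in_chart_def)

lemma d_ge_1: "d \<ge> 1" using d_ge_2 by simp

lemma no_common_zero: "w \<noteq> (0, 0) \<Longrightarrow> eval2 A w \<noteq> 0 \<or> eval2 B w \<noteq> 0"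
  by (rule coprime_no_common_zero[OF homogeneous_A homogeneous_B coprime_AB])

definition infinite_point :: "complex \<times> complex \<Rightarrow> (complex ^ 3) set" where
  "infinite_point v = vec.span {g *v vector [fst v, snd v, 0]}"

definition line_through :: "complex \<times> complex \<Rightarrow> (complex \<times> complex) set" where
  "line_through v = {w. line_eq (snd v) (- fst v) w = 0}"

lemma infinite_point_scale: "c \<noteq> 0 \<Longrightarrow> infinite_point (c * fst v, c * snd v) = infinite_point v"
proof -
  assume "c \<noteq> 0"
  have "g *v vector [c * fst v, c * snd v, 0] = c *s (g *v vector [fst v, snd v, 0])"
    by (simp add: vec3_eq_iff matrix_vector_mult_3 algebra_simps)
  then show ?thesis using span_scale[OF \<open>c \<noteq> 0\<close>] by (simp add: infinite_point_def)
qed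

lemma line_through_scale: "c \<noteq> 0 \<Longrightarrow> line_through (c * fst v, c * snd v) = line_through v"
proof -
  assume c: "c \<noteq> 0"
  have "line_eq (snd (c * fst v, c * snd v)) (- fst (c * fst v, c * snd v)) w = c * line_eq (snd v) (- fst v) w" for w
    by (simp add: line_eq_def algebra_simps)
  with c show ?thesis by (simp add: line_through_def)
qed

lemma det2_if_line_through_eq: "line_through v = line_through w \<Longrightarrow> det2 v w = 0"
proof -
  assume "line_through v = line_through w"
  moreover have "v \<in> line_through v" by (simp add: line_through_def line_eq_def)
  ultimately show ?thesis by (simp add: line_through_def line_eq_def det2_def algebra_simps)
qed

lemma det2_if_infinite_point_eq: "infinite_point v = infinite_point w \<Longrightarrow> det2 v w = 0"
proof -
  assume "infinite_point v = infinite_point w"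
  then have "g *v vector [fst v, snd v, 0] \<in> vec.span {g *v vector [fst w, snd w, 0]}"
    unfolding infinite_point_def using vec.span_base by blast
  then obtain k where "g *v vector [fst v, snd v, 0] = k *s (g *v vector [fst w, snd w, 0])"
    unfolding vec.span_singleton by auto
  also have "\<dots> = g *v (k *s vector [fst w, snd w, 0])"
    by (simp add: vec3_eq_iff matrix_vector_mult_3 algebra_simps)
  finally have "vector [fst v, snd v, 0] = k *s (vector [fst w, snd w, 0] :: complex ^ 3)"
    using invertible_matrix_vector_cancel[OF g] by blast
  then show ?thesis by (simp add: vec3_eq_iff det2_def)
qed

lemma singular_infinite_point:
  assumes "v \<noteq> (0, 0)" "fst v * eval2 A v + snd v * eval2 B v = 0"
  shows "singular_point F (infinite_point v)"
  unfolding singular_point_def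
proof
  have "(vector [fst v, snd v, 0] :: complex ^ 3) \<noteq> 0"
    using assms(1) by (auto simp: vec3_eq_iff prod_eq_iff)
  then have "g *v vector [fst v, snd v, 0] \<noteq> 0"
    using invertible_matrix_vector_cancel[OF g, of _ 0] by simp
  then show "infinite_point v \<in> projective_plane" unfolding projective_plane_def infinite_point_def by blast
  show "\<forall>x\<in>infinite_point v. eval_form F x = 0"
  proof
    fix x assume "x \<in> infinite_point v"
    then obtain k where "x = k *s (g *v vector [fst v, snd v, 0])"
      unfolding infinite_point_def vec.span_singleton by auto
    also have "\<dots> = g *v vector [k * fst v, k * snd v, 0]"
      by (simp add: vec3_eq_iff matrix_vector_mult_3 algebra_simps)
    finally have x: "x = g *v vector [k * fst v, k * snd v, 0]" .
    have "k * fst v * eval2 A (k * fst v, k * snd v) + k * snd v * eval2 B (k * fst v, k * snd v) =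
       k ^ Suc d * (fst v * eval2 A v + snd v * eval2 B v)"
      using eval2_homogeneous[OF homogeneous_A, of k "fst v" "snd v"] eval2_homogeneous[OF homogeneous_B, of k "fst v" "snd v"]
      by (simp add: algebra_simps)
    then show "eval_form F x = 0"
      unfolding x pullback_zero_iff[OF g pullback] eval_projective_form using assms(2)
      by (simp add: vec3_eq_iff)
  qed
qed

text \<open>
  The type counts radial points with \<open>card\<close>, which is zero on infinite sets. So the bound of
  \<open>three_inflection_directions\<close> depends on finiteness, here and in
  \<open>finite_transverse_lines\<close>.
\<close>

lemma finite_singular_points: "finite {s. singular_point F s}"
proof -
  define C where "C = var_x * A + var_y * B"
  have hC: "homogeneous2 (1 + d) C"
    unfolding C_def by (intro homogeneous2_add homogeneous2_mult homogeneous2_var homogeneous_A homogeneous_B)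
  obtain w where w: "fst w * eval2 A w + snd w * eval2 B w \<noteq> 0"
    by (rule tangent_cone_nonzero[OF homogeneous_A homogeneous_B d_ge_2 no_common_zero])
  then have "eval2 C w \<noteq> 0" by (simp add: C_def)
  from finitely_many_zero_directions[OF hC this] obtain V where V: "finite V"
    "\<And>v. v \<noteq> (0, 0) \<Longrightarrow> eval2 C v = 0 \<Longrightarrow> \<exists>v'\<in>V. \<exists>c. c \<noteq> 0 \<and> v = (c * fst v', c * snd v')"
    by blast
  have "{s. singular_point F s} \<subseteq> insert (vec.span {g *v vector [0, 0, 1]}) (infinite_point ` V)"
  proof
    fix s assume "s \<in> {s. singular_point F s}"
    then obtain x where x: "x \<noteq> 0" "s = vec.span {x}" "eval_form F x = 0"
      unfolding singular_point_def projective_plane_def using vec.span_base by blast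
    obtain g' where "g ** g' = mat 1" using g unfolding invertible_def by blast
    then have gx: "x = g *v (g' *v x)" by (simp add: matrix_vector_mul_assoc)
    define y where "y = g' *v x"
    have y0: "y \<noteq> 0" using x(1) gx by (auto simp: y_def)
    have "eval_form (projective_form A B) y = 0"
      using x(3) gx pullback_zero_iff[OF g pullback, of y] by (simp add: y_def)
    then have P: "y $ 3 * eval2 A (y $ 1, y $ 2) = 0" "y $ 3 * eval2 B (y $ 1, y $ 2) = 0"
      "y $ 1 * eval2 A (y $ 1, y $ 2) + y $ 2 * eval2 B (y $ 1, y $ 2) = 0"
      unfolding eval_projective_form by (auto simp: vec3_eq_iff neg_eq_iff_add_eq_0 add.commute)
    show "s \<in> insert (vec.span {g *v vector [0, 0, 1]}) (infinite_point ` V)"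
    proof (cases "y $ 3 = 0")
      case False
      then have "(y $ 1, y $ 2) = (0, 0)" using P no_common_zero by auto
      then have "y = (y $ 3) *s vector [0, 0, 1]" by (simp add: vec3_eq_iff)
      then have "x = (y $ 3) *s (g *v vector [0, 0, 1])"
        using gx vec.scale[of g "y $ 3" "vector [0, 0, 1]"] unfolding y_def[symmetric] by simp
      then show ?thesis using span_scale[OF False] x(2) by simp
    next
      case True
      with y0 have v: "(y $ 1, y $ 2) \<noteq> (0, 0)" by (auto simp: vec3_eq_iff)
      have "eval2 C (y $ 1, y $ 2) = 0" using P(3) by (simp add: C_def)
      from V(2)[OF v this] obtain v' c where v': "v' \<in> V" "c \<noteq> 0" "(y $ 1, y $ 2) = (c * fst v', c * snd v')"
        by blast
      have "y = vector [fst (y $ 1, y $ 2), snd (y $ 1, y $ 2), 0]" using True by (simp add: vec3_eq_iff)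
      then have "g *v y = g *v vector [fst (y $ 1, y $ 2), snd (y $ 1, y $ 2), 0]" by (rule arg_cong)
      then have "s = infinite_point (y $ 1, y $ 2)" unfolding infinite_point_def x(2) using gx by (simp only: y_def)
      also have "\<dots> = infinite_point v'" unfolding v'(3) by (rule infinite_point_scale[OF v'(2)])
      finally show ?thesis using v'(1) by blast
    qed
  qed
  then show ?thesis by (rule finite_subset) (use V(1) in simp)
qed

end

section \<open>The lines of inflection and the degree of the type\<close>

lemma local_field_chart:
  fixes g M :: "complex ^ 3 ^ 3"
  assumes "\<And>x. eval_form G x = c *s (transpose g *v eval_form F (g *v x))" "c \<noteq> 0"
  shows "local_field F (g ** M) z =
    (let w = transpose M *v eval_form G (M *v vector [fst z, snd z, 1]) in ((1 / c) * w $ 2, - (1 / c) * w $ 1))"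
proof -
  let ?x = "M *v vector [fst z, snd z, 1] :: complex ^ 3"
  have "transpose (g ** M) *v eval_form F ((g ** M) *v vector [fst z, snd z, 1]) =
      transpose M *v (transpose g *v eval_form F (g *v ?x))"
    unfolding matrix_transpose_mul matrix_vector_mul_assoc ..
  also have "transpose g *v eval_form F (g *v ?x) = (1 / c) *s eval_form G ?x"
    using assms(2) unfolding assms(1) by (simp add: vector_smult_assoc)
  also have "transpose M *v ((1 / c) *s eval_form G ?x) = (1 / c) *s (transpose M *v eval_form G ?x)"
    by (rule vec.scale)
  finally show ?thesis unfolding local_field_def Let_def by simp
qed

context homogeneous_chart
begin

lemma complement:
  assumes "v \<noteq> (0, 0)"
  obtains u where "det2 v u \<noteq> 0"
proof (cases "fst v = 0")
  case True
  then have "det2 v (1, 0) \<noteq> 0" using assms by (auto simp: det2_def prod_eq_iff)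
  then show ?thesis by (rule that)
next
  case False
  then have "det2 v (0, 1) \<noteq> 0" by (auto simp: det2_def)
  then show ?thesis by (rule that)
qed

text \<open>
  The matrix \<open>M\<close> below gives an affine chart \<open>(y, z)\<close> centred at the point at infinity in
  the direction \<open>v\<close>, with the line at infinity as the axis of \<open>y\<close>. In this chart the field
  is the radial model with \<open>\<alpha> = v \<cdot> (A, B)\<close> and \<open>\<mu> = u \<cdot> (A, B)\<close> restricted to \<open>v + y u\<close>.
  Invariance of the line gives \<open>\<alpha>(0) = 0\<close>; as \<open>D\<close> vanishes at \<open>v\<close>, the order of \<open>\<alpha>\<close> is at
  least two by \<open>pencil_member\<close>.
\<close>

lemma radial_point:
  assumes v: "v \<noteq> (0, 0)" and inv: "fst v * eval2 A v + snd v * eval2 B v = 0"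
    and D: "eval2 (inflection_poly A B) v = 0"
  obtains k where "k \<in> {1..d - 1}" "radial_singularity F k (infinite_point v)"
proof -
  obtain u where vu: "det2 v u \<noteq> 0" by (rule complement[OF v])
  define \<alpha> where "\<alpha> = smult (fst v) (restrict_line A v u) + smult (snd v) (restrict_line B v u)"
  define \<mu> where "\<mu> = smult (fst u) (restrict_line A v u) + smult (snd u) (restrict_line B v u)"
  have v': "(fst v, snd v) \<noteq> (0, 0)" using v by simp
  obtain j w n0 where j: "1 \<le> j" "j \<le> d" "restrict_line (inflection_poly A B) v u = [:0, 1:] ^ (j - 1) * w"
    "poly w 0 \<noteq> 0" "\<alpha> = [:0, 1:] ^ j * n0" "poly n0 0 \<noteq> 0"
    unfolding \<alpha>_def by (rule pencil_member[OF homogeneous_A homogeneous_B d_ge_1 no_common_zero vu v' inv])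
  have j2: "j \<ge> 2"
  proof (rule ccontr)
    assume "\<not> j \<ge> 2"
    with j(1) have "j = 1" by simp
    then have "poly (restrict_line (inflection_poly A B) v u) 0 \<noteq> 0" using j(3,4) by simp
    with D show False by (simp add: poly_restrict)
  qed
  have \<mu>0: "poly \<mu> 0 \<noteq> 0"
  proof
    assume "poly \<mu> 0 = 0"
    then have u0: "fst u * eval2 A v + snd u * eval2 B v = 0" by (simp add: \<mu>_def poly_restrict)
    have "det2 v u * eval2 A v = snd u * (fst v * eval2 A v + snd v * eval2 B v) - snd v * (fst u * eval2 A v + snd u * eval2 B v)"
      "det2 v u * eval2 B v = fst v * (fst u * eval2 A v + snd u * eval2 B v) - fst u * (fst v * eval2 A v + snd v * eval2 B v)"
      by (simp_all add: det2_def algebra_simps)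
    then have "det2 v u * eval2 A v = 0" "det2 v u * eval2 B v = 0" unfolding inv u0 by simp_all
    with vu have "eval2 A v = 0" "eval2 B v = 0" by simp_all
    with no_common_zero[OF v] show False by simp
  qed
  define M :: "complex ^ 3 ^ 3" where "M = vector [vector [fst u, 0, fst v], vector [snd u, 0, snd v], vector [0, 1, 0]]"
  have M: "M $ 1 = vector [fst u, 0, fst v]" "M $ 2 = vector [snd u, 0, snd v]" "M $ 3 = vector [0, 1, 0]"
    unfolding M_def by (rule vector_3)+
  have "det M = det2 v u" by (simp add: det_3 M det2_def algebra_simps)
  then have "invertible M" using vu by (simp add: invertible_det_nz)
  then have gM: "invertible (g ** M)" by (rule invertible_mult[OF g])
  obtain c where c: "c \<noteq> 0" "\<And>x. eval_form (projective_form A B) x = c *s (transpose g *v eval_form F (g *v x))"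
    using pullback unfolding is_pullback_def by blast
  have field: "local_field F (g ** M) = radial_model (- (1 / c)) \<alpha> \<mu>"
  proof
    fix z
    have Mx: "M *v vector [fst z, snd z, 1] = vector [fst v + fst z * fst u, snd v + fst z * snd u, snd z]"
      by (simp add: vec3_eq_iff matrix_vector_mult_3 M algebra_simps)
    show "local_field F (g ** M) z = radial_model (- (1 / c)) \<alpha> \<mu> z"
      unfolding local_field_chart[OF c(2,1)] Mx eval_projective_form Let_def radial_model_def
      by (simp add: matrix_vector_mult_3 transpose_def M \<alpha>_def \<mu>_def poly_restrict)
         (simp add: algebra_simps diff_divide_distrib add_divide_distrib)
  qed
  have "- (1 / c) \<noteq> 0" using c(1) by simp
  from radial_model_orders[OF this j(5,6) \<mu>0 j2]
  obtain k where k: "1 \<le> k" "k \<le> j - 1" "vanishing_order (local_field F (g ** M)) = 1"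
    "tangency_order (local_field F (g ** M)) \<ge> 2" "tangency_order (local_field F (g ** M)) - 1 = enat k"
    unfolding field by blast
  have "(g ** M) *v vector [0, 0, 1] = g *v vector [fst v, snd v, 0]"
    by (simp add: vec3_eq_iff matrix_vector_mult_3 M flip: matrix_vector_mul_assoc)
  then have "(g ** M) *v vector [0, 0, 1] \<in> infinite_point v"
    unfolding infinite_point_def by (auto intro: vec.span_base)
  then have "radial_singularity F k (infinite_point v)"
    unfolding radial_singularity_def using singular_infinite_point[OF v inv] gM k by blast
  moreover have "k \<in> {1..d - 1}" using k j(2) by auto
  ultimately show thesis by (rule that[rotated])
qed

lemma inflection_order_le:
  assumes v: "v \<noteq> (0, 0)" and m: "line_poly (snd v) (- fst v) ^ m dvd inflection_poly A B"
  shows "m \<le> d - 1"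
proof -
  obtain u where vu: "det2 v u \<noteq> 0" by (rule complement[OF v])
  have lm: "(eval2 B v, - eval2 A v) \<noteq> (0, 0)" using no_common_zero[OF v] by auto
  have lm0: "eval2 B v * eval2 A v + - eval2 A v * eval2 B v = 0" by simp
  obtain j w n0 where j: "1 \<le> j" "j \<le> d" "restrict_line (inflection_poly A B) v u = [:0, 1:] ^ (j - 1) * w"
    "poly w 0 \<noteq> 0"
    by (rule pencil_member[OF homogeneous_A homogeneous_B d_ge_1 no_common_zero vu lm lm0])
  obtain Q where Q: "inflection_poly A B = line_poly (snd v) (- fst v) ^ m * Q" using m unfolding dvd_def by blast
  define e where "e = - det2 v u"
  have "poly (restrict_line (inflection_poly A B) v u) t = poly ([:0, 1:] ^ m * smult (e ^ m) (restrict_line Q v u)) t" for t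
  proof -
    have "snd v * (fst v + t * fst u) + - fst v * (snd v + t * snd u) = t * e"
      by (simp add: det2_def e_def algebra_simps)
    then show ?thesis
      unfolding Q poly_restrict eval2_simps eval2_line_poly fst_conv snd_conv
      by (simp only: poly_mult poly_smult poly_power poly_restrict power_mult_distrib) simp
  qed
  then have "restrict_line (inflection_poly A B) v u = [:0, 1:] ^ m * smult (e ^ m) (restrict_line Q v u)"
    by (intro poly_eq_poly_eq_iff[THEN iffD1] ext)
  then have "[:0, 1:] ^ m * smult (e ^ m) (restrict_line Q v u) = [:0, 1:] ^ (j - 1) * w"
    unfolding j(3) by (rule sym)
  then have "[:0, 1:] ^ m dvd [:0, 1:] ^ (j - 1) * w" by (metis dvd_triv_left)
  have "m \<le> j - 1"
  proof (rule ccontr)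
    assume "\<not> m \<le> j - 1"
    then have m': "m = (j - 1) + Suc (m - j)" using j(1) by simp
    have "[:0, 1:] ^ (j - 1) * [:0, 1:] ^ Suc (m - j) dvd [:0, 1:] ^ (j - 1) * w"
      using \<open>[:0, 1:] ^ m dvd [:0, 1:] ^ (j - 1) * w\<close> m' by (metis power_add)
    then have "[:0, 1:] ^ Suc (m - j) dvd w" by (subst (asm) dvd_times_left_cancel_iff) auto
    then have "[:0, 1:] dvd w" by (metis dvd_mult_left power_Suc)
    then have "poly w 0 = 0" by (auto simp: dvd_def)
    with j(4) show False by simp
  qed
  then show ?thesis using j(2) by simp
qed

lemma transverse_line:
  assumes v: "v \<noteq> (0, 0)" and inv: "\<not> invariant_line A B (line_through v)"
    and D: "eval2 (inflection_poly A B) v = 0"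
  obtains k where "k \<in> {1..d - 1}" "transverse_inflection_line A B k (line_through v)"
proof -
  let ?L = "line_poly (snd v) (- fst v)"
  define n where "n = (LEAST n. \<not> ?L ^ n dvd inflection_poly A B)"
  have "\<not> ?L ^ d dvd inflection_poly A B"
    using inflection_order_le[OF v, of d] d_ge_2 by auto
  then have n1: "\<not> ?L ^ n dvd inflection_poly A B" unfolding n_def by (rule LeastI)
  have n2: "?L ^ m dvd inflection_poly A B" if "m < n" for m using not_less_Least[OF that[unfolded n_def]] by blast
  have "?L dvd inflection_poly A B"
  proof (rule line_dvd_if_vanishing[OF homogeneous2_inflection_poly[OF homogeneous_A homogeneous_B d_ge_1]])
    show "(snd v, - fst v) \<noteq> (0, 0)" using v by (cases v) auto
    show "eval2 (inflection_poly A B) (- fst v, - snd v) = 0"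
      using eval2_homogeneous[OF homogeneous2_inflection_poly[OF homogeneous_A homogeneous_B d_ge_1], of "-1" "fst v" "snd v"] D by simp
  qed
  then have "n \<noteq> 0" "n \<noteq> 1" using n1 by (metis one_dvd power_0, metis power_one_right)
  then have n: "Suc (n - 1) = n" "n - 1 \<ge> 1" by auto
  have m: "?L ^ (n - 1) dvd inflection_poly A B" by (rule n2) (use n in simp)
  have "transverse_inflection_line A B (n - 1) (line_through v)"
    unfolding transverse_inflection_line_def
  proof (rule exI[of _ "snd v"], rule exI[of _ "- fst v"], intro conjI)
    show "(snd v, - fst v) \<noteq> (0, 0)" using v by (cases v) auto
    show "line_through v = {w. line_eq (snd v) (- fst v) w = 0}" by (simp add: line_through_def)
    show "([:[:snd v:]:] * var_x + [:[:- fst v:]:] * var_y) ^ (n - 1) dvd inflection_poly A B"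
      using m by (simp only: line_poly_def)
    show "\<not> ([:[:snd v:]:] * var_x + [:[:- fst v:]:] * var_y) ^ Suc (n - 1) dvd inflection_poly A B"
      using n1 unfolding n(1) line_poly_def .
  qed (rule inv)
  moreover have "n - 1 \<in> {1..d - 1}" using inflection_order_le[OF v m] n(2) by simp
  ultimately show thesis by (rule that[rotated])
qed

lemma inflection_nonzero: obtains w where "eval2 (inflection_poly A B) w \<noteq> 0"
proof -
  have vu: "det2 (1, 0) (0, 1) \<noteq> 0" by (simp add: det2_def)
  have v: "(1, 0) \<noteq> ((0, 0) :: complex \<times> complex)" by simp
  have lm: "(eval2 B (1, 0), - eval2 A (1, 0)) \<noteq> (0, 0)" using no_common_zero[OF v] by auto
  have lm0: "eval2 B (1, 0) * eval2 A (1, 0) + - eval2 A (1, 0) * eval2 B (1, 0) = 0" by simp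
  obtain j w n0 where j: "restrict_line (inflection_poly A B) (1, 0) (0, 1) = [:0, 1:] ^ (j - 1) * w" "poly w 0 \<noteq> 0"
    by (rule pencil_member[OF homogeneous_A homogeneous_B d_ge_1 no_common_zero vu lm lm0])
  then have "restrict_line (inflection_poly A B) (1, 0) (0, 1) \<noteq> 0" by auto
  then obtain t where "poly (restrict_line (inflection_poly A B) (1, 0) (0, 1)) t \<noteq> 0"
    using poly_all_0_iff_0 by blast
  then show thesis unfolding poly_restrict by (rule that)
qed

lemma finite_transverse_lines: "finite {l. \<exists>k\<in>{1..d - 1}. transverse_inflection_line A B k l}"
proof -
  obtain w where "eval2 (inflection_poly A B) w \<noteq> 0" by (rule inflection_nonzero)
  from finitely_many_zero_directions[OF homogeneous2_inflection_poly[OF homogeneous_A homogeneous_B d_ge_1] this]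
  obtain V where V: "finite V"
    "\<And>v. v \<noteq> (0, 0) \<Longrightarrow> eval2 (inflection_poly A B) v = 0 \<Longrightarrow> \<exists>v'\<in>V. \<exists>c. c \<noteq> 0 \<and> v = (c * fst v', c * snd v')"
    by blast
  have "{l. \<exists>k\<in>{1..d - 1}. transverse_inflection_line A B k l} \<subseteq> line_through ` V"
  proof
    fix l assume "l \<in> {l. \<exists>k\<in>{1..d - 1}. transverse_inflection_line A B k l}"
    then obtain k where k1: "k \<ge> 1" "transverse_inflection_line A B k l" by auto
    from k1(2) obtain a b where k: "(a, b) \<noteq> (0, 0)" "l = {v. line_eq a b v = 0}"
      "line_poly a b ^ k dvd inflection_poly A B"
      unfolding transverse_inflection_line_def line_poly_def[symmetric] by blast
    then obtain Q where Q: "inflection_poly A B = line_poly a b ^ k * Q" unfolding dvd_def by blast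
    have "eval2 (inflection_poly A B) (- b, a) = 0"
      unfolding Q using k1(1) by (simp add: power_0_left)
    moreover have "(- b, a) \<noteq> (0, 0)" using k(1) by auto
    ultimately obtain v' c where v': "v' \<in> V" "c \<noteq> 0" "(- b, a) = (c * fst v', c * snd v')"
      using V(2) by blast
    have "l = line_through (- b, a)" unfolding k(2) line_through_def by simp
    also have "\<dots> = line_through v'" unfolding v'(3) by (rule line_through_scale[OF v'(2)])
    finally show "l \<in> line_through ` V" using v'(1) by blast
  qed
  then show ?thesis by (rule finite_subset) (use V(1) in simp)
qed

lemma size_foliation_type:
  "size (foliation_type d F A B) = (\<Sum>k = 1..d - 1. radial_count F k + transverse_count A B k)"
proof -
  have "size (\<Sum>k\<in>S. M k) = (\<Sum>k\<in>S. size (M k))" for S and M :: "nat \<Rightarrow> type_var multiset"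
    by (induction S rule: infinite_finite_induct) auto
  then show ?thesis by (simp add: foliation_type_def)
qed

text \<open>
  A zero direction of \<open>D\<close> gives a point or a line in the disjoint union of the radial
  singularities and the transverse inflection lines, and independent directions give
  distinct elements.
\<close>

lemma three_inflection_directions:
  assumes "v1 \<noteq> (0, 0)" "v2 \<noteq> (0, 0)" "v3 \<noteq> (0, 0)"
    and "eval2 (inflection_poly A B) v1 = 0" "eval2 (inflection_poly A B) v2 = 0" "eval2 (inflection_poly A B) v3 = 0"
    and "det2 v1 v2 \<noteq> 0" "det2 v1 v3 \<noteq> 0" "det2 v2 v3 \<noteq> 0"
  shows "size (foliation_type d F A B) \<ge> 3"
proof -
  define P where "P = (\<Union>k\<in>{1..d - 1}. {s. radial_singularity F k s})"
  define L where "L = (\<Union>k\<in>{1..d - 1}. {l. transverse_inflection_line A B k l})"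
  define X where "X v = (if invariant_line A B (line_through v) then Inl (infinite_point v) else Inr (line_through v))" for v
  have finP: "finite P"
    by (rule finite_subset[OF _ finite_singular_points]) (auto simp: P_def radial_singularity_def)
  have finL: "finite L"
    by (rule finite_subset[OF _ finite_transverse_lines]) (auto simp: L_def)
  have X: "X v \<in> P <+> L" if v: "v \<noteq> (0, 0)" "eval2 (inflection_poly A B) v = 0" for v
  proof (cases "invariant_line A B (line_through v)")
    case True
    have "v \<in> line_through v" by (simp add: line_through_def line_eq_def)
    with True have "fst v * eval2 A v + snd v * eval2 B v = 0"
      unfolding invariant_line_def by (auto simp: mult.commute)
    then obtain k where "k \<in> {1..d - 1}" "radial_singularity F k (infinite_point v)" by (rule radial_point[OF v(1) _ v(2)])
    then show ?thesis using True by (auto simp: X_def P_def)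
  next
    case False
    then obtain k where "k \<in> {1..d - 1}" "transverse_inflection_line A B k (line_through v)" by (rule transverse_line[OF v(1) _ v(2)])
    then show ?thesis using False by (auto simp: X_def L_def)
  qed
  have inj: "X v \<noteq> X w" if "det2 v w \<noteq> 0" for v w
    using that det2_if_infinite_point_eq[of v w] det2_if_line_through_eq[of v w] by (auto simp: X_def)
  have "{X v1, X v2, X v3} \<subseteq> P <+> L" using X assms(1-6) by blast
  then have "card {X v1, X v2, X v3} \<le> card (P <+> L)" by (intro card_mono) (simp_all add: finP finL)
  moreover have "card {X v1, X v2, X v3} = 3" using inj assms(7-9) by auto
  moreover have "card (P <+> L) = card P + card L" using finP finL by (rule card_Plus)
  moreover have "card P \<le> (\<Sum>k = 1..d - 1. radial_count F k)"
    unfolding P_def radial_count_def by (rule card_UN_le) simp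
  moreover have "card L \<le> (\<Sum>k = 1..d - 1. transverse_count A B k)"
    unfolding L_def transverse_count_def by (rule card_UN_le) simp
  ultimately show ?thesis unfolding size_foliation_type sum.distrib by linarith
qed

lemma two_inflection_directions:
  assumes "size (foliation_type d F A B) = 2"
  obtains v1 v2 where "det2 v1 v2 \<noteq> 0"
    "\<And>w. w \<noteq> (0, 0) \<Longrightarrow> eval2 (inflection_poly A B) w = 0 \<Longrightarrow> det2 w v1 = 0 \<or> det2 w v2 = 0"
proof (cases "\<exists>v1. v1 \<noteq> (0, 0) \<and> eval2 (inflection_poly A B) v1 = 0")
  case False
  show ?thesis by (rule that[of "(1, 0)" "(0, 1)"]) (use False in \<open>auto simp: det2_def\<close>)
next
  case True
  then obtain v1 where v1: "v1 \<noteq> (0, 0)" "eval2 (inflection_poly A B) v1 = 0" by blast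
  have sym: "det2 v w = - det2 w v" for v w by (simp add: det2_def)
  show ?thesis
  proof (cases "\<exists>v2. v2 \<noteq> (0, 0) \<and> eval2 (inflection_poly A B) v2 = 0 \<and> det2 v1 v2 \<noteq> 0")
    case True
    then obtain v2 where v2: "v2 \<noteq> (0, 0)" "eval2 (inflection_poly A B) v2 = 0" "det2 v1 v2 \<noteq> 0" by blast
    show ?thesis
    proof (rule that[OF v2(3)])
      fix w assume w: "w \<noteq> (0, 0)" "eval2 (inflection_poly A B) w = 0"
      show "det2 w v1 = 0 \<or> det2 w v2 = 0"
      proof (rule ccontr)
        assume "\<not> ?thesis"
        then have "det2 v1 w \<noteq> 0" "det2 v2 w \<noteq> 0" unfolding sym[of v1 w] sym[of v2 w] by simp_all
        from three_inflection_directions[OF v1(1) v2(1) w(1) v1(2) v2(2) w(2) v2(3) this] assms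
        show False by simp
      qed
    qed
  next
    case False
    obtain u where u: "det2 v1 u \<noteq> 0" by (rule complement[OF v1(1)])
    show ?thesis
    proof (rule that[OF u])
      fix w assume w: "w \<noteq> (0, 0)" "eval2 (inflection_poly A B) w = 0"
      then have "det2 v1 w = 0" using False by blast
      then show "det2 w v1 = 0 \<or> det2 w u = 0" unfolding sym[of w v1] by simp
    qed
  qed
qed

end

section \<open>Logarithmic derivatives and webs in a pencil\<close>

lemma sum_pairs:
  fixes x :: "nat \<Rightarrow> complex"
  shows "(\<Sum>(r, s)\<in>{(r, s). r < s \<and> s < n}. x r + x s) = of_nat (n - 1) * (\<Sum>i<n. x i) \<and>
         finite {(r, s). r < s \<and> s < n} \<and> card {(r, s). r < s \<and> s < n} = n choose 2"
proof (induction n)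
  case (Suc n)
  have eq: "{(r, s). r < s \<and> s < Suc n} = {(r, s). r < s \<and> s < n} \<union> (\<lambda>r. (r, n)) ` {..<n}"
    by (auto simp: less_Suc_eq)
  have disj: "{(r, s). r < s \<and> s < n} \<inter> (\<lambda>r. (r, n)) ` {..<n} = {}" by auto
  have inj: "inj_on (\<lambda>r. (r, n)) {..<n}" by (auto simp: inj_on_def)
  note IH = Suc.IH[THEN conjunct1] Suc.IH[THEN conjunct2, THEN conjunct1] Suc.IH[THEN conjunct2, THEN conjunct2]
  have "(\<Sum>(r, s)\<in>{(r, s). r < s \<and> s < Suc n}. x r + x s) =
     of_nat (n - 1) * (\<Sum>i<n. x i) + (\<Sum>r<n. x r + x n)"
    unfolding eq by (subst sum.union_disjoint[OF IH(2) _ disj]) (simp_all add: IH(1) sum.reindex[OF inj])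
  also have "\<dots> = of_nat n * (\<Sum>i<Suc n. x i)"
    by (cases n) (simp_all add: sum.distrib algebra_simps)
  finally have 1: "(\<Sum>(r, s)\<in>{(r, s). r < s \<and> s < Suc n}. x r + x s) = of_nat (Suc n - 1) * (\<Sum>i<Suc n. x i)"
    by simp
  have "card {(r, s). r < s \<and> s < Suc n} = (n choose 2) + n"
    unfolding eq by (subst card_Un_disjoint[OF IH(2) _ disj]) (simp_all add: IH(3) card_image[OF inj])
  also have "\<dots> = Suc n choose 2" by (simp add: numeral_2_eq_2)
  finally show ?case using 1 IH(2) unfolding eq by simp
qed simp

text \<open>
  Every index lies in the same number of triples. This is what makes the sum over all
  triples of the logarithmic differentials of three units a multiple of the one of the
  product of all units.
\<close>

lemma sum_triples:
  fixes x :: "nat \<Rightarrow> complex"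
  shows "(\<Sum>(r, s, t)\<in>{(r, s, t). r < s \<and> s < t \<and> t < n}. x r + x s + x t) = of_nat ((n - 1) choose 2) * (\<Sum>i<n. x i) \<and>
         finite {(r, s, t). r < s \<and> s < t \<and> t < n} \<and> card {(r, s, t). r < s \<and> s < t \<and> t < n} = n choose 3"
proof (induction n)
  case (Suc n)
  let ?S2 = "{(r, s). r < s \<and> s < n}"
  let ?f = "\<lambda>(r, s). (r, s, n)"
  have eq: "{(r, s, t). r < s \<and> s < t \<and> t < Suc n} = {(r, s, t). r < s \<and> s < t \<and> t < n} \<union> ?f ` ?S2"
    by (auto simp: less_Suc_eq image_iff)
  have disj: "{(r, s, t). r < s \<and> s < t \<and> t < n} \<inter> ?f ` ?S2 = {}" by auto
  have inj: "inj_on ?f ?S2" by (auto simp: inj_on_def)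
  note IH = Suc.IH[THEN conjunct1] Suc.IH[THEN conjunct2, THEN conjunct1] Suc.IH[THEN conjunct2, THEN conjunct2]
  note p = sum_pairs[of x n, THEN conjunct1] sum_pairs[of x n, THEN conjunct2, THEN conjunct1] sum_pairs[of x n, THEN conjunct2, THEN conjunct2]
  have "(\<Sum>(r, s, t)\<in>{(r, s, t). r < s \<and> s < t \<and> t < Suc n}. x r + x s + x t) =
     of_nat ((n - 1) choose 2) * (\<Sum>i<n. x i) + (\<Sum>(r, s)\<in>?S2. x r + x s + x n)"
  proof -
    have "(\<Sum>(r, s, t)\<in>?f ` ?S2. x r + x s + x t) = (\<Sum>(r, s)\<in>?S2. x r + x s + x n)"
      by (subst sum.reindex[OF inj]) (simp add: o_def case_prod_unfold)
    then show ?thesis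
      unfolding eq sum.union_disjoint[OF IH(2) finite_imageI[OF p(2)] disj] IH(1) by simp
  qed
  also have "(\<Sum>(r, s)\<in>?S2. x r + x s + x n) = of_nat (n - 1) * (\<Sum>i<n. x i) + of_nat (n choose 2) * x n"
    unfolding p(1)[symmetric] p(3)[symmetric] by (simp add: case_prod_unfold sum.distrib)
  also have "of_nat ((n - 1) choose 2) * (\<Sum>i<n. x i) + \<dots> = of_nat (n choose 2) * (\<Sum>i<Suc n. x i)"
    by (cases n) (simp_all add: numeral_2_eq_2 algebra_simps)
  finally have 1: "(\<Sum>(r, s, t)\<in>{(r, s, t). r < s \<and> s < t \<and> t < Suc n}. x r + x s + x t) =
      of_nat ((Suc n - 1) choose 2) * (\<Sum>i<Suc n. x i)"
    by simp
  have "card {(r, s, t). r < s \<and> s < t \<and> t < Suc n} = (n choose 3) + (n choose 2)"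
    unfolding eq by (subst card_Un_disjoint[OF IH(2) _ disj]) (simp_all add: IH(3) p(2,3) card_image[OF inj])
  also have "\<dots> = Suc n choose 3" by (simp add: numeral_3_eq_3 numeral_2_eq_2)
  finally show ?case using 1 IH(2) p(2) unfolding eq by simp
qed simp

definition has_partials :: "(complex \<times> complex \<Rightarrow> complex) \<Rightarrow> complex \<times> complex \<Rightarrow> complex \<times> complex \<Rightarrow> bool" where
  "has_partials f e z \<longleftrightarrow>
     ((\<lambda>u. f (u, snd z)) has_field_derivative fst e) (at (fst z)) \<and>
     ((\<lambda>v. f (fst z, v)) has_field_derivative snd e) (at (snd z))"

text \<open>
  \<open>e\<close> is the logarithmic differential \<open>df / f\<close> at \<open>z\<close>.
\<close>

definition has_dlog :: "(complex \<times> complex \<Rightarrow> complex) \<Rightarrow> complex \<times> complex \<Rightarrow> complex \<times> complex \<Rightarrow> bool" where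
  "has_dlog f e z \<longleftrightarrow> f z \<noteq> 0 \<and> has_partials f (f z * fst e, f z * snd e) z"

lemma has_partials_const: "has_partials (\<lambda>w. c) (0, 0) z"
  by (simp add: has_partials_def)

lemma has_partials_add: "has_partials f e z \<Longrightarrow> has_partials g e' z \<Longrightarrow> has_partials (\<lambda>w. f w + g w) (e + e') z"
  by (simp add: has_partials_def DERIV_add)

lemma has_partials_diff: "has_partials f e z \<Longrightarrow> has_partials g e' z \<Longrightarrow> has_partials (\<lambda>w. f w - g w) (e - e') z"
  by (simp add: has_partials_def DERIV_diff)

lemma has_partials_mult:
  "has_partials f e z \<Longrightarrow> has_partials g e' z \<Longrightarrow>
   has_partials (\<lambda>w. f w * g w) (fst e * g z + f z * fst e', snd e * g z + f z * snd e') z"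
  unfolding has_partials_def
  by (auto intro!: derivative_eq_intros)

lemma has_partials_divide:
  "has_partials f e z \<Longrightarrow> has_partials g e' z \<Longrightarrow> g z \<noteq> 0 \<Longrightarrow>
   has_partials (\<lambda>w. f w / g w) ((fst e * g z - f z * fst e') / (g z * g z), (snd e * g z - f z * snd e') / (g z * g z)) z"
  unfolding has_partials_def
  by (auto intro!: derivative_eq_intros)

lemma eventually_slices:
  assumes "\<forall>\<^sub>F w in nhds z. P w"
  shows "\<forall>\<^sub>F u in nhds (fst z). P (u, snd z)" "\<forall>\<^sub>F v in nhds (snd z). P (fst z, v)"
proof -
  have "filterlim (\<lambda>u. (u, snd z)) (nhds z) (nhds (fst z))" "filterlim (\<lambda>v. (fst z, v)) (nhds z) (nhds (snd z))"
    by (auto intro!: tendsto_eq_intros filterlim_ident)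
  then show "\<forall>\<^sub>F u in nhds (fst z). P (u, snd z)" "\<forall>\<^sub>F v in nhds (snd z). P (fst z, v)"
    using assms by (auto dest: eventually_compose_filterlim)
qed

lemma has_partials_cong:
  assumes "\<forall>\<^sub>F w in nhds z. f w = g w" "has_partials f e z"
  shows "has_partials g e z"
  using assms(2) DERIV_cong_ev[OF refl eventually_slices(1)[OF assms(1)] refl]
    DERIV_cong_ev[OF refl eventually_slices(2)[OF assms(1)] refl]
  unfolding has_partials_def by blast

lemma has_partials_unique: "has_partials f e z \<Longrightarrow> has_partials f e' z \<Longrightarrow> e = e'"
  unfolding has_partials_def by (auto simp: prod_eq_iff intro: DERIV_unique)

lemma holomorphic2_on_has_partials:
  assumes "holomorphic2_on f U" "z \<in> U"
  obtains e where "has_partials f e z"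
proof -
  have z: "(fst z, snd z) \<in> U" using assms(2) by simp
  obtain a b where "((\<lambda>u. f (u, snd z)) has_field_derivative a) (at (fst z))"
      "((\<lambda>v. f (fst z, v)) has_field_derivative b) (at (snd z))"
    using holomorphic2_on_slices[OF assms(1) z] unfolding field_differentiable_def by blast
  then show thesis by (intro that[of "(a, b)"]) (simp add: has_partials_def)
qed

lemma has_dlog_mult:
  assumes "has_dlog f e z" "has_dlog g e' z"
  shows "has_dlog (\<lambda>w. f w * g w) (e + e') z"
  using has_partials_mult[of f _ z g] assms
  unfolding has_dlog_def by (force simp: algebra_simps)

lemma has_dlog_prod:
  assumes "finite I" "\<And>i. i \<in> I \<Longrightarrow> has_dlog (f i) (e i) z"
  shows "has_dlog (\<lambda>w. \<Prod>i\<in>I. f i w) (\<Sum>i\<in>I. e i) z"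
  using assms
proof (induction I)
  case empty
  show ?case by (simp add: has_dlog_def has_partials_const)
next
  case (insert i I)
  then show ?case using has_dlog_mult[of "f i" "e i" z "\<lambda>w. \<Prod>i\<in>I. f i w" "\<Sum>i\<in>I. e i"] by simp
qed

lemma has_dlog_cong:
  assumes "\<forall>\<^sub>F w in nhds z. f w = g w" "has_dlog f e z"
  shows "has_dlog g e z"
  using assms has_partials_cong[OF assms(1)] eventually_nhds_x_imp_x[OF assms(1)]
  unfolding has_dlog_def by simp

lemma has_dlog_unique: "has_dlog f e z \<Longrightarrow> has_dlog f e' z \<Longrightarrow> e = e'"
  unfolding has_dlog_def using has_partials_unique by (fastforce simp: prod_eq_iff)

lemma ext_deriv_eqI:
  assumes "has_partials (\<lambda>w. fst (e w)) P z" "has_partials (\<lambda>w. snd (e w)) Q z"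
  shows "ext_deriv e z = fst Q - snd P"
  using DERIV_imp_deriv[OF assms(2)[unfolded has_partials_def, THEN conjunct1]]
    DERIV_imp_deriv[OF assms(1)[unfolded has_partials_def, THEN conjunct2]]
  by (simp add: ext_deriv_def)

lemma ext_deriv_cong:
  assumes "\<forall>\<^sub>F w in nhds z. e w = f w"
  shows "ext_deriv e z = ext_deriv f z"
proof -
  have "deriv (\<lambda>u. snd (e (u, snd z))) (fst z) = deriv (\<lambda>u. snd (f (u, snd z))) (fst z)"
    by (rule deriv_cong_ev[OF _ refl]) (use eventually_slices(1)[OF assms] in eventually_elim, simp)
  moreover have "deriv (\<lambda>v. fst (e (fst z, v))) (snd z) = deriv (\<lambda>v. fst (f (fst z, v))) (snd z)"
    by (rule deriv_cong_ev[OF _ refl]) (use eventually_slices(2)[OF assms] in eventually_elim, simp)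
  ultimately show ?thesis by (simp add: ext_deriv_def)
qed

lemma ext_deriv_dlog_scaled:
  assumes "has_dlog \<phi> L z" "has_partials (\<lambda>w. fst (\<sigma> w)) P z" "has_partials (\<lambda>w. snd (\<sigma> w)) Q z"
    and "fst Q - snd P = wedge \<kappa> (\<sigma> z)"
  shows "ext_deriv (\<lambda>w. (\<phi> w * fst (\<sigma> w), \<phi> w * snd (\<sigma> w))) z = \<phi> z * wedge (\<kappa> + L) (\<sigma> z)"
proof -
  have "has_partials (\<lambda>w. fst (\<phi> w * fst (\<sigma> w), \<phi> w * snd (\<sigma> w)))
      (\<phi> z * fst L * fst (\<sigma> z) + \<phi> z * fst P, \<phi> z * snd L * fst (\<sigma> z) + \<phi> z * snd P) z"
    using has_partials_mult[OF _ assms(2), of \<phi> "(\<phi> z * fst L, \<phi> z * snd L)"] assms(1)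
    by (simp add: has_dlog_def)
  moreover have "has_partials (\<lambda>w. snd (\<phi> w * fst (\<sigma> w), \<phi> w * snd (\<sigma> w)))
      (\<phi> z * fst L * snd (\<sigma> z) + \<phi> z * fst Q, \<phi> z * snd L * snd (\<sigma> z) + \<phi> z * snd Q) z"
    using has_partials_mult[OF _ assms(3), of \<phi> "(\<phi> z * fst L, \<phi> z * snd L)"] assms(1)
    by (simp add: has_dlog_def)
  ultimately have "ext_deriv (\<lambda>w. (\<phi> w * fst (\<sigma> w), \<phi> w * snd (\<sigma> w))) z =
      \<phi> z * fst L * snd (\<sigma> z) + \<phi> z * fst Q - (\<phi> z * snd L * fst (\<sigma> z) + \<phi> z * snd P)"
    by (simp add: ext_deriv_eqI)
  also have "\<dots> = \<phi> z * ((fst Q - snd P) + wedge L (\<sigma> z))" by (simp add: wedge_def algebra_simps)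
  finally show ?thesis unfolding assms(4) by (simp add: wedge_def algebra_simps)
qed

lemma wedge_determines:
  assumes "wedge e x = wedge e' x" "wedge e y = wedge e' y" "wedge x y \<noteq> 0"
  shows "e = e'"
proof -
  have "fst (e - e') * wedge x y = fst y * 0 - fst x * 0 + (fst x * (wedge e y - wedge e' y) - fst y * (wedge e x - wedge e' x))"
       "snd (e - e') * wedge x y = (snd x * (wedge e y - wedge e' y) - snd y * (wedge e x - wedge e' x))"
    by (simp_all add: wedge_def algebra_simps)
  then have "fst (e - e') * wedge x y = 0" "snd (e - e') * wedge x y = 0" using assms(1,2) by simp_all
  then show ?thesis using assms(3) by (simp add: prod_eq_iff)
qed

text \<open>
  For three members of a pencil with constant coefficients,
  \<open>\<delta>_jk \<theta>_i = (c_j - c_k) \<phi> (\<sigma>1 - c_i \<sigma>2)\<close> with the same function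
  \<open>\<phi> = \<alpha>_r \<alpha>_s \<alpha>_t (\<sigma>1 \<and> \<sigma>2)\<close> for all three. By linearity the equations for \<open>\<eta>\<close> are solved
  by \<open>\<kappa> + d\<phi> / \<phi>\<close> as soon as \<open>\<kappa> \<and> \<sigma>1 = d\<sigma>1\<close> and \<open>\<kappa> \<and> \<sigma>2 = d\<sigma>2\<close>.
\<close>

lemma eta_pencil:
  assumes \<theta>: "\<And>i. i \<in> {r, s, t} \<Longrightarrow> \<forall>\<^sub>F w in nhds z.
      \<theta> i w = (\<alpha> i w * (fst (\<sigma>1 w) - c i * fst (\<sigma>2 w)), \<alpha> i w * (snd (\<sigma>1 w) - c i * snd (\<sigma>2 w)))"
    and \<alpha>: "\<And>i. i \<in> {r, s, t} \<Longrightarrow> has_dlog (\<alpha> i) (L i) z"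
    and c: "c r \<noteq> c s" "c s \<noteq> c t" "c t \<noteq> c r" and m: "has_dlog (\<lambda>w. wedge (\<sigma>1 w) (\<sigma>2 w)) Lm z"
    and p1: "has_partials (\<lambda>w. fst (\<sigma>1 w)) P1 z" "has_partials (\<lambda>w. snd (\<sigma>1 w)) Q1 z"
      "fst Q1 - snd P1 = wedge \<kappa> (\<sigma>1 z)"
    and p2: "has_partials (\<lambda>w. fst (\<sigma>2 w)) P2 z" "has_partials (\<lambda>w. snd (\<sigma>2 w)) Q2 z"
      "fst Q2 - snd P2 = wedge \<kappa> (\<sigma>2 z)"
  shows "eta \<theta> r s t z = \<kappa> + Lm + (L r + L s + L t)"
proof -
  define \<phi> where "\<phi> w = \<alpha> r w * \<alpha> s w * \<alpha> t w * wedge (\<sigma>1 w) (\<sigma>2 w)" for w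
  define E where "E = \<kappa> + (L r + L s + L t + Lm)"
  have \<phi>: "has_dlog \<phi> (L r + L s + L t + Lm) z"
    unfolding \<phi>_def by (intro has_dlog_mult \<alpha> m) auto
  have \<phi>0: "\<phi> z \<noteq> 0" using \<phi> by (simp add: has_dlog_def)
  define \<sigma> where "\<sigma> i w = (fst (\<sigma>1 w) - c i * fst (\<sigma>2 w), snd (\<sigma>1 w) - c i * snd (\<sigma>2 w))" for i w
  have scaled: "\<forall>\<^sub>F w in nhds z. scale_form (delta \<theta> j k) (\<theta> i) w =
      ((c j - c k) * \<phi> w * fst (\<sigma> i w), (c j - c k) * \<phi> w * snd (\<sigma> i w))"
    if "(i, j, k) \<in> {(r, s, t), (s, t, r), (t, r, s)}" for i j k
    using \<theta>[of r, simplified] \<theta>[of s, simplified] \<theta>[of t, simplified]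
    by eventually_elim (use that in \<open>auto simp: scale_form_def delta_def wedge_def \<phi>_def \<sigma>_def algebra_simps\<close>)
  have eq: "ext_deriv (scale_form (delta \<theta> j k) (\<theta> i)) z = wedge E (scale_form (delta \<theta> j k) (\<theta> i) z)"
    if ijk: "(i, j, k) \<in> {(r, s, t), (s, t, r), (t, r, s)}" for i j k
  proof -
    have "has_dlog (\<lambda>w. c j - c k) 0 z"
      using ijk c by (auto simp: has_dlog_def has_partials_const)
    from has_dlog_mult[OF this \<phi>] have d: "has_dlog (\<lambda>w. (c j - c k) * \<phi> w) (L r + L s + L t + Lm) z" by simp
    have ps: "has_partials (\<lambda>w. fst (\<sigma> i w)) (P1 - (c i * fst P2, c i * snd P2)) z"
      "has_partials (\<lambda>w. snd (\<sigma> i w)) (Q1 - (c i * fst Q2, c i * snd Q2)) z"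
      using has_partials_diff[OF p1(1) has_partials_mult[OF has_partials_const p2(1)]]
        has_partials_diff[OF p1(2) has_partials_mult[OF has_partials_const p2(2)]]
      by (simp_all add: \<sigma>_def)
    have "fst (Q1 - (c i * fst Q2, c i * snd Q2)) - snd (P1 - (c i * fst P2, c i * snd P2)) =
       (fst Q1 - snd P1) - c i * (fst Q2 - snd P2)" by (simp add: algebra_simps)
    also have "\<dots> = wedge \<kappa> (\<sigma> i z)" unfolding p1(3) p2(3) by (simp add: wedge_def \<sigma>_def algebra_simps)
    finally have w: "fst (Q1 - (c i * fst Q2, c i * snd Q2)) - snd (P1 - (c i * fst P2, c i * snd P2)) = wedge \<kappa> (\<sigma> i z)" .
    have "ext_deriv (scale_form (delta \<theta> j k) (\<theta> i)) z = (c j - c k) * \<phi> z * wedge E (\<sigma> i z)"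
      unfolding ext_deriv_cong[OF scaled[OF ijk]] ext_deriv_dlog_scaled[OF d ps w] E_def ..
    also have "\<dots> = wedge E (scale_form (delta \<theta> j k) (\<theta> i) z)"
      unfolding eventually_nhds_x_imp_x[OF scaled[OF ijk]] by (simp add: wedge_def algebra_simps)
    finally show ?thesis .
  qed
  have ind: "wedge (scale_form (delta \<theta> s t) (\<theta> r) z) (scale_form (delta \<theta> t r) (\<theta> s) z) \<noteq> 0"
  proof -
    have "wedge (scale_form (delta \<theta> s t) (\<theta> r) z) (scale_form (delta \<theta> t r) (\<theta> s) z) =
       ((c s - c t) * \<phi> z) * ((c t - c r) * \<phi> z) * ((c r - c s) * wedge (\<sigma>1 z) (\<sigma>2 z))"
      unfolding eventually_nhds_x_imp_x[OF scaled[of r s t, simplified]]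
        eventually_nhds_x_imp_x[OF scaled[of s t r, simplified]]
      by (simp add: wedge_def \<sigma>_def algebra_simps)
    then show ?thesis using c \<phi>0 m by (simp add: has_dlog_def)
  qed
  have "eta \<theta> r s t z = E"
    unfolding eta_def
  proof (rule the_equality)
    show "ext_deriv (scale_form (delta \<theta> s t) (\<theta> r)) z = wedge E (scale_form (delta \<theta> s t) (\<theta> r) z) \<and>
      ext_deriv (scale_form (delta \<theta> t r) (\<theta> s)) z = wedge E (scale_form (delta \<theta> t r) (\<theta> s) z) \<and>
      ext_deriv (scale_form (delta \<theta> r s) (\<theta> t)) z = wedge E (scale_form (delta \<theta> r s) (\<theta> t) z)"
      by (intro conjI eq) auto
  next
    fix e
    assume "ext_deriv (scale_form (delta \<theta> s t) (\<theta> r)) z = wedge e (scale_form (delta \<theta> s t) (\<theta> r) z) \<and>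
      ext_deriv (scale_form (delta \<theta> t r) (\<theta> s)) z = wedge e (scale_form (delta \<theta> t r) (\<theta> s) z) \<and>
      ext_deriv (scale_form (delta \<theta> r s) (\<theta> t)) z = wedge e (scale_form (delta \<theta> r s) (\<theta> t) z)"
    then show "e = E"
      using eq[of r s t] eq[of s t r] by (intro wedge_determines[OF _ _ ind]) simp_all
  qed
  then show ?thesis by (simp add: E_def algebra_simps)
qed

section \<open>Curvature of binomial webs\<close>

text \<open>
  If \<open>C \<noteq> 0\<close>, the form \<open>l\<close> vanishes on the kernels of \<open>\<theta> 0\<close> and \<open>\<theta> 1\<close>, so it is zero. In any
  case the product is zero at every vector, although finitely many lines do not cover the
  plane.
\<close>

lemma pairwise_independent_product_not_power:
  fixes \<theta> :: "nat \<Rightarrow> complex \<times> complex"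
  assumes d: "d \<ge> 2" and ind: "\<And>i j. i < d \<Longrightarrow> j < d \<Longrightarrow> i \<noteq> j \<Longrightarrow> wedge (\<theta> i) (\<theta> j) \<noteq> 0"
    and eq: "\<And>w. C * apply_form l w ^ d = (\<Prod>i<d. apply_form (\<theta> i) w)"
  shows False
proof -
  have nz: "\<theta> i \<noteq> 0" if "i < d" for i
  proof
    assume "\<theta> i = 0"
    moreover have "wedge (\<theta> i) (\<theta> (if i = 0 then 1 else 0)) \<noteq> 0" using d by (intro ind that) auto
    ultimately show False by (simp add: wedge_def)
  qed
  have zero: "C = 0 \<or> wedge (\<theta> i) l = 0" if "i < d" for i
  proof -
    have "(\<Prod>k<d. apply_form (\<theta> k) (- snd (\<theta> i), fst (\<theta> i))) = 0"
      using that by (intro prod_zero bexI[of _ i]) (auto simp: apply_form_def)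
    then have "C * apply_form l (- snd (\<theta> i), fst (\<theta> i)) ^ d = 0" by (simp add: eq)
    moreover have "apply_form l (- snd (\<theta> i), fst (\<theta> i)) = wedge (\<theta> i) l"
      by (simp add: apply_form_def wedge_def algebra_simps)
    ultimately show ?thesis by auto
  qed
  have "C * apply_form l w ^ d = 0" for w
  proof (cases "C = 0")
    case False
    then have "wedge (\<theta> 0) l = 0" "wedge (\<theta> 1) l = 0" using zero d by auto
    then have "wedge l (\<theta> 0) = wedge 0 (\<theta> 0)" "wedge l (\<theta> 1) = wedge 0 (\<theta> 1)"
      by (simp_all add: wedge_def algebra_simps)
    then have "l = 0" using ind[of 0 1] d by (intro wedge_determines[of _ "\<theta> 0" _ "\<theta> 1"]) auto
    then show ?thesis using d by (simp add: apply_form_def)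
  qed simp
  then have 0: "(\<Prod>i<d. apply_form (\<theta> i) w) = 0" for w unfolding eq .
  define p where "p = (\<Prod>i<d. [:fst (\<theta> i), snd (\<theta> i):])"
  have "p \<noteq> 0" unfolding p_def using nz by (auto simp: prod_eq_iff)
  then obtain t where "poly p t \<noteq> 0" using poly_all_0_iff_0 by blast
  moreover have "poly p t = (\<Prod>i<d. apply_form (\<theta> i) (1, t))"
    by (simp add: p_def poly_prod apply_form_def mult.commute)
  ultimately show False using 0 by simp
qed

text \<open>
  In each of the degenerate cases the left-hand side is a multiple of the \<open>d\<close>-th power of a
  single linear form.
\<close>

lemma decomposition_nonvanishing:
  fixes \<theta> :: "nat \<Rightarrow> complex \<times> complex"
  assumes d: "d \<ge> 2" and ind: "\<And>i j. i < d \<Longrightarrow> j < d \<Longrightarrow> i \<noteq> j \<Longrightarrow> wedge (\<theta> i) (\<theta> j) \<noteq> 0"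
    and eq: "\<And>w. a * apply_form X w ^ d + b * apply_form Y w ^ d = (\<Prod>i<d. apply_form (\<theta> i) w)"
  shows "a \<noteq> 0" "b \<noteq> 0" "wedge X Y \<noteq> 0"
proof -
  show "a \<noteq> 0"
    using pairwise_independent_product_not_power[where \<theta> = \<theta> and C = b and l = Y, OF d ind] eq d by auto
  show "b \<noteq> 0"
    using pairwise_independent_product_not_power[where \<theta> = \<theta> and C = a and l = X, OF d ind] eq d by auto
  show "wedge X Y \<noteq> 0"
  proof
    assume w: "wedge X Y = 0"
    show False
    proof (cases "X = 0")
      case True
      then have "b * apply_form Y w ^ d = (\<Prod>i<d. apply_form (\<theta> i) w)" for w
        using eq[of w] d True by (simp add: apply_form_def power_0_left)
      with pairwise_independent_product_not_power[where \<theta> = \<theta> and C = b and l = Y, OF d ind] show False by blast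
    next
      case False
      obtain k where k: "fst Y = k * fst X" "snd Y = k * snd X"
      proof (cases "fst X = 0")
        case True
        then have "snd X \<noteq> 0" using False by (auto simp: prod_eq_iff)
        then show ?thesis using w True by (intro that[of "snd Y / snd X"]) (auto simp: wedge_def)
      next
        case False
        then show ?thesis using w by (intro that[of "fst Y / fst X"]) (auto simp: wedge_def field_simps)
      qed
      have "apply_form Y w = k * apply_form X w" for w by (simp add: apply_form_def k algebra_simps)
      then have "(a + b * k ^ d) * apply_form X w ^ d = (\<Prod>i<d. apply_form (\<theta> i) w)" for w
        using eq[of w] by (simp add: power_mult_distrib algebra_simps)
      with pairwise_independent_product_not_power[where \<theta> = \<theta> and C = "a + b * k ^ d" and l = X, OF d ind]
      show False by blast
    qed
  qed
qed

text \<open>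
  The constant term comes first in the triple, so that \<open>snd a\<close> is the differential of
  \<open>aff a\<close>.
\<close>

definition aff :: "complex \<times> complex \<times> complex \<Rightarrow> complex \<times> complex \<Rightarrow> complex" where
  "aff a z = fst a + fst (snd a) * fst z + snd (snd a) * snd z"

definition smul :: "complex \<Rightarrow> complex \<times> complex \<Rightarrow> complex \<times> complex" where
  "smul k e = (k * fst e, k * snd e)"

definition dlog_aff :: "complex \<times> complex \<times> complex \<Rightarrow> form1" where
  "dlog_aff a z = (fst (snd a) / aff a z, snd (snd a) / aff a z)"

lemma has_partials_aff: "has_partials (aff a) (snd a) z"
  unfolding has_partials_def aff_def by (auto intro!: derivative_eq_intros)

lemma has_dlog_aff: "aff a z \<noteq> 0 \<Longrightarrow> has_dlog (aff a) (dlog_aff a z) z"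
  using has_partials_aff[of a z] by (simp add: has_dlog_def dlog_aff_def)

lemma holomorphic2_on_aff: "holomorphic2_on (aff a) U"
  unfolding aff_def
  by (intro holomorphic2_on_add holomorphic2_on_mult holomorphic2_on_const holomorphic2_on_fst holomorphic2_on_snd)

definition form_has_partials :: "form1 \<Rightarrow> complex \<times> complex \<Rightarrow> bool" where
  "form_has_partials e z \<longleftrightarrow> (\<exists>P Q. has_partials (\<lambda>w. fst (e w)) P z \<and> has_partials (\<lambda>w. snd (e w)) Q z)"

definition closed_form_at :: "form1 \<Rightarrow> complex \<times> complex \<Rightarrow> bool" where
  "closed_form_at e z \<longleftrightarrow>
     (\<exists>P Q. has_partials (\<lambda>w. fst (e w)) P z \<and> has_partials (\<lambda>w. snd (e w)) Q z \<and> fst Q = snd P)"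

lemma closed_form_dlog_aff: "aff a z \<noteq> 0 \<Longrightarrow> closed_form_at (dlog_aff a) z"
  unfolding closed_form_at_def dlog_aff_def fst_conv snd_conv
  by (rule exI, rule exI, intro conjI, rule has_partials_divide[OF has_partials_const has_partials_aff], assumption,
      rule has_partials_divide[OF has_partials_const has_partials_aff], assumption) simp

lemma closed_form_smul: "closed_form_at e z \<Longrightarrow> closed_form_at (\<lambda>w. smul k (e w)) z"
  unfolding closed_form_at_def smul_def fst_conv snd_conv
  using has_partials_mult[OF has_partials_const[of k]] by fastforce

lemma closed_form_add: "closed_form_at e z \<Longrightarrow> closed_form_at f z \<Longrightarrow> closed_form_at (\<lambda>w. e w + f w) z"
proof -
  assume "closed_form_at e z" "closed_form_at f z"
  then obtain P Q P' Q' where "has_partials (\<lambda>w. fst (e w)) P z" "has_partials (\<lambda>w. snd (e w)) Q z" "fst Q = snd P"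
    "has_partials (\<lambda>w. fst (f w)) P' z" "has_partials (\<lambda>w. snd (f w)) Q' z" "fst Q' = snd P'"
    unfolding closed_form_at_def by (elim exE conjE)
  then show ?thesis
    unfolding closed_form_at_def fst_add snd_add
    by (intro exI[of _ "P + P'"] exI[of _ "Q + Q'"] conjI has_partials_add) simp_all
qed

lemma closed_form_diff: "closed_form_at e z \<Longrightarrow> closed_form_at f z \<Longrightarrow> closed_form_at (\<lambda>w. e w - f w) z"
proof -
  assume "closed_form_at e z" "closed_form_at f z"
  then obtain P Q P' Q' where "has_partials (\<lambda>w. fst (e w)) P z" "has_partials (\<lambda>w. snd (e w)) Q z" "fst Q = snd P"
    "has_partials (\<lambda>w. fst (f w)) P' z" "has_partials (\<lambda>w. snd (f w)) Q' z" "fst Q' = snd P'"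
    unfolding closed_form_at_def by (elim exE conjE)
  then show ?thesis
    unfolding closed_form_at_def fst_diff snd_diff
    by (intro exI[of _ "P - P'"] exI[of _ "Q - Q'"] conjI has_partials_diff) simp_all
qed

lemma closed_form_ext_deriv: "closed_form_at e z \<Longrightarrow> ext_deriv e z = 0"
  unfolding closed_form_at_def by (auto simp: ext_deriv_eqI)

lemma closed_form_has_partials: "closed_form_at e z \<Longrightarrow> form_has_partials e z"
  unfolding closed_form_at_def form_has_partials_def by blast

lemma ext_deriv_smul_add_closed:
  assumes "form_has_partials \<kappa> z" "closed_form_at e z"
  shows "ext_deriv (\<lambda>w. smul k (\<kappa> w) + e w) z = k * ext_deriv \<kappa> z"
proof -
  obtain P Q where PQ: "has_partials (\<lambda>w. fst (\<kappa> w)) P z" "has_partials (\<lambda>w. snd (\<kappa> w)) Q z"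
    using assms(1) unfolding form_has_partials_def by blast
  obtain P' Q' where PQ': "has_partials (\<lambda>w. fst (e w)) P' z" "has_partials (\<lambda>w. snd (e w)) Q' z" "fst Q' = snd P'"
    using assms(2) unfolding closed_form_at_def by blast
  have "ext_deriv (\<lambda>w. smul k (\<kappa> w) + e w) z = (k * fst Q + fst Q') - (k * snd P + snd P')"
    using ext_deriv_eqI[of "\<lambda>w. smul k (\<kappa> w) + e w", unfolded smul_def fst_add snd_add fst_conv snd_conv,
        OF has_partials_add[OF has_partials_mult[OF has_partials_const PQ(1)] PQ'(1)]
           has_partials_add[OF has_partials_mult[OF has_partials_const PQ(2)] PQ'(2)]]
    by (simp add: smul_def)
  also have "\<dots> = k * ext_deriv \<kappa> z" using PQ'(3) by (simp add: ext_deriv_eqI[OF PQ] algebra_simps)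
  finally show ?thesis .
qed

text \<open>
  Write \<open>\<theta>_i = \<alpha>_i (\<sigma>x - \<omega>_i \<sigma>y)\<close>. Comparison with \<open>\<Omega>\<close> shows that the product of the \<open>\<alpha>_i\<close>
  is \<open>f\<close> and that \<open>\<omega>_i^d = - h / f\<close>. So \<open>\<omega>_i / \<omega>_0\<close> is a root of unity and locally constant,
  and near \<open>z0\<close> the web lies in the pencil spanned by \<open>\<sigma>x\<close> and \<open>\<omega>_0 \<sigma>y\<close>. In the sum of the
  forms of \<open>eta_pencil\<close> over all triples the units \<open>\<alpha>_i\<close> contribute a multiple of \<open>df / f\<close>;
  apart from \<open>\<kappa>\<close> there remain logarithmic differentials of affine functions, which are
  closed.
\<close>

lemma curvature_binomial_web:
  assumes d: "d \<ge> 3" and U: "open U" and dec: "decomposition d \<Omega> U \<theta>"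
    and \<Omega>: "\<And>z w. z \<in> U \<Longrightarrow> \<Omega> z w = aff f z * apply_form (\<sigma>x z) w ^ d + aff h z * apply_form (\<sigma>y z) w ^ d"
    and \<sigma>x: "\<sigma>x = (\<lambda>z. (aff x1 z, aff x2 z))" and \<sigma>y: "\<sigma>y = (\<lambda>z. (aff y1 z, aff y2 z))"
    and n: "\<And>z. wedge (\<sigma>x z) (\<sigma>y z) = aff n z"
    and \<kappa>: "\<And>z. aff f z \<noteq> 0 \<Longrightarrow> aff h z \<noteq> 0 \<Longrightarrow> aff n z \<noteq> 0 \<Longrightarrow>
        wedge (\<kappa> z) (\<sigma>x z) = fst (snd x2) - snd (snd x1) \<and>
        wedge (\<kappa> z - smul (1 / of_nat d) (dlog_aff h z - dlog_aff f z)) (\<sigma>y z) = fst (snd y2) - snd (snd y1) \<and>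
        form_has_partials \<kappa> z"
    and z0: "z0 \<in> U"
  shows "curvature d \<theta> z0 = of_nat (d choose 3) * ext_deriv \<kappa> z0"
    and "aff f z0 \<noteq> 0" "aff h z0 \<noteq> 0" "aff n z0 \<noteq> 0"
proof -
  have d2: "d \<ge> 2" and d0: "d > 0" using d by auto
  have hol\<theta>: "holomorphic2_on (\<lambda>z. fst (\<theta> i z)) U" "holomorphic2_on (\<lambda>z. snd (\<theta> i z)) U" if "i < d" for i
    using dec that unfolding decomposition_def by auto
  have \<delta>: "wedge (\<theta> i z) (\<theta> j z) \<noteq> 0" if "i < d" "j < d" "i \<noteq> j" "z \<in> U" for i j z
    using dec that unfolding decomposition_def delta_def by auto
  have prod: "aff f z * apply_form (\<sigma>x z) w ^ d + aff h z * apply_form (\<sigma>y z) w ^ d = (\<Prod>i<d. apply_form (\<theta> i z) w)"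
    if "z \<in> U" for z w
  proof -
    have "\<Omega> z w = (\<Prod>i<d. apply_form (\<theta> i z) w)" using dec that unfolding decomposition_def by blast
    then show ?thesis unfolding \<Omega>[OF that] .
  qed
  have nv: "aff f z \<noteq> 0" "aff h z \<noteq> 0" "aff n z \<noteq> 0" if z: "z \<in> U" for z
    using decomposition_nonvanishing[where \<theta> = "\<lambda>i. \<theta> i z", OF d2 \<delta> prod] z unfolding n by blast+
  define \<alpha> where "\<alpha> i z = wedge (\<theta> i z) (\<sigma>y z) * inverse (aff n z)" for i z
  define \<beta> where "\<beta> i z = wedge (\<sigma>x z) (\<theta> i z) * inverse (aff n z)" for i z
  define \<omega> where "\<omega> i z = - \<beta> i z * inverse (\<alpha> i z)" for i z
  have rep: "fst (\<theta> i z) = \<alpha> i z * fst (\<sigma>x z) + \<beta> i z * fst (\<sigma>y z)"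
      "snd (\<theta> i z) = \<alpha> i z * snd (\<sigma>x z) + \<beta> i z * snd (\<sigma>y z)" if "z \<in> U" for i z
  proof -
    have "wedge e y * fst x + wedge x e * fst y = fst e * wedge x y"
      "wedge e y * snd x + wedge x e * snd y = snd e * wedge x y" for e x y
      by (simp_all add: wedge_def algebra_simps)
    from this[of "\<theta> i z" "\<sigma>y z" "\<sigma>x z"] nv(3)[OF that]
    show "fst (\<theta> i z) = \<alpha> i z * fst (\<sigma>x z) + \<beta> i z * fst (\<sigma>y z)"
      "snd (\<theta> i z) = \<alpha> i z * snd (\<sigma>x z) + \<beta> i z * snd (\<sigma>y z)"
      unfolding n by (simp_all add: \<alpha>_def \<beta>_def field_simps)
  qed
  have dual: "\<exists>w. apply_form (\<sigma>x z) w = p \<and> apply_form (\<sigma>y z) w = q" if "z \<in> U" for z p q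
  proof -
    define w where "w = ((p * snd (\<sigma>y z) - q * snd (\<sigma>x z)) / aff n z, (q * fst (\<sigma>x z) - p * fst (\<sigma>y z)) / aff n z)"
    have "apply_form (\<sigma>x z) w = p * wedge (\<sigma>x z) (\<sigma>y z) / aff n z"
      by (simp add: w_def apply_form_def wedge_def add_divide_distrib[symmetric]) (simp add: algebra_simps)
    moreover have "apply_form (\<sigma>y z) w = q * wedge (\<sigma>x z) (\<sigma>y z) / aff n z"
      by (simp add: w_def apply_form_def wedge_def add_divide_distrib[symmetric]) (simp add: algebra_simps)
    ultimately show ?thesis using nv(3)[OF that] unfolding n by (intro exI[of _ w]) simp
  qed
  have \<theta>w: "apply_form (\<theta> i z) w = \<alpha> i z * apply_form (\<sigma>x z) w + \<beta> i z * apply_form (\<sigma>y z) w" if "z \<in> U" for i z w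
    unfolding apply_form_def rep[OF that] by (simp add: algebra_simps)
  have prod\<alpha>: "(\<Prod>i<d. \<alpha> i z) = aff f z" if zU: "z \<in> U" for z
  proof -
    obtain w where w: "apply_form (\<sigma>x z) w = 1" "apply_form (\<sigma>y z) w = 0" using dual[OF zU] by blast
    show ?thesis using prod[OF zU, of w] d0 unfolding \<theta>w[OF zU] w by (simp add: power_0_left)
  qed
  have \<alpha>0: "\<alpha> i z \<noteq> 0" if "i < d" "z \<in> U" for i z
  proof
    assume "\<alpha> i z = 0"
    then have "(\<Prod>i<d. \<alpha> i z) = 0" using that(1) by (intro prod_zero bexI[of _ i]) auto
    then show False using prod\<alpha>[OF that(2)] nv(1)[OF that(2)] by simp
  qed
  have root: "aff f z * \<omega> i z ^ d = - aff h z" if i: "i < d" and z: "z \<in> U" for i z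
  proof -
    obtain w where w: "apply_form (\<sigma>x z) w = \<omega> i z" "apply_form (\<sigma>y z) w = 1" using dual[OF z] by blast
    have "apply_form (\<theta> i z) w = 0"
      unfolding \<theta>w[OF z] w using \<alpha>0[OF i z] by (simp add: \<omega>_def)
    then have "(\<Prod>i<d. apply_form (\<theta> i z) w) = 0" using i by (intro prod_zero bexI[of _ i]) auto
    with prod[OF z, of w] have "aff f z * \<omega> i z ^ d + aff h z = 0"
      by (simp only: w power_one mult_1_right)
    then show ?thesis by (rule eq_neg_iff_add_eq_0[THEN iffD2])
  qed
  have \<omega>0: "\<omega> i z \<noteq> 0" if "i < d" "z \<in> U" for i z
    using root[OF that] nv(2)[OF that(2)] d0 by (auto simp: power_0_left)
  have rep\<omega>: "fst (\<theta> i z) = \<alpha> i z * (fst (\<sigma>x z) - \<omega> i z * fst (\<sigma>y z))"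
      "snd (\<theta> i z) = \<alpha> i z * (snd (\<sigma>x z) - \<omega> i z * snd (\<sigma>y z))" if "i < d" "z \<in> U" for i z
    unfolding rep[OF that(2)] using \<alpha>0[OF that] by (simp_all add: \<omega>_def algebra_simps)
  have \<omega>_inj: "\<omega> i z \<noteq> \<omega> j z" if "i < d" "j < d" "i \<noteq> j" "z \<in> U" for i j z
  proof
    assume "\<omega> i z = \<omega> j z"
    then have "wedge (\<theta> i z) (\<theta> j z) = 0"
      unfolding wedge_def rep\<omega>[OF that(1,4)] rep\<omega>[OF that(2,4)] by simp
    with \<delta>[OF that] show False by simp
  qed
  have hol\<sigma>: "holomorphic2_on (\<lambda>z. fst (\<sigma>x z)) U" "holomorphic2_on (\<lambda>z. snd (\<sigma>x z)) U"
    "holomorphic2_on (\<lambda>z. fst (\<sigma>y z)) U" "holomorphic2_on (\<lambda>z. snd (\<sigma>y z)) U"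
    unfolding \<sigma>x \<sigma>y fst_conv snd_conv by (rule holomorphic2_on_aff)+
  have hol\<alpha>: "holomorphic2_on (\<alpha> i) U" if "i < d" for i
    unfolding \<alpha>_def wedge_def
    by (intro holomorphic2_on_mult holomorphic2_on_diff hol\<theta> that hol\<sigma> holomorphic2_on_inverse holomorphic2_on_aff nv)
  have hol\<beta>: "holomorphic2_on (\<beta> i) U" if "i < d" for i
    unfolding \<beta>_def wedge_def
    by (intro holomorphic2_on_mult holomorphic2_on_diff hol\<theta> that hol\<sigma> holomorphic2_on_inverse holomorphic2_on_aff nv)
  have hol\<omega>: "holomorphic2_on (\<omega> i) U" if "i < d" for i
    unfolding \<omega>_def
    by (intro holomorphic2_on_mult holomorphic2_on_minus hol\<alpha> hol\<beta> that holomorphic2_on_inverse \<alpha>0)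
  obtain \<epsilon> where \<epsilon>: "\<epsilon> > 0" "ball z0 \<epsilon> \<subseteq> U" using U z0 by (meson open_contains_ball)
  let ?V = "ball z0 \<epsilon>"
  have zV: "z0 \<in> ?V" using \<epsilon>(1) by simp
  define c where "c i = \<omega> i z0 / \<omega> 0 z0" for i
  have c: "\<omega> i z = c i * \<omega> 0 z" if i: "i < d" and z: "z \<in> ?V" for i z
  proof -
    let ?\<rho> = "\<lambda>z. \<omega> i z / \<omega> 0 z"
    have "continuous_on ?V ?\<rho>"
      by (intro continuous_on_divide continuous_on_subset[OF holomorphic2_on_imp_continuous_on[OF hol\<omega>] \<epsilon>(2)] i d0)
         (use \<omega>0[OF d0] \<epsilon>(2) in auto)
    moreover have "?\<rho> ` ?V \<subseteq> {x. x ^ d = 1}"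
    proof
      fix x assume "x \<in> ?\<rho> ` ?V"
      then obtain z where z: "z \<in> U" "x = ?\<rho> z" using \<epsilon>(2) by auto
      have "aff f z * \<omega> i z ^ d = aff f z * \<omega> 0 z ^ d" using root[OF i z(1)] root[OF d0 z(1)] by simp
      then show "x \<in> {x. x ^ d = 1}" using nv(1)[OF z(1)] \<omega>0[OF d0 z(1)] by (simp add: z(2) power_divide)
    qed
    then have "finite (?\<rho> ` ?V)" by (rule finite_subset) (rule finite_roots_unity, use d0 in simp)
    ultimately have "?\<rho> constant_on ?V" using continuous_finite_range_constant[OF connected_ball] by blast
    then have "?\<rho> z = ?\<rho> z0" using z zV unfolding constant_on_def by metis
    then show ?thesis using \<omega>0[OF d0, of z] z \<epsilon>(2) by (auto simp: c_def field_simps)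
  qed
  have c_inj: "c i \<noteq> c j" if "i < d" "j < d" "i \<noteq> j" for i j
    using \<omega>_inj[OF that z0] \<omega>0[OF d0 z0] by (simp add: c_def)
  define E0 where "E0 z = smul (1 / of_nat d) (dlog_aff h z - dlog_aff f z)" for z
  have dlog\<omega>: "has_dlog (\<omega> 0) (E0 z) z" if z: "z \<in> U" for z
  proof -
    obtain e' where e': "has_partials (\<omega> 0) e' z" by (rule holomorphic2_on_has_partials[OF hol\<omega>[OF d0] z])
    define e where "e = (fst e' / \<omega> 0 z, snd e' / \<omega> 0 z)"
    have e: "has_dlog (\<omega> 0) e z" using e' \<omega>0[OF d0 z] by (simp add: has_dlog_def e_def)
    have "has_dlog (\<lambda>w. aff f w * (\<Prod>i<d. \<omega> 0 w)) (dlog_aff f z + (\<Sum>i<d. e)) z"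
      by (intro has_dlog_mult has_dlog_aff nv z has_dlog_prod finite_lessThan e)
    moreover have "\<forall>\<^sub>F w in nhds z. aff f w * (\<Prod>i<d. \<omega> 0 w) = (-1) * aff h w"
      using eventually_nhds_in_open[OF U z] by eventually_elim (simp add: root[OF d0])
    ultimately have 1: "has_dlog (\<lambda>w. (-1) * aff h w) (dlog_aff f z + (\<Sum>i<d. e)) z"
      by (rule has_dlog_cong[rotated])
    have "has_dlog (\<lambda>w. -1) 0 z" by (simp add: has_dlog_def has_partials_const)
    from has_dlog_mult[OF this has_dlog_aff[OF nv(2)[OF z]]]
    have 2: "has_dlog (\<lambda>w. (-1) * aff h w) (0 + dlog_aff h z) z" .
    have "dlog_aff f z + (\<Sum>i<d. e) = 0 + dlog_aff h z" by (rule has_dlog_unique[OF 1 2])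
    then have "fst (dlog_aff f z) + of_nat d * fst e = fst (dlog_aff h z)"
      "snd (dlog_aff f z) + of_nat d * snd e = snd (dlog_aff h z)"
      by (auto simp: prod_eq_iff fst_sum snd_sum)
    then have "e = E0 z" using d0 by (simp add: E0_def smul_def prod_eq_iff field_simps)
    with e show ?thesis by simp
  qed
  let ?S = "{(r, s, t). r < s \<and> s < t \<and> t < d}"
  let ?K3 = "of_nat (d choose 3) :: complex" and ?K2 = "of_nat ((d - 1) choose 2) :: complex"
  have total: "(\<Sum>(r, s, t)\<in>?S. eta \<theta> r s t z) = smul ?K3 (\<kappa> z) + (smul ?K3 (E0 z + dlog_aff n z) + smul ?K2 (dlog_aff f z))"
    if z: "z \<in> ?V" for z
  proof -
    have zU: "z \<in> U" using z \<epsilon>(2) by auto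
    have evV: "\<forall>\<^sub>F w in nhds z. w \<in> ?V" by (rule eventually_nhds_in_open[OF open_ball z])
    have "\<forall>i\<in>{..<d}. \<exists>L. has_dlog (\<alpha> i) L z"
    proof
      fix i assume i: "i \<in> {..<d}"
      then have i': "i < d" by simp
      obtain e where "has_partials (\<alpha> i) e z" by (rule holomorphic2_on_has_partials[OF hol\<alpha>[OF i'] zU])
      then have "has_dlog (\<alpha> i) (fst e / \<alpha> i z, snd e / \<alpha> i z) z" using \<alpha>0[OF i' zU] by (simp add: has_dlog_def)
      then show "\<exists>L. has_dlog (\<alpha> i) L z" by blast
    qed
    from bchoice[OF this] obtain L where L: "\<And>i. i < d \<Longrightarrow> has_dlog (\<alpha> i) (L i) z" by auto
    have "has_dlog (\<lambda>w. \<Prod>i<d. \<alpha> i w) (\<Sum>i<d. L i) z" by (intro has_dlog_prod finite_lessThan L) simp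
    moreover have "\<forall>\<^sub>F w in nhds z. (\<Prod>i<d. \<alpha> i w) = aff f w"
      using eventually_nhds_in_open[OF U zU] by eventually_elim (rule prod\<alpha>)
    ultimately have "has_dlog (aff f) (\<Sum>i<d. L i) z" by (rule has_dlog_cong[rotated])
    from has_dlog_unique[OF this has_dlog_aff[OF nv(1)[OF zU]]] have sumL: "(\<Sum>i<d. L i) = dlog_aff f z" .
    define \<sigma>2 where "\<sigma>2 w = (\<omega> 0 w * fst (\<sigma>y w), \<omega> 0 w * snd (\<sigma>y w))" for w
    have m: "has_dlog (\<lambda>w. wedge (\<sigma>x w) (\<sigma>2 w)) (E0 z + dlog_aff n z) z"
    proof -
      have "wedge (\<sigma>x w) (\<sigma>2 w) = \<omega> 0 w * aff n w" for w
        unfolding n[symmetric] by (simp add: \<sigma>2_def wedge_def algebra_simps)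
      then show ?thesis using has_dlog_mult[OF dlog\<omega>[OF zU] has_dlog_aff[OF nv(3)[OF zU]]] by simp
    qed
    note \<kappa>z = \<kappa>[OF nv[OF zU]]
    have p1: "has_partials (\<lambda>w. fst (\<sigma>x w)) (snd x1) z" "has_partials (\<lambda>w. snd (\<sigma>x w)) (snd x2) z"
      unfolding \<sigma>x fst_conv snd_conv by (rule has_partials_aff)+
    have p1': "fst (snd x2) - snd (snd x1) = wedge (\<kappa> z) (\<sigma>x z)" using \<kappa>z by simp
    have q: "has_partials (\<lambda>w. fst (\<sigma>y w)) (snd y1) z" "has_partials (\<lambda>w. snd (\<sigma>y w)) (snd y2) z"
      unfolding \<sigma>y fst_conv snd_conv by (rule has_partials_aff)+
    let ?e = "(\<omega> 0 z * fst (E0 z), \<omega> 0 z * snd (E0 z))"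
    have pe: "has_partials (\<omega> 0) ?e z" using dlog\<omega>[OF zU] by (simp add: has_dlog_def)
      let ?P2 = "(fst ?e * fst (\<sigma>y z) + \<omega> 0 z * fst (snd y1), snd ?e * fst (\<sigma>y z) + \<omega> 0 z * snd (snd y1))"
    let ?Q2 = "(fst ?e * snd (\<sigma>y z) + \<omega> 0 z * fst (snd y2), snd ?e * snd (\<sigma>y z) + \<omega> 0 z * snd (snd y2))"
    have p2: "has_partials (\<lambda>w. fst (\<sigma>2 w)) ?P2 z" "has_partials (\<lambda>w. snd (\<sigma>2 w)) ?Q2 z"
      unfolding \<sigma>2_def using has_partials_mult[OF pe q(1)] has_partials_mult[OF pe q(2)] by simp_all
    have "fst ?Q2 - snd ?P2 = \<omega> 0 z * (wedge (E0 z) (\<sigma>y z) + (fst (snd y2) - snd (snd y1)))"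
      by (simp add: wedge_def algebra_simps)
    also have "fst (snd y2) - snd (snd y1) = wedge (\<kappa> z - E0 z) (\<sigma>y z)" using \<kappa>z by (simp add: E0_def)
    also have "\<omega> 0 z * (wedge (E0 z) (\<sigma>y z) + wedge (\<kappa> z - E0 z) (\<sigma>y z)) = wedge (\<kappa> z) (\<sigma>2 z)"
      by (simp add: wedge_def \<sigma>2_def algebra_simps)
    finally have p2': "fst ?Q2 - snd ?P2 = wedge (\<kappa> z) (\<sigma>2 z)" .
    have eta: "eta \<theta> r s t z = \<kappa> z + (E0 z + dlog_aff n z) + (L r + L s + L t)" if rst: "r < s" "s < t" "t < d" for r s t
    proof (rule eta_pencil[OF _ _ _ _ _ m p1 p1' p2 p2'])
      fix i assume "i \<in> {r, s, t}"
      then have i: "i < d" using rst by auto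
      then show "has_dlog (\<alpha> i) (L i) z" by (rule L)
      show "\<forall>\<^sub>F w in nhds z. \<theta> i w = (\<alpha> i w * (fst (\<sigma>x w) - c i * fst (\<sigma>2 w)), \<alpha> i w * (snd (\<sigma>x w) - c i * snd (\<sigma>2 w)))"
        using evV
      proof eventually_elim
        case (elim w)
        then have "w \<in> U" using \<epsilon>(2) by auto
        then show ?case using rep\<omega>[OF i, of w] c[OF i elim] by (simp add: prod_eq_iff \<sigma>2_def mult.assoc)
      qed
    qed (use c_inj rst in auto)
    have "(\<Sum>(r, s, t)\<in>?S. eta \<theta> r s t z) = (\<Sum>(r, s, t)\<in>?S. \<kappa> z + (E0 z + dlog_aff n z) + (L r + L s + L t))"
      by (rule sum.cong) (auto simp: eta)
    also have "\<dots> = (\<Sum>(r, s, t)\<in>?S. \<kappa> z + (E0 z + dlog_aff n z)) + (\<Sum>(r, s, t)\<in>?S. L r + L s + L t)"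
      by (simp add: case_prod_unfold sum.distrib)
    also have "(\<Sum>(r, s, t)\<in>?S. \<kappa> z + (E0 z + dlog_aff n z)) = smul ?K3 (\<kappa> z + (E0 z + dlog_aff n z))"
    proof -
      have "(\<Sum>x\<in>S. v) = smul (of_nat (card S)) v" for S :: "(nat \<times> nat \<times> nat) set" and v
        by (simp add: smul_def prod_eq_iff fst_sum snd_sum)
      then show ?thesis using sum_triples[of "\<lambda>_. 0" d] by (simp add: case_prod_unfold)
    qed
    also have "(\<Sum>(r, s, t)\<in>?S. L r + L s + L t) = smul ?K2 (dlog_aff f z)"
      unfolding sumL[symmetric]
      using sum_triples[of "\<lambda>i. fst (L i)" d, THEN conjunct1] sum_triples[of "\<lambda>i. snd (L i)" d, THEN conjunct1]
      by (simp add: smul_def prod_eq_iff fst_sum snd_sum case_prod_unfold)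
    finally show ?thesis by (simp add: smul_def prod_eq_iff algebra_simps)
  qed
  have "curvature d \<theta> z0 = ext_deriv (\<lambda>z. smul ?K3 (\<kappa> z) + (smul ?K3 (E0 z + dlog_aff n z) + smul ?K2 (dlog_aff f z))) z0"
    unfolding curvature_def
    by (rule ext_deriv_cong) (use eventually_nhds_in_open[OF open_ball zV] in eventually_elim, rule total)
  also have "\<dots> = ?K3 * ext_deriv \<kappa> z0"
    unfolding E0_def
    by (intro ext_deriv_smul_add_closed closed_form_add closed_form_smul closed_form_diff closed_form_dlog_aff nv z0)
       (use \<kappa>[OF nv[OF z0]] in blast)
  finally show "curvature d \<theta> z0 = of_nat (d choose 3) * ext_deriv \<kappa> z0" .
  show "aff f z0 \<noteq> 0" "aff h z0 \<noteq> 0" "aff n z0 \<noteq> 0" using nv[OF z0] by auto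
qed

section \<open>The Legendre transform of a binomial foliation\<close>

lemma prod_roots_unity:
  fixes X Y :: complex
  assumes d: "d > 0"
  defines "c \<equiv> \<lambda>k. cis (2 * pi * real k / real d)"
  shows "(\<Prod>k<d. X - c k * Y) = X ^ d - Y ^ d"
proof -
  have bij: "bij_betw c {..<d} {z. z ^ d = 1}" unfolding c_def by (rule Complex.bij_betw_roots_unity[OF d])
  define p where "p = (\<Prod>k<d. [:- c k, 1:])"
  define q where "q = monom 1 d - (1 :: complex poly)"
  have pq: "p = q"
  proof (rule poly_eqI_degree_lead_coeff[where n = d and A = "{z. z ^ d = 1}"])
    show "d \<le> card {z :: complex. z ^ d = 1}" using card_roots_unity_eq[OF d] by simp
    have dp: "degree p = d" unfolding p_def by (subst degree_prod_eq_sum_degree) auto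
    then show "degree p \<le> d" by simp
    show "degree q \<le> d" unfolding q_def by (intro degree_diff_le degree_monom_le) simp
    have "lead_coeff p = 1" unfolding p_def lead_coeff_prod by simp
    then show "coeff p d = coeff q d" using d dp by (simp add: q_def)
    fix z assume z: "z \<in> {z :: complex. z ^ d = 1}"
    then obtain k where "k < d" "z = c k" using bij unfolding bij_betw_def by auto
    then have "poly p z = 0" unfolding p_def poly_prod by (intro prod_zero bexI[of _ k]) auto
    then show "poly p z = poly q z" using z by (simp add: q_def poly_monom)
  qed
  have x: "(\<Prod>k<d. x - c k) = x ^ d - 1" for x
    using arg_cong[OF pq, of "\<lambda>p. poly p x"] by (simp add: p_def q_def poly_prod poly_monom)
  show ?thesis
  proof (cases "Y = 0")
    case True
    then show ?thesis using d by (simp add: power_0_left)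
  next
    case False
    have "(\<Prod>k<d. X - c k * Y) = (\<Prod>k<d. Y * (X / Y - c k))"
      by (rule prod.cong) (use False in \<open>auto simp: field_simps\<close>)
    also have "\<dots> = Y ^ d * ((X / Y) ^ d - 1)" by (simp add: prod.distrib x)
    also have "\<dots> = X ^ d - Y ^ d" using False by (simp add: field_simps)
    finally show ?thesis .
  qed
qed

lemma poly_poly_eval: "poly (poly Q r) x = poly (poly Q [:poly r x:]) (x :: complex)"
  by (induction Q) auto

lemma homogenized_linear_power:
  "(\<Sum>j\<le>d. coeff ([:\<alpha>, \<beta>:] ^ d) j * Y ^ j * X ^ (d - j)) = (\<alpha> * X + \<beta> * Y) ^ d" for X Y :: complex
proof -
  have "(\<alpha> * X + \<beta> * Y) ^ d = (\<beta> * Y + \<alpha> * X) ^ d" by (simp add: add.commute)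
  also have "\<dots> = (\<Sum>j\<le>d. of_nat (d choose j) * (\<beta> * Y) ^ j * (\<alpha> * X) ^ (d - j))"
    by (rule binomial_ring)
  also have "\<dots> = (\<Sum>j\<le>d. coeff ([:\<alpha>, \<beta>:] ^ d) j * Y ^ j * X ^ (d - j))"
    by (rule sum.cong) (simp_all add: coeff_linear_poly_power power_mult_distrib)
  finally show ?thesis by simp
qed

text \<open>
  An envelope of the lines \<open>y = p x - q\<close> touches them at \<open>(dq, p dq - q dp, dp)\<close>, in
  homogeneous coordinates. This is the pairing of that point with the row vector \<open>m\<close>.
\<close>

definition row_form :: "complex ^ 3 \<Rightarrow> form1" where
  "row_form m = (\<lambda>z. (aff (m $ 3, 0, - m $ 2) z, aff (m $ 1, m $ 2, 0) z))"

text \<open>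
  Under a linear map of the plane with rows \<open>m1, m2, m3\<close>, the coordinates \<open>(p, -1, -q)\<close> of a
  line are transformed by the cofactor matrix, whose rows are the cross products
  \<open>m2 \<times> m3, m3 \<times> m1, m1 \<times> m2\<close>. This is the pairing of \<open>x \<times> y\<close> with \<open>(p, -1, -q)\<close>.
\<close>

definition cross_line :: "complex ^ 3 \<Rightarrow> complex ^ 3 \<Rightarrow> complex \<times> complex \<times> complex" where
  "cross_line x y = (- (x $ 3 * y $ 1 - x $ 1 * y $ 3), x $ 2 * y $ 3 - x $ 3 * y $ 2, - (x $ 1 * y $ 2 - x $ 2 * y $ 1))"

definition scale_aff :: "complex \<Rightarrow> complex \<times> complex \<times> complex \<Rightarrow> complex \<times> complex \<times> complex" where
  "scale_aff k a = (k * fst a, k * fst (snd a), k * snd (snd a))"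

lemma aff_scale_aff [simp]: "aff (scale_aff k a) z = k * aff a z"
  by (simp add: aff_def scale_aff_def algebra_simps)

lemma aff_add: "aff (a + b) z = aff a z + aff b z"
  by (simp add: aff_def algebra_simps)

lemma dlog_aff_scale_aff: "k \<noteq> 0 \<Longrightarrow> dlog_aff (scale_aff k a) z = dlog_aff a z"
  by (simp add: dlog_aff_def) (simp add: scale_aff_def)

lemma transpose_vector_mult_3:
  fixes M :: "complex ^ 3 ^ 3"
  shows "(transpose M *v v) $ i = M $ 1 $ i * v $ 1 + M $ 2 $ i * v $ 2 + M $ 3 $ i * v $ 3"
  by (simp add: matrix_vector_mult_3 transpose_def)

text \<open>
  The polynomial whose roots are the tangencies is, up to the factor \<open>k\<close>, the form
  \<open>projective_form A B\<close> taken at the image point \<open>M (x, p x - q, 1)\<close> and evaluated on the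
  image \<open>M (1, p, 0)\<close> of the direction of the line. It involves the direction only through
  the cross product of the two images. This cross product is minus the image of the line
  \<open>(p, -1, -q)\<close> under the cofactor matrix, and does not depend on \<open>x\<close>.
\<close>

lemma legendre_form_binomial:
  assumes G: "\<And>v. eval_form G v = k *s (transpose M *v eval_form (projective_form A B) (M *v v))"
    and A: "\<And>v. eval2 A v = a * fst v ^ d + b * snd v ^ d"
    and B: "\<And>v. eval2 B v = c * fst v ^ d + e * snd v ^ d"
  shows "legendre_form d G z w =
     aff (scale_aff k (scale_aff c (cross_line (M $ 2) (M $ 3)) + scale_aff (- a) (cross_line (M $ 3) (M $ 1)))) z * apply_form (row_form (M $ 1) z) w ^ d +
     aff (scale_aff k (scale_aff e (cross_line (M $ 2) (M $ 3)) + scale_aff (- b) (cross_line (M $ 3) (M $ 1)))) z * apply_form (row_form (M $ 2) z) w ^ d"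
    (is "_ = ?f * apply_form ?X w ^ d + ?h * apply_form ?Y w ^ d")
proof -
  obtain p q where z: "z = (p, q)" by (cases z)
  have G3: "poly (poly (poly (G $ i) 1) [:- q, p:]) x = eval_form G (vector [x, p * x - q, 1]) $ i" for i x
    by (simp add: eval_form_def eval3_def poly_poly_eval[of _ "[:- q, p:]"] mult.commute flip: one_pCons)
  have "legendre_poly G z = smult ?f ([:fst ?X, snd ?X:] ^ d) + smult ?h ([:fst ?Y, snd ?Y:] ^ d)"
  proof (rule poly_eq_poly_eq_iff[THEN iffD1], rule ext)
    fix x
    define v :: "complex ^ 3" where "v = vector [x, p * x - q, 1]"
    have v: "v $ 1 = x" "v $ 2 = p * x - q" "v $ 3 = 1" by (simp_all add: v_def)
    let ?y = "M *v v"
    have y1: "?y $ 1 = poly [:fst ?X, snd ?X:] x" and y2: "?y $ 2 = poly [:fst ?Y, snd ?Y:] x"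
      by (simp_all add: matrix_vector_mult_3 v row_form_def aff_def z algebra_simps)
    let ?A = "eval2 A (?y $ 1, ?y $ 2)" and ?B = "eval2 B (?y $ 1, ?y $ 2)"
    have "poly (legendre_poly G z) x = eval_form G v $ 1 + p * eval_form G v $ 2"
      by (simp add: legendre_poly_def z Let_def G3 v_def)
    also have "\<dots> = k * (?A * (?y $ 3 * (M $ 1 $ 1 + p * M $ 1 $ 2) - ?y $ 1 * (M $ 3 $ 1 + p * M $ 3 $ 2)) +
                       ?B * (?y $ 3 * (M $ 2 $ 1 + p * M $ 2 $ 2) - ?y $ 2 * (M $ 3 $ 1 + p * M $ 3 $ 2)))"
      unfolding G eval_projective_form
      by (simp add: transpose_vector_mult_3 del: transpose_matrix_vector) (simp add: algebra_simps)
    also have "?y $ 3 * (M $ 1 $ 1 + p * M $ 1 $ 2) - ?y $ 1 * (M $ 3 $ 1 + p * M $ 3 $ 2) = - aff (cross_line (M $ 3) (M $ 1)) z"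
      by (simp add: matrix_vector_mult_3 v cross_line_def aff_def z algebra_simps)
    also have "?y $ 3 * (M $ 2 $ 1 + p * M $ 2 $ 2) - ?y $ 2 * (M $ 3 $ 1 + p * M $ 3 $ 2) = aff (cross_line (M $ 2) (M $ 3)) z"
      by (simp add: matrix_vector_mult_3 v cross_line_def aff_def z algebra_simps)
    also have "k * (?A * - aff (cross_line (M $ 3) (M $ 1)) z + ?B * aff (cross_line (M $ 2) (M $ 3)) z) =
       ?f * (?y $ 1) ^ d + ?h * (?y $ 2) ^ d"
      by (simp add: A B aff_add algebra_simps)
    also have "\<dots> = poly (smult ?f ([:fst ?X, snd ?X:] ^ d) + smult ?h ([:fst ?Y, snd ?Y:] ^ d)) x"
      unfolding y1 y2 poly_add poly_smult poly_power ..
    finally show "poly (legendre_poly G z) x = \<dots>" .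
  qed
  then have "legendre_form d G z w =
     ?f * (\<Sum>j\<le>d. coeff ([:fst ?X, snd ?X:] ^ d) j * snd w ^ j * fst w ^ (d - j)) +
     ?h * (\<Sum>j\<le>d. coeff ([:fst ?Y, snd ?Y:] ^ d) j * snd w ^ j * fst w ^ (d - j))"
    unfolding legendre_form_def by (simp add: sum.distrib sum_distrib_left algebra_simps)
  then show ?thesis unfolding homogenized_linear_power by (simp add: apply_form_def)
qed

lemma wedge_row_form: "wedge (row_form x z) (row_form y z) = aff (scale_aff (-1) (cross_line x y)) z"
  by (simp add: wedge_def row_form_def cross_line_def aff_def scale_aff_def algebra_simps)

lemma wedge_dlog_cross_line:
  assumes "aff (cross_line x y) z \<noteq> 0"
  shows "wedge (dlog_aff (cross_line x y) z) (row_form x z) = x $ 2"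
    and "wedge (dlog_aff (cross_line x y) z) (row_form y z) = y $ 2"
proof -
  have "fst (snd (cross_line x y)) * snd (row_form x z) - snd (snd (cross_line x y)) * fst (row_form x z) = x $ 2 * aff (cross_line x y) z"
    "fst (snd (cross_line x y)) * snd (row_form y z) - snd (snd (cross_line x y)) * fst (row_form y z) = y $ 2 * aff (cross_line x y) z"
    by (simp_all add: row_form_def cross_line_def aff_def algebra_simps)
  then show "wedge (dlog_aff (cross_line x y) z) (row_form x z) = x $ 2"
    "wedge (dlog_aff (cross_line x y) z) (row_form y z) = y $ 2"
    using assms by (simp_all add: wedge_def dlog_aff_def field_simps)
qed

lemma wedge_linear:
  "wedge (smul k e) x = k * wedge e x" "wedge (e + e') x = wedge e x + wedge e' x" "wedge (e - e') x = wedge e x - wedge e' x"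
  by (simp_all add: wedge_def smul_def algebra_simps)

text \<open>
  Here \<open>\<omega>\<close> is a constant times \<open>(l1 / l2)^\<epsilon>\<close>. Since \<open>dl_i / l_i\<close> has the wedge product
  \<open>M_12\<close> with \<open>\<sigma>x\<close> for \<open>i = 2, 3\<close>, and \<open>M_22\<close> with \<open>\<sigma>y\<close> for \<open>i = 1, 3\<close>, while \<open>d\<sigma>x = 2 M_12\<close>
  and \<open>d\<sigma>y = 2 M_22\<close>, the form \<open>\<kappa>\<close> has to be a combination of \<open>dl2 / l2\<close> and \<open>dl3 / l3\<close> with
  coefficients of sum \<open>2\<close>, and \<open>\<kappa> - d\<omega> / \<omega>\<close> one of \<open>dl1 / l1\<close> and \<open>dl3 / l3\<close> with the same
  sum.
\<close>

lemma flat_monomial_pencil: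
  fixes \<epsilon> :: complex and M :: "complex ^ 3 ^ 3"
  assumes d: "d \<ge> 3" and k: "k1 \<noteq> 0" "k2 \<noteq> 0" and \<epsilon>: "\<epsilon> = 1 / of_nat d \<and> f = scale_aff k1 l2 \<and> h = scale_aff k2 l1 \<or> \<epsilon> = - 1 / of_nat d \<and> f = scale_aff k1 l1 \<and> h = scale_aff k2 l2"
    and l: "l1 = cross_line (M $ 2) (M $ 3)" "l2 = cross_line (M $ 3) (M $ 1)"
    and \<Omega>: "\<And>z w. \<Omega> z w = aff f z * apply_form (row_form (M $ 1) z) w ^ d + aff h z * apply_form (row_form (M $ 2) z) w ^ d"
  shows "flat_form d \<Omega>"
  unfolding flat_form_def
proof (intro allI impI ballI)
  fix U \<theta> z assume U: "open U" "decomposition d \<Omega> U \<theta>" "z \<in> U"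
  define l3 where "l3 = cross_line (M $ 1) (M $ 2)"
  define \<kappa> where "\<kappa> z = smul (- \<epsilon>) (dlog_aff l2 z) + smul (2 + \<epsilon>) (dlog_aff l3 z)" for z
  have zero: "aff l1 z \<noteq> 0" "aff l2 z \<noteq> 0" if "aff f z \<noteq> 0" "aff h z \<noteq> 0" for z using that \<epsilon> by auto
  have \<kappa>: "wedge (\<kappa> z) (row_form (M $ 1) z) = fst (snd (M $ 1 $ 1, M $ 1 $ 2, 0)) - snd (snd (M $ 1 $ 3, 0, - M $ 1 $ 2)) \<and>
        wedge (\<kappa> z - smul (1 / of_nat d) (dlog_aff h z - dlog_aff f z)) (row_form (M $ 2) z) =
          fst (snd (M $ 2 $ 1, M $ 2 $ 2, 0)) - snd (snd (M $ 2 $ 3, 0, - M $ 2 $ 2)) \<and>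
        form_has_partials \<kappa> z \<and> closed_form_at \<kappa> z"
    if nv: "aff f z \<noteq> 0" "aff h z \<noteq> 0" "aff (scale_aff (-1) l3) z \<noteq> 0" for z
  proof -
    have l3: "aff l3 z \<noteq> 0" using nv(3) by simp
    note z12 = zero[OF nv(1,2)]
    have cl: "closed_form_at \<kappa> z"
      unfolding \<kappa>_def by (intro closed_form_add closed_form_smul closed_form_dlog_aff z12 l3)
    have E: "smul (1 / of_nat d) (dlog_aff h z - dlog_aff f z) = smul \<epsilon> (dlog_aff l1 z - dlog_aff l2 z)"
      using \<epsilon> by (elim disjE conjE) (simp_all add: dlog_aff_scale_aff k smul_def diff_divide_distrib)
    have K: "\<kappa> z - smul \<epsilon> (dlog_aff l1 z - dlog_aff l2 z) = smul (- \<epsilon>) (dlog_aff l1 z) + smul (2 + \<epsilon>) (dlog_aff l3 z)"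
      by (simp add: \<kappa>_def smul_def prod_eq_iff algebra_simps)
    show ?thesis
      unfolding E K
      using cl closed_form_has_partials[OF cl]
        wedge_dlog_cross_line[OF z12(1)[unfolded l]] wedge_dlog_cross_line[OF z12(2)[unfolded l]]
        wedge_dlog_cross_line[OF l3[unfolded l3_def]]
      by (simp add: \<kappa>_def wedge_linear l l3_def algebra_simps)
  qed
  have W: "wedge (row_form (M $ 1) z) (row_form (M $ 2) z) = aff (scale_aff (-1) l3) z" for z
    unfolding l3_def by (rule wedge_row_form)
  note * = curvature_binomial_web[OF d U(1,2) \<Omega> row_form_def row_form_def W _ U(3), of \<kappa>]
  have "curvature d \<theta> z = of_nat (d choose 3) * ext_deriv \<kappa> z" using * \<kappa> by blast
  moreover have "aff f z \<noteq> 0" "aff h z \<noteq> 0" "aff (scale_aff (-1) l3) z \<noteq> 0" using * \<kappa> by blast+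
  ultimately show "curvature d \<theta> z = 0" using closed_form_ext_deriv[of \<kappa> z] \<kappa> by simp
qed

section \<open>Linear changes of coordinates\<close>

lemma is_pullback_trans:
  assumes "is_pullback g F G" "is_pullback h G K"
  shows "is_pullback (g ** h) F K"
proof -
  obtain c where c: "c \<noteq> 0" "\<And>v. eval_form G v = c *s (transpose g *v eval_form F (g *v v))"
    using assms(1) unfolding is_pullback_def by blast
  obtain c' where c': "c' \<noteq> 0" "\<And>v. eval_form K v = c' *s (transpose h *v eval_form G (h *v v))"
    using assms(2) unfolding is_pullback_def by blast
  have "eval_form K v = (c' * c) *s (transpose (g ** h) *v eval_form F ((g ** h) *v v))" for v
    unfolding c'(2) c(2) matrix_transpose_mul vec.scale matrix_vector_mul_assoc vector_smult_assoc ..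
  then show ?thesis unfolding is_pullback_def using c(1) c'(1) by (intro exI[of _ "c' * c"]) simp
qed

lemma is_pullback_factor:
  assumes g: "invertible g" and "is_pullback g F G" "is_pullback h F K"
  obtains M where "h = g ** M" "is_pullback M G K"
proof -
  obtain g' where g': "g ** g' = mat 1" "g' ** g = mat 1" using g unfolding invertible_def by blast
  define M where "M = g' ** h"
  have h: "h = g ** M" by (simp add: M_def matrix_mul_assoc g')
  obtain c where c: "c \<noteq> 0" "\<And>v. eval_form G v = c *s (transpose g *v eval_form F (g *v v))"
    using assms(2) unfolding is_pullback_def by blast
  obtain c' where c': "c' \<noteq> 0" "\<And>v. eval_form K v = c' *s (transpose h *v eval_form F (h *v v))"
    using assms(3) unfolding is_pullback_def by blast
  have "eval_form K v = (c' / c) *s (transpose M *v eval_form G (M *v v))" for v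
    unfolding c'(2) c(2) h matrix_transpose_mul vec.scale matrix_vector_mul_assoc vector_smult_assoc
    using c(1) by simp
  then have "is_pullback M G K" unfolding is_pullback_def using c(1) c'(1) by (intro exI[of _ "c' / c"]) simp
  with h show thesis by (rule that)
qed

lemma flat_web_if_conjugate:
  assumes d: "d \<ge> 3" and conj: "linearly_conjugate H (H1 d) \<or> linearly_conjugate H (H2 d)"
  shows "flat_web d (Leg d H)"
  unfolding flat_web_def Leg_def
proof (clarify)
  fix g G assume g: "invertible g" "is_pullback g H G"
  from conj show "flat_form d (legendre_form d G)"
  proof
    assume "linearly_conjugate H (H1 d)"
    then obtain g0 where "invertible g0" "is_pullback g0 H (H1 d)" unfolding linearly_conjugate_def by blast
    from is_pullback_factor[OF this g(2)] obtain M where "is_pullback M (H1 d) G" by blast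
    then obtain k where k: "k \<noteq> 0" "\<And>v. eval_form G v = k *s (transpose M *v eval_form (H1 d) (M *v v))"
      unfolding is_pullback_def by blast
    have k': "- k \<noteq> 0" using k(1) by simp
    note L = legendre_form_binomial[OF k(2)[unfolded H1_def], of 0 d 1 "-1" 0]
    have "legendre_form d G z w = aff (scale_aff (- k) (cross_line (M $ 2) (M $ 3))) z * apply_form (row_form (M $ 1) z) w ^ d +
        aff (scale_aff (- k) (cross_line (M $ 3) (M $ 1))) z * apply_form (row_form (M $ 2) z) w ^ d" for z w
      by (subst L) (simp_all add: aff_add)
    from flat_monomial_pencil[OF d k' k' _ refl refl this, of "- 1 / of_nat d"] show ?thesis by simp
  next
    assume "linearly_conjugate H (H2 d)"
    then obtain g0 where "invertible g0" "is_pullback g0 H (H2 d)" unfolding linearly_conjugate_def by blast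
    from is_pullback_factor[OF this g(2)] obtain M where "is_pullback M (H2 d) G" by blast
    then obtain k where k: "k \<noteq> 0" "\<And>v. eval_form G v = k *s (transpose M *v eval_form (H2 d) (M *v v))"
      unfolding is_pullback_def by blast
    have k': "- k \<noteq> 0" using k(1) by simp
    note L = legendre_form_binomial[OF k(2)[unfolded H2_def], of 1 d 0 0 "-1"]
    have "legendre_form d G z w = aff (scale_aff (- k) (cross_line (M $ 3) (M $ 1))) z * apply_form (row_form (M $ 1) z) w ^ d +
        aff (scale_aff (- k) (cross_line (M $ 2) (M $ 3))) z * apply_form (row_form (M $ 2) z) w ^ d" for z w
      by (subst L) (simp_all add: aff_add)
    from flat_monomial_pencil[OF d k' k' _ refl refl this, of "1 / of_nat d"] show ?thesis by simp
  qed
qed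

definition binom_form :: "nat \<Rightarrow> complex \<Rightarrow> complex \<Rightarrow> poly2" where
  "binom_form d a b = [:[:a:]:] * var_x ^ d + [:[:b:]:] * var_y ^ d"

lemma eval2_binom_form: "eval2 (binom_form d a b) v = a * fst v ^ d + b * snd v ^ d"
  unfolding binom_form_def eval2_simps ..

context homogeneous_chart
begin

lemma binomial_chart:
  assumes "size (foliation_type d F A B) = 2"
  obtains g' a b c e where "invertible g'" "a * e - b * c \<noteq> 0"
    "is_pullback g' F (projective_form (binom_form d a b) (binom_form d c e))"
proof -
  obtain v1 v2 where v: "det2 v1 v2 \<noteq> 0"
    "\<And>w. w \<noteq> (0, 0) \<Longrightarrow> eval2 (inflection_poly A B) w = 0 \<Longrightarrow> det2 w v1 = 0 \<or> det2 w v2 = 0"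
    using two_inflection_directions[OF assms] by blast
  obtain a b c e where ab: "a * e - b * c \<noteq> 0"
    "\<forall>s t. eval2 A (s * fst v1 + t * fst v2, s * snd v1 + t * snd v2) = a * s ^ d + b * t ^ d"
    "\<forall>s t. eval2 B (s * fst v1 + t * fst v2, s * snd v1 + t * snd v2) = c * s ^ d + e * t ^ d"
    by (rule two_inflection_directions_normal_form[OF homogeneous_A homogeneous_B d_ge_1 no_common_zero v])
  define M :: "complex ^ 3 ^ 3" where "M = vector [vector [fst v1, fst v2, 0], vector [snd v1, snd v2, 0], vector [0, 0, 1]]"
  have M: "M $ 1 = vector [fst v1, fst v2, 0]" "M $ 2 = vector [snd v1, snd v2, 0]" "M $ 3 = vector [0, 0, 1]"
    unfolding M_def by (rule vector_3)+
  have "det M = det2 v1 v2" by (simp add: det_3 M det2_def algebra_simps)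
  then have "invertible M" using v(1) by (simp add: invertible_det_nz)
  then have inv: "invertible (g ** M)" by (rule invertible_mult[OF g])
  let ?a = "fst v1 * a + snd v1 * c" and ?b = "fst v1 * b + snd v1 * e"
  let ?c = "fst v2 * a + snd v2 * c" and ?e = "fst v2 * b + snd v2 * e"
  have "?a * ?e - ?b * ?c = det2 v1 v2 * (a * e - b * c)" by (simp add: det2_def algebra_simps)
  then have det: "?a * ?e - ?b * ?c \<noteq> 0" using v(1) ab(1) by simp
  have "eval_form (projective_form (binom_form d ?a ?b) (binom_form d ?c ?e)) x =
      1 *s (transpose M *v eval_form (projective_form A B) (M *v x))" for x
  proof -
    have A: "eval2 A ((M *v x) $ 1, (M *v x) $ 2) = a * (x $ 1) ^ d + b * (x $ 2) ^ d"
      and B: "eval2 B ((M *v x) $ 1, (M *v x) $ 2) = c * (x $ 1) ^ d + e * (x $ 2) ^ d"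
      using ab(2,3)[rule_format, of "x $ 1" "x $ 2"] by (simp_all add: matrix_vector_mult_3 M mult.commute)
    show ?thesis
      unfolding eval_projective_form A B eval2_binom_form
      by (simp add: vec3_eq_iff transpose_vector_mult_3 matrix_vector_mult_3[of M] M del: transpose_matrix_vector)
         (simp add: algebra_simps)
  qed
  then have "is_pullback M (projective_form A B) (projective_form (binom_form d ?a ?b) (binom_form d ?c ?e))"
    unfolding is_pullback_def by (intro exI[of _ 1]) simp
  from that[OF inv det is_pullback_trans[OF pullback this]] show thesis .
qed

end

lemma exists_complex_root:
  assumes "c \<noteq> 0" "n > 0" obtains x :: complex where "x ^ n = c"
proof -
  have "exp (Ln c / of_nat n) ^ n = c" using assms by (simp flip: exp_of_nat_mult)
  then show thesis by (rule that)
qed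

lemma rescaled_chart:
  assumes \<alpha>: "\<alpha> \<noteq> 0" and k: "k \<noteq> 0" and g: "invertible g" "is_pullback g H (projective_form A B)"
    and A: "\<And>x y. eval2 A' (x, y) = k * \<alpha> * eval2 A (\<alpha> * x, y)"
    and B: "\<And>x y. eval2 B' (x, y) = k * eval2 B (\<alpha> * x, y)"
  shows "linearly_conjugate H (projective_form A' B')"
proof -
  define M :: "complex ^ 3 ^ 3" where "M = vector [vector [\<alpha>, 0, 0], vector [0, 1, 0], vector [0, 0, 1]]"
  have M: "M $ 1 = vector [\<alpha>, 0, 0]" "M $ 2 = vector [0, 1, 0]" "M $ 3 = vector [0, 0, 1]"
    unfolding M_def by (rule vector_3)+
  have "det M = \<alpha>" by (simp add: det_3 M)
  then have "invertible M" using \<alpha> by (simp add: invertible_det_nz)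
  then have inv: "invertible (g ** M)" by (rule invertible_mult[OF g(1)])
  have "eval_form (projective_form A' B') x = k *s (transpose M *v eval_form (projective_form A B) (M *v x))" for x
    unfolding eval_projective_form A B
    by (simp add: vec3_eq_iff transpose_vector_mult_3 matrix_vector_mult_3[of M] M del: transpose_matrix_vector)
       (simp add: algebra_simps)
  then have "is_pullback M (projective_form A B) (projective_form A' B')"
    unfolding is_pullback_def using k by blast
  from is_pullback_trans[OF g(2) this] inv show ?thesis unfolding linearly_conjugate_def by blast
qed

lemma conjugate_H1:
  assumes "d \<ge> 2" "b \<noteq> 0" "c \<noteq> 0" "invertible g" "is_pullback g H (projective_form (binom_form d 0 b) (binom_form d c 0))"
  shows "linearly_conjugate H (H1 d)"
proof -
  \<comment> \<open>\<open>x\<close> is scaled by \<open>\<alpha>\<close>: the coefficients \<open>b \<alpha>\<close> and \<open>c \<alpha>^d\<close> have to be opposite\<close>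
  obtain \<alpha> where \<alpha>: "\<alpha> ^ (d - 1) = - b / c" by (rule exists_complex_root[of "- b / c" "d - 1"]) (use assms in auto)
  have \<alpha>0: "\<alpha> \<noteq> 0" using \<alpha> assms by (auto simp: power_0_left split: if_splits)
  have "\<alpha> ^ d = \<alpha> ^ (d - 1) * \<alpha>" by (rule power_minus_mult[symmetric]) (use assms(1) in simp)
  then have "c * \<alpha> ^ d = c * (- b / c * \<alpha>)" unfolding \<alpha> by (rule arg_cong)
  then have \<alpha>d: "c * \<alpha> ^ d = - (\<alpha> * b)" using assms(3) by simp
  show ?thesis unfolding H1_def
  proof (rule rescaled_chart[OF \<alpha>0 _ assms(4,5), of "1 / (\<alpha> * b)"])
    show "1 / (\<alpha> * b) \<noteq> 0" using \<alpha>0 assms(2) by simp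
    show "eval2 (var_y ^ d) (x, y) = 1 / (\<alpha> * b) * \<alpha> * eval2 (binom_form d 0 b) (\<alpha> * x, y)" for x y
      using \<alpha>0 assms(2) by (simp add: eval2_binom_form)
    have "1 / (\<alpha> * b) * (c * (\<alpha> * x) ^ d) = (c * \<alpha> ^ d) / (\<alpha> * b) * x ^ d" for x by (simp add: power_mult_distrib)
    then show "eval2 (- (var_x ^ d)) (x, y) = 1 / (\<alpha> * b) * eval2 (binom_form d c 0) (\<alpha> * x, y)" for x y
      unfolding \<alpha>d using \<alpha>0 assms(2) by (simp add: eval2_binom_form)
  qed
qed

lemma conjugate_H2:
  assumes "a \<noteq> 0" "e \<noteq> 0" "invertible g" "is_pullback g H (projective_form (binom_form d a 0) (binom_form d 0 e))"
  shows "linearly_conjugate H (H2 d)"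
proof -
  \<comment> \<open>\<open>x\<close> is scaled by \<open>\<alpha>\<close>: the coefficients \<open>a \<alpha>^(d + 1)\<close> and \<open>e\<close> have to be opposite\<close>
  obtain \<alpha> where \<alpha>: "\<alpha> ^ (Suc d) = - e / a" by (rule exists_complex_root[of "- e / a" "Suc d"]) (use assms in auto)
  have \<alpha>0: "\<alpha> \<noteq> 0" using \<alpha> assms by auto
  have \<alpha>d: "\<alpha> * (a * \<alpha> ^ d) = - e" using \<alpha> assms(1) by (simp add: field_simps)
  show ?thesis unfolding H2_def
  proof (rule rescaled_chart[OF \<alpha>0 _ assms(3,4), of "- 1 / e"])
    show "- 1 / e \<noteq> 0" using assms(2) by simp
    have "- 1 / e * \<alpha> * (a * (\<alpha> * x) ^ d) = - (\<alpha> * (a * \<alpha> ^ d)) / e * x ^ d" for x by (simp add: power_mult_distrib)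
    then show "eval2 (var_x ^ d) (x, y) = - 1 / e * \<alpha> * eval2 (binom_form d a 0) (\<alpha> * x, y)" for x y
      unfolding \<alpha>d using assms(2) by (simp add: eval2_binom_form)
    show "eval2 (- (var_y ^ d)) (x, y) = - 1 / e * eval2 (binom_form d 0 e) (\<alpha> * x, y)" for x y
      using assms(2) by (simp add: eval2_binom_form)
  qed
qed

section \<open>Flatness of binomial webs\<close>

lemma legendre_form_standard_chart:
  "legendre_form d (projective_form (binom_form d a b) (binom_form d c e)) z w =
     aff (a, c, 0) z * apply_form (aff (0, 0, 0) z, aff (1, 0, 0) z) w ^ d +
     aff (b, e, 0) z * apply_form (aff (0, 0, -1) z, aff (0, 1, 0) z) w ^ d"
proof -
  let ?G = "projective_form (binom_form d a b) (binom_form d c e)"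
  have 1: "eval_form ?G v = 1 *s (transpose (mat 1) *v eval_form ?G (mat 1 *v v))" for v
    by (simp add: transpose_mat)
  have m: "(mat 1 :: complex ^ 3 ^ 3) $ i $ j = (if i = j then 1 else 0)" for i j by (simp add: mat_def)
  show ?thesis
    unfolding legendre_form_binomial[OF 1 eval2_binom_form eval2_binom_form]
    by (simp add: row_form_def cross_line_def aff_add m) (simp add: aff_def add.commute)
qed

text \<open>
  Where \<open>f\<close>, \<open>h\<close> and \<open>q\<close> do not vanish, the web is the product of \<open>f\<close> and the forms
  \<open>\<sigma>x - \<zeta> w \<sigma>y\<close>, with \<open>\<zeta>\<close> running over the \<open>d\<close>-th roots of unity and \<open>w^d = - h / f\<close>. The
  factor \<open>f\<close> is absorbed into the first of them.
\<close>

lemma binomial_web_decomposition: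
  assumes d: "d > 0" and ne: "a * e - b * c \<noteq> 0"
    and \<Omega>: "\<And>z w. \<Omega> z w = aff (a, c, 0) z * apply_form (aff (0, 0, 0) z, aff (1, 0, 0) z) w ^ d +
     aff (b, e, 0) z * apply_form (aff (0, 0, -1) z, aff (0, 1, 0) z) w ^ d"
  obtains U \<theta> p where "open U" "decomposition d \<Omega> U \<theta>" "(p, 1) \<in> U"
proof -
  define f where "f = aff (a, c, 0)"
  define h where "h = aff (b, e, 0)"
  have fz: "f z = a + c * fst z" and hz: "h z = b + e * fst z" for z by (simp_all add: f_def h_def aff_def)
  have "\<exists>p. a + c * p \<noteq> 0 \<and> b + e * p \<noteq> 0"
  proof -
    have "[:a, c:] * [:b, e:] \<noteq> 0" using ne by auto
    then obtain p where "poly ([:a, c:] * [:b, e:]) p \<noteq> 0" using poly_all_0_iff_0 by blast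
    then have "poly [:a, c:] p \<noteq> 0 \<and> poly [:b, e:] p \<noteq> 0" unfolding poly_mult by auto
    then show ?thesis by (intro exI[of _ p]) (simp add: mult.commute)
  qed
  then obtain p where p: "f (p, 1) \<noteq> 0" "h (p, 1) \<noteq> 0" unfolding fz hz by auto
  define s where "s z = - h z / f z" for z
  define s0 where "s0 = s (p, 1)"
  have s0: "s0 \<noteq> 0" using p by (simp add: s0_def s_def)
  define U where "U = {z. snd z \<noteq> 0} \<inter> {z. f z \<noteq> 0} \<inter> {z. h z \<noteq> 0} \<inter> (\<lambda>z. s z / s0) -` (- \<real>\<^sub>\<le>\<^sub>0)"
  have cont: "continuous_on S f" "continuous_on S h" for S
    unfolding f_def h_def aff_def by (intro continuous_intros)+
  have opV: "open ({z. snd z \<noteq> 0} \<inter> {z. f z \<noteq> 0} \<inter> {z. h z \<noteq> 0})"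
    by (intro open_Int open_Collect_neq continuous_intros cont)
  have "continuous_on ({z. snd z \<noteq> 0} \<inter> {z. f z \<noteq> 0} \<inter> {z. h z \<noteq> 0}) (\<lambda>z. s z / s0)"
    unfolding s_def using s0 by (intro continuous_intros cont) auto
  then have opU: "open U" unfolding U_def by (intro continuous_open_preimage opV open_Compl closed_nonpos_Reals_complex)
  have pU: "(p, 1) \<in> U" using p s0 by (simp add: U_def s0_def[symmetric])
  have nz: "snd z \<noteq> 0" "f z \<noteq> 0" "h z \<noteq> 0" "s z / s0 \<notin> \<real>\<^sub>\<le>\<^sub>0" if "z \<in> U" for z
    using that by (auto simp: U_def)
  \<comment> \<open>the quotient \<open>s z / s0\<close> is \<open>1\<close> at the chosen point and avoids the branch cut of the logarithm on \<open>U\<close>\<close>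
  define w where "w z = exp ((Ln s0 + Ln (s z / s0)) / of_nat d)" for z
  have w0: "w z \<noteq> 0" for z by (simp add: w_def)
  have wd: "w z ^ d = s z" if "z \<in> U" for z
  proof -
    have sz: "s z / s0 \<noteq> 0" using nz(4)[OF that] by auto
    have "w z ^ d = exp (Ln s0 + Ln (s z / s0))"
      unfolding w_def using d by (simp flip: exp_of_nat_mult)
    also have "\<dots> = s0 * (s z / s0)" unfolding exp_add using s0 sz by simp
    finally show ?thesis using s0 by simp
  qed
  have hs: "holomorphic2_on (\<lambda>z. - h z * inverse (f z) * (1 / s0)) U"
    unfolding f_def h_def
    by (intro holomorphic2_on_mult holomorphic2_on_minus holomorphic2_on_inverse holomorphic2_on_aff holomorphic2_on_const)
       (use nz in \<open>auto simp: f_def\<close>)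
  have hw: "holomorphic2_on w U"
  proof -
    have "holomorphic2_on (\<lambda>z. exp ((Ln s0 + Ln (- h z * inverse (f z) * (1 / s0))) / of_nat d)) U"
    proof (rule holomorphic2_on_compose[OF hs, of "\<lambda>x. exp ((Ln s0 + Ln x) / of_nat d)"])
      fix z assume z: "z \<in> U"
      have "- h z * inverse (f z) * (1 / s0) \<notin> \<real>\<^sub>\<le>\<^sub>0" using nz(4)[OF z] by (simp add: s_def field_simps)
      then have "(\<lambda>x. (Ln s0 + Ln x) / of_nat d) field_differentiable at (- h z * inverse (f z) * (1 / s0))"
        using d by (intro field_differentiable_divide field_differentiable_add field_differentiable_const field_differentiable_at_Ln) auto
      from field_differentiable_compose[OF this field_differentiable_within_exp]
      show "(\<lambda>x. exp ((Ln s0 + Ln x) / of_nat d)) field_differentiable at (- h z * inverse (f z) * (1 / s0))"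
        by (simp add: o_def)
    qed
    moreover have "- h z * inverse (f z) * (1 / s0) = s z / s0" for z by (simp add: s_def field_simps)
    ultimately show ?thesis unfolding w_def[abs_def] by simp
  qed
  define \<zeta> where "\<zeta> k = cis (2 * pi * real k / real d)" for k
  have bij: "bij_betw \<zeta> {..<d} {z. z ^ d = 1}" unfolding \<zeta>_def by (rule Complex.bij_betw_roots_unity[OF d])
  have \<zeta>_inj: "\<zeta> i \<noteq> \<zeta> j" if "i < d" "j < d" "i \<noteq> j" for i j
    using bij that unfolding bij_betw_def inj_on_def by auto
  define u where "u i z = (if i = (0::nat) then f z else 1)" for i z
  define \<theta> where "\<theta> i z = (u i z * (\<zeta> i * (w z * snd z)), u i z * (1 - \<zeta> i * (w z * fst z)))" for i z
  have u0: "u i z \<noteq> 0" if "z \<in> U" for i z using nz[OF that] by (simp add: u_def)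
  have hu: "holomorphic2_on (u i) U" for i
    unfolding u_def f_def by (cases "i = 0") (simp_all add: holomorphic2_on_aff)
  have \<theta>w: "apply_form (\<theta> i z) v = u i z * (apply_form (aff (0, 0, 0) z, aff (1, 0, 0) z) v -
      \<zeta> i * (w z * apply_form (aff (0, 0, -1) z, aff (0, 1, 0) z) v))" for i z v
    by (simp add: \<theta>_def apply_form_def aff_def algebra_simps)
  have "decomposition d \<Omega> U \<theta>"
    unfolding decomposition_def
  proof (intro conjI allI impI ballI)
    fix i
    show "holomorphic2_on (\<lambda>z. fst (\<theta> i z)) U" "holomorphic2_on (\<lambda>z. snd (\<theta> i z)) U"
      unfolding \<theta>_def fst_conv snd_conv
      by (intro holomorphic2_on_mult holomorphic2_on_diff holomorphic2_on_const holomorphic2_on_fst holomorphic2_on_snd hu hw)+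
  next
    fix i j z assume ij: "i < d" "j < d" "i \<noteq> j" and z: "z \<in> U"
    have "delta \<theta> i j z = u i z * u j z * w z * snd z * (\<zeta> i - \<zeta> j)"
      by (simp add: delta_def wedge_def \<theta>_def algebra_simps)
    then show "delta \<theta> i j z \<noteq> 0" using u0[OF z] w0 nz(1)[OF z] \<zeta>_inj[OF ij] by simp
  next
    fix z v assume z: "z \<in> U"
    let ?X = "apply_form (aff (0, 0, 0) z, aff (1, 0, 0) z) v" and ?Y = "apply_form (aff (0, 0, -1) z, aff (0, 1, 0) z) v"
    have "(\<Prod>i<d. apply_form (\<theta> i z) v) = (\<Prod>i<d. u i z) * (\<Prod>i<d. ?X - \<zeta> i * (w z * ?Y))"
      unfolding \<theta>w by (rule prod.distrib)
    also have "(\<Prod>i<d. u i z) = f z" unfolding u_def using d by (simp add: prod.delta)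
    also have "(\<Prod>i<d. ?X - \<zeta> i * (w z * ?Y)) = ?X ^ d - s z * ?Y ^ d"
      unfolding \<zeta>_def prod_roots_unity[OF d] by (simp add: power_mult_distrib wd[OF z])
    also have "f z * (?X ^ d - s z * ?Y ^ d) = f z * ?X ^ d + h z * ?Y ^ d"
      using nz(2)[OF z] by (simp add: s_def field_simps)
    also have "\<dots> = \<Omega> z v" by (simp only: \<Omega> f_def h_def)
    finally show "\<Omega> z v = (\<Prod>i<d. apply_form (\<theta> i z) v)" by simp
  qed
  from that[OF opU this pU] show thesis .
qed

text \<open>
  Here \<open>f = a + c p\<close> and \<open>h = b + e p\<close>. The partial derivative of the coefficient of \<open>\<kappa>\<close>
  with respect to \<open>p\<close> vanishes if and only if \<open>e b f^2 = c a h^2\<close>, which is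
  \<open>(a e - b c) (a b - e c p^2) = 0\<close>. As this holds on a nonempty open set of values of \<open>p\<close>,
  the coefficients \<open>a b\<close> and \<open>e c\<close> are zero.
\<close>

lemma flat_binomial_web:
  assumes d: "d \<ge> 3" and ne: "a * e - b * c \<noteq> 0"
    and flat: "flat_form d (legendre_form d (projective_form (binom_form d a b) (binom_form d c e)))"
  shows "a * b = 0" "e * c = 0"
proof -
  let ?\<Omega> = "legendre_form d (projective_form (binom_form d a b) (binom_form d c e))"
  have d0: "d > 0" using d by simp
  obtain U \<theta> p where U: "open U" "decomposition d ?\<Omega> U \<theta>" "(p, 1) \<in> U"
    by (rule binomial_web_decomposition[OF d0 ne legendre_form_standard_chart])
  define D where "D = (of_nat d :: complex)"
  have D0: "D \<noteq> 0" using d by (simp add: D_def)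
  define \<kappa> :: form1 where "\<kappa> z = (0, (2 + fst z * (e / aff (b, e, 0) z - c / aff (a, c, 0) z) / D) / aff (0, 0, 1) z)" for z
  have partial: "has_partials (\<lambda>z. fst (\<kappa> z)) (0, 0) z"
    "\<exists>Q. has_partials (\<lambda>z. snd (\<kappa> z)) Q z \<and>
       fst Q = (e * b / (aff (b, e, 0) z)\<^sup>2 - c * a / (aff (a, c, 0) z)\<^sup>2) / D / aff (0, 0, 1) z"
    if "aff (a, c, 0) z \<noteq> 0" "aff (b, e, 0) z \<noteq> 0" "aff (0, 0, 1) z \<noteq> 0" for z
  proof -
    show "has_partials (\<lambda>z. fst (\<kappa> z)) (0, 0) z" by (simp add: \<kappa>_def has_partials_const)
    define k where "k u = (2 + u * (e / (b + e * u) - c / (a + c * u)) / D) / snd z" for u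
    have nz: "a + c * fst z \<noteq> 0" "b + e * fst z \<noteq> 0" "snd z \<noteq> 0" using that by (simp_all add: aff_def)
    have 1: "((\<lambda>u. snd (\<kappa> (u, snd z))) has_field_derivative
       (e * b / (aff (b, e, 0) z)\<^sup>2 - c * a / (aff (a, c, 0) z)\<^sup>2) / D / aff (0, 0, 1) z) (at (fst z))"
    proof -
      let ?h = "b + e * fst z" and ?f = "a + c * fst z"
      have q: "((\<lambda>u. u * x / (y + x * u)) has_field_derivative x * y / (y + x * fst z)\<^sup>2) (at (fst z))"
        if "y + x * fst z \<noteq> 0" for x y
      proof -
        have "((\<lambda>u. u * x) has_field_derivative x) (at (fst z))" "((\<lambda>u. y + x * u) has_field_derivative x) (at (fst z))"
          by (auto intro!: derivative_eq_intros)
        from DERIV_divide[OF this that] show ?thesis by (simp add: power2_eq_square algebra_simps)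
      qed
      have "((\<lambda>u. (2 + (u * e / (b + e * u) - u * c / (a + c * u)) / D) / snd z) has_field_derivative
          (0 + (e * b / ?h\<^sup>2 - c * a / ?f\<^sup>2) / D) / snd z) (at (fst z))"
        by (intro DERIV_cdivide DERIV_add DERIV_const DERIV_diff q nz)
      then show ?thesis by (simp add: \<kappa>_def aff_def right_diff_distrib)
    qed
    have "((\<lambda>v. snd (\<kappa> (fst z, v))) has_field_derivative
       - (2 + fst z * (e / (b + e * fst z) - c / (a + c * fst z)) / D) / (snd z)\<^sup>2) (at (snd z))"
    proof -
      have "((\<lambda>v. K / v) has_field_derivative - K / (snd z)\<^sup>2) (at (snd z))" for K
        using DERIV_divide[OF DERIV_const DERIV_ident nz(3), of K] by (simp add: power2_eq_square)
      from this[of "2 + fst z * (e / (b + e * fst z) - c / (a + c * fst z)) / D"]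
      show ?thesis by (simp add: \<kappa>_def aff_def)
    qed
    with 1 have "has_partials (\<lambda>z. snd (\<kappa> z))
       ((e * b / (aff (b, e, 0) z)\<^sup>2 - c * a / (aff (a, c, 0) z)\<^sup>2) / D / aff (0, 0, 1) z,
        - (2 + fst z * (e / (b + e * fst z) - c / (a + c * fst z)) / D) / (snd z)\<^sup>2) z"
      unfolding has_partials_def fst_conv snd_conv by (rule conjI)
    then show "\<exists>Q. has_partials (\<lambda>z. snd (\<kappa> z)) Q z \<and>
       fst Q = (e * b / (aff (b, e, 0) z)\<^sup>2 - c * a / (aff (a, c, 0) z)\<^sup>2) / D / aff (0, 0, 1) z"
      by (intro exI conjI) (assumption, simp)
  qed
  have \<kappa>: "wedge (\<kappa> z) (aff (0, 0, 0) z, aff (1, 0, 0) z) = fst (snd (1, 0, 0)) - snd (snd (0, 0, 0)) \<and>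
      wedge (\<kappa> z - smul (1 / of_nat d) (dlog_aff (b, e, 0) z - dlog_aff (a, c, 0) z)) (aff (0, 0, -1) z, aff (0, 1, 0) z) =
        fst (snd (0, 1, 0)) - snd (snd (0, 0, -1)) \<and> form_has_partials \<kappa> z"
    if nv: "aff (a, c, 0) z \<noteq> 0" "aff (b, e, 0) z \<noteq> 0" "aff (0, 0, 1) z \<noteq> 0" for z
  proof (intro conjI)
    show "wedge (\<kappa> z) (aff (0, 0, 0) z, aff (1, 0, 0) z) = fst (snd (1, 0, 0)) - snd (snd (0, 0, 0))"
      by (simp add: \<kappa>_def wedge_def aff_def)
    define x where "x = e / aff (b, e, 0) z - c / aff (a, c, 0) z"
    have "wedge (\<kappa> z - smul (1 / of_nat d) (dlog_aff (b, e, 0) z - dlog_aff (a, c, 0) z)) (- snd z, fst z) =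
       - (x / D) * fst z + (2 + fst z * x / D) / snd z * snd z"
      by (simp add: \<kappa>_def wedge_def smul_def dlog_aff_def D_def[symmetric] x_def[symmetric]) (simp add: aff_def)
    also have "\<dots> = 2" using nv(3) by (simp add: aff_def)
    finally show "wedge (\<kappa> z - smul (1 / of_nat d) (dlog_aff (b, e, 0) z - dlog_aff (a, c, 0) z)) (aff (0, 0, -1) z, aff (0, 1, 0) z) =
        fst (snd (0, 1, 0)) - snd (snd (0, 0, -1))" by (simp add: aff_def)
    show "form_has_partials \<kappa> z" unfolding form_has_partials_def using partial[OF nv] by blast
  qed
  have n: "wedge (aff (0, 0, 0) z, aff (1, 0, 0) z) (aff (0, 0, -1) z, aff (0, 1, 0) z) = aff (0, 0, 1) z" for z
    by (simp add: wedge_def aff_def)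
  have key: "(a * e - b * c) * (a * b - e * c * x\<^sup>2) = 0" if x: "(x, 1) \<in> U" for x
  proof -
    note web = curvature_binomial_web[OF d U(1,2) legendre_form_standard_chart refl refl n \<kappa> x]
    have nv: "aff (a, c, 0) (x, 1) \<noteq> 0" "aff (b, e, 0) (x, 1) \<noteq> 0" "aff (0, 0, 1) (x, 1) \<noteq> 0" using web(2-4) by auto
    have "curvature d \<theta> (x, 1) = 0" using flat U x unfolding flat_form_def by blast
    with web(1) have "of_nat (d choose 3) * ext_deriv \<kappa> (x, 1) = 0" by simp
    then have 0: "ext_deriv \<kappa> (x, 1) = 0" using d by simp
    obtain Q where Q: "has_partials (\<lambda>z. snd (\<kappa> z)) Q (x, 1)"
      "fst Q = (e * b / (aff (b, e, 0) (x, 1))\<^sup>2 - c * a / (aff (a, c, 0) (x, 1))\<^sup>2) / D / aff (0, 0, 1) (x, 1)"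
      using partial(2)[OF nv] by blast
    have "fst Q = 0" using ext_deriv_eqI[OF partial(1)[OF nv] Q(1)] 0 by simp
    then have "e * b / (b + e * x)\<^sup>2 = c * a / (a + c * x)\<^sup>2" using D0 unfolding Q(2) by (simp add: aff_def)
    then have "e * b * (a + c * x)\<^sup>2 = c * a * (b + e * x)\<^sup>2" using nv(1,2) by (simp add: aff_def frac_eq_eq)
    then show ?thesis by (simp add: power2_eq_square algebra_simps)
  qed
  have "[:a * b, 0, - (e * c):] = 0"
  proof (rule ccontr)
    assume "[:a * b, 0, - (e * c):] \<noteq> 0"
    then have fin: "finite {x. poly [:a * b, 0, - (e * c):] x = 0}" by (rule poly_roots_finite)
    have "open ((\<lambda>x. (x, 1 :: complex)) -` U)" by (intro open_vimage U(1) continuous_intros)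
    moreover have "p \<in> (\<lambda>x. (x, 1 :: complex)) -` U" using U(3) by simp
    ultimately have "infinite ((\<lambda>x. (x, 1 :: complex)) -` U)" using finite_imp_not_open by blast
    moreover have "(\<lambda>x. (x, 1 :: complex)) -` U \<subseteq> {x. poly [:a * b, 0, - (e * c):] x = 0}"
    proof
      fix x assume "x \<in> (\<lambda>x. (x, 1 :: complex)) -` U"
      then have "a * b - e * c * x\<^sup>2 = 0" using key ne by auto
      then show "x \<in> {x. poly [:a * b, 0, - (e * c):] x = 0}" by (simp add: power2_eq_square algebra_simps)
    qed
    ultimately show False using fin finite_subset by blast
  qed
  then show "a * b = 0" "e * c = 0" by simp_all
qed

theorem proposition2p15:
  fixes d :: nat and H :: form3 and g :: "complex ^ 3 ^ 3" and A B :: poly2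
  assumes "d \<ge> 3"
    and "homogeneous_foliation d H"
    and "described_in_chart d H g A B"
    and "size (foliation_type d H A B) = 2"
  shows "flat_web d (Leg d H) \<longleftrightarrow>
         linearly_conjugate H (H1 d) \<or> linearly_conjugate H (H2 d)"
proof
  assume flat: "flat_web d (Leg d H)"
  interpret homogeneous_chart d H g A B
    by unfold_locales (use assms in auto)
  obtain g' a b c e where g': "invertible g'" "a * e - b * c \<noteq> 0"
    "is_pullback g' H (projective_form (binom_form d a b) (binom_form d c e))"
    by (rule binomial_chart[OF assms(4)])
  have "legendre_form d (projective_form (binom_form d a b) (binom_form d c e)) \<in> Leg d H"
    unfolding Leg_def using g'(1,3) by blast
  then have "flat_form d (legendre_form d (projective_form (binom_form d a b) (binom_form d c e)))"
    using flat unfolding flat_web_def by blast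
  note zero = flat_binomial_web[OF assms(1) g'(2) this]
  show "linearly_conjugate H (H1 d) \<or> linearly_conjugate H (H2 d)"
  proof (cases "a = 0")
    case True
    then have "b \<noteq> 0" "c \<noteq> 0" "e = 0" using g'(2) zero by auto
    then show ?thesis using conjugate_H1[OF d_ge_2 _ _ g'(1)] g'(3) True by simp
  next
    case False
    then have "b = 0" "e \<noteq> 0" "c = 0" using g'(2) zero by auto
    then show ?thesis using conjugate_H2[OF False _ g'(1)] g'(3) by simp
  qed
next
  assume "linearly_conjugate H (H1 d) \<or> linearly_conjugate H (H2 d)"
  then show "flat_web d (Leg d H)" by (rule flat_web_if_conjugate[OF assms(1)])
qed

end
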